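(* Let $W$ be a finite window size with $W\ge1$, and suppose that $(\tau_\pi,\pi)$, with $\pi$ an open-loop policy of window size $W$ and $\tau_\pi$ the GLR CuSum stopping time, is an asymptotically optimal solution as $\gamma\to\infty$ of $$\min_{\tau,\pi}\ \mathrm{WADD}(\tau,\pi)\quad\text{s.t.}\quad \mathrm{ARL}(\tau,\pi)\ge\gamma,\quad \mathrm{AOSC}(\pi)\le\alpha_{\mathrm{AOSC}},$$ over stopping times and open-loop policies of window size $W$. Then there exists an open-loop policy $\pi_1$ of window size $1$ such that $\mathrm{AOSC}(\pi_1)=\mathrm{AOSC}(\pi)$ and $$\mathrm{WADD}(\tau_{\pi_1},\pi_1)\asymp\mathrm{WADD}(\tau_\pi,\pi)\quad\text{as }\gamma\to\infty.$$
   Context: Signal model. $p_0,p_1,\dots,p_M$ are distinct pdfs on $\mathbb{R}^N$. The signal $X_1,X_2,\dots$ is a sequence of independent random vectors with $X_t\sim p_0$ for $t<\nu$ and $X_t\sim p_m$ for $t\ge\nu$, where the change point $\nu\ge 0$ and $m\in\{1,\dots,M\}$ are unknown deterministic constants. There is a finite set of actions $\mathcal{A}=\{1,\dots,|\mathcal{A}|\}$. At each time $t$ an action $A_t\in\mathcal{A}$ is chosen and the pair $(A_t,Y_t)$ is observed, where $Y_t=A_t(X_t)$ is a function of $X_t$ determined by the action. $p_m(\cdot\mid a)$ denotes the conditional pdf of $Y_t$ given $A_t=a$ when $X_t\sim p_m$; given $A_t$, $Y_t$ is conditionally independent of $Y_1,\dots,Y_{t-1},A_1,\dots,A_{t-1}$.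 For each $m\in\{1,\dots,M\}$ there is an action $a$ under which $p_0$ and $p_m$ are distinguishable, i.e. $p_m(\cdot\mid a)\ne p_0(\cdot\mid a)$. $\mathbb{P}_{\nu,m},\mathbb{E}_{\nu,m}$ denote probability and expectation when the change point is $\nu$ and the post-change pdf is $p_m$; $\mathbb{P}_\infty,\mathbb{E}_\infty$ when there is no change. $a^{k:t}=(a_k,\dots,a_t)$. Stopping times are with respect to the observed sequence $(A_t,Y_t)_{t\ge1}$. Open-loop policies. An open-loop policy of window size $W$ chooses $A_{t+1}$, for $t\ge W$, by a fixed (time-independent) randomized function of the past $W$ actions; equivalently, it is a Markov chain of order $W$ on $\mathcal{A}$, written $\pi=(q,T)$, where $q$ is the distribution of $A^{1:W}$ on $\mathcal{A}^W$ and $T$ is the transition matrix of the $\mathcal{A}^W$-valued chain of windows $A^{t-W+1:t}$. Performance measures. $\mathrm{WADD}(\tau,\pi)=\max_{1\le m\le M}\mathrm{WADD}_m(\tau,\pi)$ with $\mathrm{WADD}_m(\tau,\pi)=\sup_{\nu\ge1}\operatorname{ess\,sup}\mathbb{E}_{\nu,m}[(\tau-\nu+1)^+\mid A^{1:(\nu-1)},Y^{1:(\nu-1)}]$; $\mathrm{ARL}(\tau,\pi)=\mathbb{E}_\infty[\tau]$. Given a cost matrix $\mathcal{C}\in\mathbb{R}^{|\mathcal{A}|\times|\mathcal{A}|}$, $\mathcal{C}[i,j]$ being the cost of switching from action $i$ to action $j$, $\mathrm{AOSC}(\pi)=\limsup_{n\to\infty}\frac1n\mathbb{E}_\infty\big[\sum_{t=2}^{n+1}\mathcal{C}[A_{t-1},A_t]\big]$.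 $\alpha_{\mathrm{AOSC}}$ is a given threshold. GLR CuSum. $S_m(0,\pi)=0$, $S_m(t,\pi)=\big(S_m(t-1,\pi)+\log\frac{p_m(Y_t\mid A_t)}{p_0(Y_t\mid A_t)}\big)^+$, $S(t,\pi)=\max_{1\le m\le M}S_m(t,\pi)$, and $\tau_\pi=\tau_\pi(\gamma)=\inf\{t: S(t,\pi)>\log(M\gamma)\}$. $f\asymp g$ means $\lim f/g=1$. A solution (family indexed by $\gamma$) is asymptotically optimal as $\gamma\to\infty$ if it is feasible for the problem for each $\gamma$ and its objective value is $\asymp$ the optimal value of the problem as $\gamma\to\infty$.
   Formalization: The formal theorem additionally assumes that for every m in {1,…,M} and every action a the Kullback–Leibler divergence of p_m(·|a) from p_0(·|a) is finite; without this the claim can fail, for instance when one sample of an action detects the change with certainty. *)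

theory Defs
  imports "HOL-Probability.Probability"
begin

section \<open>Signal model\<close>

text \<open>
  \<open>pdf m\<close> is \<open>p\<^sub>m\<close> on Euclidean space, \<open>act a\<close> is the map through which action \<open>a\<close> observes
  the signal, and \<open>obs_pdf m a\<close> is \<open>p\<^sub>m(\<cdot> | a)\<close>. Different actions may return objects of
  different dimension, so the observations live in an arbitrary measurable space, and
  \<open>p\<^sub>m(\<cdot> | a)\<close> is a density with respect to a dominating measure \<open>ref_measure a\<close> that may depend
  on \<open>a\<close> but not on \<open>m\<close> (Lebesgue measure of the appropriate dimension, for instance).
  The set of actions is the finite type \<open>'act\<close>.
\<close>

record ('n, 'act, 'y) signal_model =
  num_hyp :: nat
  pdf :: "nat \<Rightarrow> real ^ 'n::finite \<Rightarrow> real"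
  act :: "'act \<Rightarrow> real ^ 'n \<Rightarrow> 'y"
  obs_space :: "'y measure"
  ref_measure :: "'act \<Rightarrow> 'y measure"
  obs_pdf :: "nat \<Rightarrow> 'act \<Rightarrow> 'y \<Rightarrow> real"

definition signal_law :: "('n::finite, 'act, 'y) signal_model \<Rightarrow> nat \<Rightarrow> (real ^ 'n) measure" where
  "signal_law S m = density lborel (\<lambda>x. ennreal (pdf S m x))"

definition obs_law :: "('n::finite, 'act, 'y) signal_model \<Rightarrow> nat \<Rightarrow> 'act \<Rightarrow> 'y measure" where
  "obs_law S m a = distr (signal_law S m) (obs_space S) (act S a)"

definition signal_model :: "('n::finite, 'act::finite, 'y) signal_model \<Rightarrow> bool" where
  "signal_model S \<longleftrightarrow>
     num_hyp S \<ge> 1 \<and>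
     (\<forall>m\<le>num_hyp S. pdf S m \<in> borel_measurable borel \<and> (\<forall>x. 0 \<le> pdf S m x) \<and>
        (\<integral>\<^sup>+x. ennreal (pdf S m x) \<partial>lborel) = 1) \<and>
     (\<forall>i\<le>num_hyp S. \<forall>j\<le>num_hyp S. i \<noteq> j \<longrightarrow> signal_law S i \<noteq> signal_law S j) \<and>
     (\<forall>a. act S a \<in> borel \<rightarrow>\<^sub>M obs_space S) \<and>
     (\<forall>a. sigma_finite_measure (ref_measure S a) \<and> sets (ref_measure S a) = sets (obs_space S)) \<and>
     (\<forall>m\<le>num_hyp S. \<forall>a. obs_pdf S m a \<in> borel_measurable (obs_space S) \<and>
        (\<forall>y. 0 \<le> obs_pdf S m a y) \<and>
        obs_law S m a = density (ref_measure S a) (\<lambda>y. ennreal (obs_pdf S m a y))) \<and>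
     (\<forall>m\<in>{1..num_hyp S}. \<exists>a. obs_law S m a \<noteq> obs_law S 0 a)"

text \<open>
  Finiteness of the Kullback-Leibler divergences of \<open>p\<^sub>m(\<cdot> | a)\<close> from \<open>p\<^sub>0(\<cdot> | a)\<close>. The library
  defines \<^const>\<open>KL_divergence\<close> as a Bochner integral, which is \<open>0\<close> rather than infinite when the
  integrand is not integrable; hence absolute continuity and integrability are what has to be said.
\<close>

definition finite_KL :: "('n::finite, 'act::finite, 'y) signal_model \<Rightarrow> bool" where
  "finite_KL S \<longleftrightarrow> (\<forall>m\<in>{1..num_hyp S}. \<forall>a.
     absolutely_continuous (obs_law S 0 a) (obs_law S m a) \<and>
     integrable (obs_law S m a) (entropy_density (exp 1) (obs_law S 0 a) (obs_law S m a)))"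


section \<open>Open-loop policies\<close>

text \<open>
  A policy \<open>(q, T)\<close>: \<open>q\<close> is the law of the first window and \<open>T\<close> the transition matrix of the
  chain of windows. A window is the list of its actions, oldest first, and a transition drops the
  oldest action and appends the new one.
\<close>

type_synonym 'act policy = "'act list pmf \<times> ('act list \<Rightarrow> 'act list pmf)"

definition open_loop_policy :: "nat \<Rightarrow> 'act policy \<Rightarrow> bool" where
  "open_loop_policy W \<pi> \<longleftrightarrow>
     (\<forall>w\<in>set_pmf (fst \<pi>). length w = W) \<and>
     (\<forall>w. length w = W \<longrightarrow> (\<forall>w'\<in>set_pmf (snd \<pi> w). \<exists>a. w' = tl w @ [a]))"

definition window_kernel :: "'act policy \<Rightarrow> nat \<Rightarrow> (nat \<Rightarrow> 'act list) \<Rightarrow> 'act list measure" where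
  "window_kernel \<pi> k \<omega> =
     measure_pmf (case k of 0 \<Rightarrow> fst \<pi> | Suc j \<Rightarrow> snd \<pi> (\<omega> j))"

text \<open>
  The law of the chain of windows, by the Ionescu-Tulcea theorem. Coordinate \<open>k\<close> is the window
  \<open>(A\<^sub>k\<^sub>+\<^sub>1, \<dots>, A\<^sub>k\<^sub>+\<^sub>W)\<close>, so for \<open>t \<ge> 1\<close> the action \<open>A\<^sub>t\<close> is the head of coordinate \<open>t - 1\<close>.
\<close>

definition window_measure :: "'act policy \<Rightarrow> (nat \<Rightarrow> 'act list) measure" where
  "window_measure \<pi> =
     projective_family.lim UNIV
       (Ionescu_Tulcea.CI (window_kernel \<pi>) (\<lambda>_. count_space UNIV)) (\<lambda>_. count_space UNIV)"

definition action_at :: "(nat \<Rightarrow> 'act list) \<Rightarrow> nat \<Rightarrow> 'act" where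
  "action_at w t = hd (w (t - 1))"


section \<open>Law of the observed sequence\<close>

definition obs_seq_space ::
    "('n::finite, 'act, 'y) signal_model \<Rightarrow> (nat \<Rightarrow> 'act \<times> 'y) measure" where
  "obs_seq_space S = PiM {1..} (\<lambda>_. count_space UNIV \<Otimes>\<^sub>M obs_space S)"

text \<open>
  The law of \<open>(A\<^sub>t, Y\<^sub>t)\<^sub>t\<^sub>\<ge>\<^sub>1\<close> for change point \<open>\<nu>\<close> and post-change hypothesis \<open>m\<close>. An open-loop
  policy ignores the observations, so windows and signal are independent, and \<open>Y\<^sub>t = A\<^sub>t(X\<^sub>t)\<close>.
\<close>

definition obs_measure ::
    "('n::finite, 'act::finite, 'y) signal_model \<Rightarrow> 'act policy \<Rightarrow> enat \<Rightarrow> nat \<Rightarrow>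
     (nat \<Rightarrow> 'act \<times> 'y) measure" where
  "obs_measure S \<pi> \<nu> m =
     distr (window_measure \<pi> \<Otimes>\<^sub>M PiM {1..} (\<lambda>t. signal_law S (if enat t < \<nu> then 0 else m)))
       (obs_seq_space S)
       (\<lambda>(w, x). \<lambda>t\<in>{1..}. (action_at w t, act S (action_at w t) (x t)))"

abbreviation no_change_measure ::
    "('n::finite, 'act::finite, 'y) signal_model \<Rightarrow> 'act policy \<Rightarrow> (nat \<Rightarrow> 'act \<times> 'y) measure" where
  "no_change_measure S \<pi> \<equiv> obs_measure S \<pi> \<infinity> 0"

text \<open>The \<open>\<sigma>\<close>-algebra generated by \<open>(A\<^sub>1, Y\<^sub>1), \<dots>, (A\<^sub>n, Y\<^sub>n)\<close>; time \<open>\<infinity>\<close> is included.\<close>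

definition obs_filtration ::
    "('n::finite, 'act, 'y) signal_model \<Rightarrow> enat \<Rightarrow> (nat \<Rightarrow> 'act \<times> 'y) measure" where
  "obs_filtration S n =
     vimage_algebra (space (obs_seq_space S))
       (\<lambda>\<omega>. restrict \<omega> {t. 1 \<le> t \<and> enat t \<le> n})
       (PiM {t. 1 \<le> t \<and> enat t \<le> n} (\<lambda>_. count_space UNIV \<Otimes>\<^sub>M obs_space S))"


section \<open>Performance measures\<close>

text \<open>In \<^typ>\<open>enat\<close> the difference is truncated at \<open>0\<close>, so \<open>\<tau> + 1 - \<nu>\<close> is \<open>(\<tau> - \<nu> + 1)\<^sup>+\<close>.\<close>

definition WADD_hyp ::
    "('n::finite, 'act::finite, 'y) signal_model \<Rightarrow> nat \<Rightarrow>
     ((nat \<Rightarrow> 'act \<times> 'y) \<Rightarrow> enat) \<Rightarrow> 'act policy \<Rightarrow> ennreal" where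
  "WADD_hyp S m \<tau> \<pi> =
     (SUP \<nu>\<in>{1..}. esssup (obs_measure S \<pi> (enat \<nu>) m)
        (nn_cond_exp (obs_measure S \<pi> (enat \<nu>) m) (obs_filtration S (enat (\<nu> - 1)))
           (\<lambda>\<omega>. ennreal_of_enat (\<tau> \<omega> + 1 - enat \<nu>))))"

definition WADD ::
    "('n::finite, 'act::finite, 'y) signal_model \<Rightarrow>
     ((nat \<Rightarrow> 'act \<times> 'y) \<Rightarrow> enat) \<Rightarrow> 'act policy \<Rightarrow> ennreal" where
  "WADD S \<tau> \<pi> = (MAX m\<in>{1..num_hyp S}. WADD_hyp S m \<tau> \<pi>)"

definition ARL ::
    "('n::finite, 'act::finite, 'y) signal_model \<Rightarrow>
     ((nat \<Rightarrow> 'act \<times> 'y) \<Rightarrow> enat) \<Rightarrow> 'act policy \<Rightarrow> ennreal" where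
  "ARL S \<tau> \<pi> = (\<integral>\<^sup>+\<omega>. ennreal_of_enat (\<tau> \<omega>) \<partial>no_change_measure S \<pi>)"

definition AOSC ::
    "('n::finite, 'act::finite, 'y) signal_model \<Rightarrow> real ^ 'act ^ 'act \<Rightarrow> 'act policy \<Rightarrow> ereal" where
  "AOSC S C \<pi> =
     limsup (\<lambda>n. ereal (1 / real n *
       (\<integral>\<omega>. (\<Sum>t=2..n + 1. C $ fst (\<omega> (t - 1)) $ fst (\<omega> t)) \<partial>no_change_measure S \<pi>)))"


section \<open>GLR CuSum\<close>

text \<open>
  The logarithm of the likelihood ratio, as an extended real because either density may vanish
  (the library has \<open>ln 0 = 0\<close>). Points where both vanish have probability \<open>0\<close> whenever
  \<open>p\<^sub>m(\<cdot> | a)\<close> or \<open>p\<^sub>0(\<cdot> | a)\<close> is the true density.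
\<close>

definition llr ::
    "('n::finite, 'act, 'y) signal_model \<Rightarrow> nat \<Rightarrow> 'act \<times> 'y \<Rightarrow> ereal" where
  "llr S m = (\<lambda>(a, y).
     if obs_pdf S m a y = 0 then -\<infinity>
     else if obs_pdf S 0 a y = 0 then \<infinity>
     else ereal (ln (obs_pdf S m a y / obs_pdf S 0 a y)))"

primrec cusum ::
    "('n::finite, 'act, 'y) signal_model \<Rightarrow> nat \<Rightarrow> nat \<Rightarrow> (nat \<Rightarrow> 'act \<times> 'y) \<Rightarrow> ereal" where
  "cusum S m 0 \<omega> = 0"
| "cusum S m (Suc t) \<omega> = max 0 (cusum S m t \<omega> + llr S m (\<omega> (Suc t)))"

definition glr_statistic ::
    "('n::finite, 'act, 'y) signal_model \<Rightarrow> nat \<Rightarrow> (nat \<Rightarrow> 'act \<times> 'y) \<Rightarrow> ereal" where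
  "glr_statistic S t \<omega> = (MAX m\<in>{1..num_hyp S}. cusum S m t \<omega>)"

text \<open>
  As a function of the observed sequence the stopping time \<open>\<tau>\<^sub>\<pi>(\<gamma>)\<close> is the same for every policy;
  the dependence on \<open>\<pi>\<close> is through the law of that sequence.
\<close>

definition glr_cusum ::
    "('n::finite, 'act, 'y) signal_model \<Rightarrow> real \<Rightarrow> (nat \<Rightarrow> 'act \<times> 'y) \<Rightarrow> enat" where
  "glr_cusum S \<gamma> \<omega> =
     Inf {enat t |t. glr_statistic S t \<omega> > ereal (ln (real (num_hyp S) * \<gamma>))}"


section \<open>Asymptotic optimality\<close>

definition asymp_eq :: "(real \<Rightarrow> ennreal) \<Rightarrow> (real \<Rightarrow> ennreal) \<Rightarrow> bool" where
  "asymp_eq f g \<longleftrightarrow> ((\<lambda>\<gamma>. f \<gamma> / g \<gamma>) \<longlongrightarrow> 1) at_top"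

definition feasible ::
    "('n::finite, 'act::finite, 'y) signal_model \<Rightarrow> real ^ 'act ^ 'act \<Rightarrow> real \<Rightarrow> nat \<Rightarrow> real \<Rightarrow>
     ((nat \<Rightarrow> 'act \<times> 'y) \<Rightarrow> enat) \<Rightarrow> 'act policy \<Rightarrow> bool" where
  "feasible S C \<alpha> W \<gamma> \<tau> \<pi> \<longleftrightarrow>
     stopping_time (obs_filtration S) \<tau> \<and> open_loop_policy W \<pi> \<and>
     ARL S \<tau> \<pi> \<ge> ennreal \<gamma> \<and> AOSC S C \<pi> \<le> ereal \<alpha>"

definition optimal_WADD ::
    "('n::finite, 'act::finite, 'y) signal_model \<Rightarrow> real ^ 'act ^ 'act \<Rightarrow> real \<Rightarrow> nat \<Rightarrow> real \<Rightarrow>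
     ennreal" where
  "optimal_WADD S C \<alpha> W \<gamma> = Inf {WADD S \<tau> \<pi> |\<tau> \<pi>. feasible S C \<alpha> W \<gamma> \<tau> \<pi>}"

text \<open>
  The bound \<open>\<gamma>\<close> on the average run length is at least \<open>1\<close>. (For \<open>\<gamma> < 1 / M\<close> the threshold
  \<open>log (M \<gamma>)\<close> is negative and the GLR CuSum stops at time \<open>0\<close>.)
\<close>

definition asymp_optimal ::
    "('n::finite, 'act::finite, 'y) signal_model \<Rightarrow> real ^ 'act ^ 'act \<Rightarrow> real \<Rightarrow> nat \<Rightarrow>
     (real \<Rightarrow> (nat \<Rightarrow> 'act \<times> 'y) \<Rightarrow> enat) \<Rightarrow> (real \<Rightarrow> 'act policy) \<Rightarrow> bool" where
  "asymp_optimal S C \<alpha> W \<tau> \<pi> \<longleftrightarrow>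
     (\<forall>\<gamma>\<ge>1. feasible S C \<alpha> W \<gamma> (\<tau> \<gamma>) (\<pi> \<gamma>)) \<and>
     asymp_eq (\<lambda>\<gamma>. WADD S (\<tau> \<gamma>) (\<pi> \<gamma>)) (optimal_WADD S C \<alpha> W)"


section \<open>The constructions are well defined\<close>

lemma Ionescu_Tulcea_window_kernel:
  fixes \<pi> :: "'act::finite policy"
  shows "Ionescu_Tulcea (window_kernel \<pi>) (\<lambda>_. count_space UNIV)"
proof (rule Ionescu_Tulcea.intro)
  fix i
  show "window_kernel \<pi> i \<in> PiM {0..<i} (\<lambda>_. count_space UNIV) \<rightarrow>\<^sub>M subprob_algebra (count_space UNIV)"
  proof (cases i)
    case 0
    then show ?thesis
      by (simp add: window_kernel_def[abs_def] measure_pmf_in_subprob_space)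
  next
    case (Suc j)
    have "(\<lambda>\<omega>. \<omega> j) \<in> PiM {0..<i} (\<lambda>_. count_space UNIV) \<rightarrow>\<^sub>M (count_space UNIV :: 'act list measure)"
      using Suc by (intro measurable_component_singleton) auto
    then show ?thesis
      using Suc unfolding window_kernel_def[abs_def]
      by (auto intro!: measurable_compose[where N="count_space UNIV"] measure_pmf_in_subprob_space)
  qed
next
  fix i and x :: "nat \<Rightarrow> 'act list"
  show "prob_space (window_kernel \<pi> i x)"
    unfolding window_kernel_def by (rule measure_pmf.prob_space_axioms)
qed

lemma sets_window_measure [measurable_cong, simp]:
  fixes \<pi> :: "'act::finite policy"
  shows "sets (window_measure \<pi>) = sets (PiM UNIV (\<lambda>_. count_space UNIV))"
proof -
  interpret Ionescu_Tulcea "window_kernel \<pi>" "\<lambda>_. count_space UNIV"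
    by (rule Ionescu_Tulcea_window_kernel)
  show ?thesis unfolding window_measure_def by simp
qed

lemma prob_space_window_measure:
  fixes \<pi> :: "'act::finite policy"
  shows "prob_space (window_measure \<pi>)"
proof -
  interpret Ionescu_Tulcea "window_kernel \<pi>" "\<lambda>_. count_space UNIV"
    by (rule Ionescu_Tulcea_window_kernel)
  have s: "space (window_measure \<pi>) = UNIV" unfolding window_measure_def by (simp add: space_PiM)
  have "emeasure PF.lim (PF.emb UNIV {0} (space (PiM {0} (\<lambda>_. count_space UNIV)))) = emeasure (CI {0}) (space (PiM {0} (\<lambda>_. count_space UNIV)))"
    by (rule lim) auto
  moreover have "prob_space (CI {0})" by (rule PF.prob_space_P) auto
  moreover have "space (CI {0}) = space (PiM {0} (\<lambda>_. count_space UNIV))" by (simp add: CI_def)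
  ultimately have "emeasure PF.lim (PF.emb UNIV {0} (space (PiM {0} (\<lambda>_. count_space UNIV)))) = 1"
    using prob_space.emeasure_space_1 by metis
  moreover have "PF.emb UNIV {0} (space (PiM {0} (\<lambda>_. count_space UNIV))) = (UNIV :: (nat \<Rightarrow> 'act list) set)"
    by (auto simp: prod_emb_def space_PiM)
  ultimately show ?thesis
    by (intro prob_spaceI) (simp add: s window_measure_def[symmetric])
qed

lemma emeasure_window_measure_cylinder:
  fixes \<pi> :: "'act::finite policy"
  shows "emeasure (window_measure \<pi>) {\<omega>. \<forall>i\<le>n. \<omega> i = ws i} =
    ennreal (pmf (fst \<pi>) (ws 0) * (\<Prod>i<n. pmf (snd \<pi> (ws i)) (ws (Suc i))))"
proof -
  interpret Ionescu_Tulcea "window_kernel \<pi>" "\<lambda>_. count_space UNIV"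
    by (rule Ionescu_Tulcea_window_kernel)
  let ?X = "\<lambda>n. {restrict ws {0..<n}}"
  have X: "?X n = (\<Pi>\<^sub>E i\<in>{0..<n}. {ws i})" for n
    by (auto simp: PiE_iff extensional_def fun_eq_iff)
  have Xs[measurable]: "?X n \<in> sets (PiM {0..<n} (\<lambda>_. count_space UNIV))" for n
    unfolding X by (rule sets_PiM_I_finite) auto
  have e: "{\<omega>. \<forall>i\<le>n. \<omega> i = ws i} = PF.emb UNIV {0..<Suc n} (?X (Suc n))"
    by (auto simp: prod_emb_def space_PiM fun_eq_iff restrict_def less_Suc_eq_le) metis
  have "emeasure (window_measure \<pi>) {\<omega>. \<forall>i\<le>n. \<omega> i = ws i} = emeasure (CI {0..<Suc n}) (?X (Suc n))"
    unfolding e window_measure_def by (rule lim) (auto intro: Xs)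
  also have "\<dots> = C 0 (Suc n) (\<lambda>_. undefined) (PF.emb {0..<Suc n} {0..<Suc n} (?X (Suc n)))"
    by (rule emeasure_CI) (auto intro: Xs)
  also have "PF.emb {0..<Suc n} {0..<Suc n} (?X (Suc n)) = ?X (Suc n)"
    by (rule prod_emb_id) (auto simp: X space_PiM)
  also have "C 0 (Suc n) (\<lambda>_. undefined) (?X (Suc n)) =
    ennreal (pmf (fst \<pi>) (ws 0) * (\<Prod>i<n. pmf (snd \<pi> (ws i)) (ws (Suc i))))"
  proof -
    have stepR: "emeasure (eP k \<omega>) (?X (Suc k)) =
        indicator (?X k) \<omega> * emeasure (window_kernel \<pi> k (restrict ws {0..<k})) {ws k}"
      if w: "\<omega> \<in> space (PiM {0..<k} (\<lambda>_. count_space UNIV))" for k \<omega>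
    proof -
      have [measurable]: "fun_upd \<omega> k \<in> window_kernel \<pi> k \<omega> \<rightarrow>\<^sub>M PiM {0..<Suc k} (\<lambda>_. count_space UNIV)"
        using w by (intro measurable_fun_upd[where J="{0..<k}"]) (auto simp: window_kernel_def)
      have v: "fun_upd \<omega> k -` ?X (Suc k) = (if \<omega> = restrict ws {0..<k} then {ws k} else {})"
        using w by (auto simp: fun_eq_iff space_PiM PiE_iff extensional_def restrict_def)
           (metis less_Suc_eq less_irrefl_nat)+
      show ?thesis
        unfolding eP_def using w v
        by (subst emeasure_distr) (auto simp: window_kernel_def space_PiM PiE_iff extensional_def)
    qed
    have sC: "sets (C 0 k (\<lambda>_. undefined)) = sets (PiM {0..<k} (\<lambda>_. count_space UNIV))" for k
      using sets_C[of "\<lambda>_. undefined" 0 k] by simp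
    have "C 0 (Suc k) (\<lambda>_. undefined) (?X (Suc k)) =
      C 0 k (\<lambda>_. undefined) (?X k) * emeasure (window_kernel \<pi> k (restrict ws {0..<k})) {ws k}" for k
    proof -
      have "C 0 (Suc k) (\<lambda>_. undefined) (?X (Suc k)) =
         (\<integral>\<^sup>+\<omega>. emeasure (eP k \<omega>) (?X (Suc k)) \<partial>C 0 k (\<lambda>_. undefined))"
        by (simp, rule emeasure_bind[where N="PiM {0..<Suc k} (\<lambda>_. count_space UNIV)"])
           (auto simp: space_C space_PiM PiE_iff extensional_def Xs measurable_cong_sets[OF sC refl])
      also have "\<dots> = (\<integral>\<^sup>+\<omega>. indicator (?X k) \<omega> * emeasure (window_kernel \<pi> k (restrict ws {0..<k})) {ws k} \<partial>C 0 k (\<lambda>_. undefined))"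
        by (intro nn_integral_cong stepR) (simp add: space_C)
      also have "\<dots> = C 0 k (\<lambda>_. undefined) (?X k) * emeasure (window_kernel \<pi> k (restrict ws {0..<k})) {ws k}"
        by (subst nn_integral_multc) (auto simp: sC Xs measurable_cong_sets[OF sC refl])
      finally show ?thesis .
    qed
    note step = this
    show ?thesis
    proof (induction n)
      case 0
      have "C 0 0 (\<lambda>_. undefined) (?X 0) = 1"
        using Xs[of 0] by (simp add: restrict_def)
      then show ?case by (subst step) (simp add: window_kernel_def emeasure_pmf_single)
    next
      case (Suc n)
      show ?case by (subst step, subst Suc.IH)
        (simp add: window_kernel_def emeasure_pmf_single ennreal_mult[symmetric] prod_nonneg mult.assoc)
    qed
  qed
  finally show ?thesis .
qed

lemma prob_space_signal_law:
  "signal_model S \<Longrightarrow> m \<le> num_hyp S \<Longrightarrow> prob_space (signal_law S m)"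
  unfolding signal_model_def signal_law_def by (intro prob_spaceI) (auto simp: emeasure_density)

lemma measurable_obs_map:
  fixes S :: "('n::finite, 'act::finite, 'y) signal_model"
  assumes S: "signal_model S"
  shows "(\<lambda>(w, x). \<lambda>t\<in>{1..}. (action_at w t, act S (action_at w t) (x t)))
    \<in> window_measure \<pi> \<Otimes>\<^sub>M PiM {1..} (\<lambda>t. signal_law S (if enat t < \<nu> then 0 else m)) \<rightarrow>\<^sub>M obs_seq_space S"
proof -
  let ?L = "PiM {1..} (\<lambda>t. signal_law S (if enat t < \<nu> then 0 else m))"
  have [measurable]: "act S a \<in> borel \<rightarrow>\<^sub>M obs_space S" for a
    using S by (auto simp: signal_model_def)
  have A[measurable]: "(\<lambda>p. action_at (fst p) t) \<in> window_measure \<pi> \<Otimes>\<^sub>M ?L \<rightarrow>\<^sub>M count_space UNIV" for t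
  proof -
    have "(\<lambda>w. w (t-1)) \<in> window_measure \<pi> \<rightarrow>\<^sub>M count_space UNIV"
      by (simp add: measurable_cong_sets[OF sets_window_measure refl] measurable_component_singleton)
    then have "(\<lambda>w. action_at w t) \<in> window_measure \<pi> \<rightarrow>\<^sub>M count_space UNIV"
      unfolding action_at_def by (rule measurable_compose) simp
    then show ?thesis by measurable
  qed
  have X[measurable]: "(\<lambda>p. snd p t) \<in> window_measure \<pi> \<Otimes>\<^sub>M ?L \<rightarrow>\<^sub>M borel" if "t \<ge> 1" for t
  proof -
    have "(\<lambda>x. x t) \<in> ?L \<rightarrow>\<^sub>M signal_law S (if enat t < \<nu> then 0 else m)"
      using that by (intro measurable_component_singleton) auto
    then have "(\<lambda>x. x t) \<in> ?L \<rightarrow>\<^sub>M borel"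
      by (subst (asm) measurable_cong_sets[OF refl, of _ borel]) (auto simp: signal_law_def)
    then show ?thesis by measurable
  qed
  have "(\<lambda>p. act S (action_at (fst p) t) (snd p t)) \<in> window_measure \<pi> \<Otimes>\<^sub>M ?L \<rightarrow>\<^sub>M obs_space S" if "t \<ge> 1" for t
    by (rule measurable_compose_countable'[OF _ A]) (rule measurable_compose[OF X[OF that]], simp_all add: countable_finite)
  then show ?thesis
    unfolding obs_seq_space_def split_beta' using A by (intro measurable_restrict measurable_Pair) auto
qed

lemma prob_space_obs_measure:
  fixes S :: "('n::finite, 'act::finite, 'y) signal_model"
  assumes S: "signal_model S" and m: "m \<le> num_hyp S"
  shows "prob_space (obs_measure S \<pi> \<nu> m)"
proof -
  interpret W: prob_space "window_measure \<pi>" by (rule prob_space_window_measure)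
  interpret X: prob_space "PiM {1..} (\<lambda>t::nat. signal_law S (if enat t < \<nu> then 0 else m))"
    by (intro prob_space_PiM prob_space_signal_law[OF S]) (use m in auto)
  interpret pair_prob_space "window_measure \<pi>" "PiM {1..} (\<lambda>t::nat. signal_law S (if enat t < \<nu> then 0 else m))" ..
  show ?thesis unfolding obs_measure_def by (rule prob_space_distr[OF measurable_obs_map[OF S]])
qed

lemma obs_filtration_facts:
  shows "space (obs_filtration S n) = space (obs_seq_space S)"
    and "n \<le> n' \<Longrightarrow> sets (obs_filtration S n) \<subseteq> sets (obs_filtration S n')"
    and "sets (obs_filtration S \<infinity>) = sets (obs_seq_space S)"
    and "subalgebra (obs_measure S \<pi> \<nu> m) (obs_filtration S n)"
proof -
  show 1: "space (obs_filtration S n) = space (obs_seq_space S)" for n by (simp add: obs_filtration_def)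
  let ?N = "\<lambda>_::nat. count_space UNIV \<Otimes>\<^sub>M obs_space S"
  let ?I = "\<lambda>n. {t. 1 \<le> t \<and> enat t \<le> n}"
  show 2: "sets (obs_filtration S n) \<subseteq> sets (obs_filtration S n')" if "n \<le> n'" for n n'
  proof -
    have sub: "?I n \<subseteq> ?I n'" using that by auto
    have m: "(\<lambda>\<omega>. restrict \<omega> (?I n')) \<in> obs_filtration S n' \<rightarrow>\<^sub>M PiM (?I n') ?N"
      unfolding obs_filtration_def
      by (rule measurable_vimage_algebra1) (auto simp: obs_seq_space_def space_PiM PiE_iff)
    have "(\<lambda>\<omega>. restrict (restrict \<omega> (?I n')) (?I n)) \<in> obs_filtration S n' \<rightarrow>\<^sub>M PiM (?I n) ?N"
      by (rule measurable_compose[OF m measurable_restrict_subset[OF sub]])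
    moreover have "?I n' \<inter> ?I n = ?I n" using sub by auto
    ultimately have "(\<lambda>\<omega>. restrict \<omega> (?I n)) \<in> obs_filtration S n' \<rightarrow>\<^sub>M PiM (?I n) ?N"
      by simp
    then have "(\<lambda>\<omega>. restrict \<omega> (?I n)) -` A \<inter> space (obs_seq_space S) \<in> sets (obs_filtration S n')"
      if "A \<in> sets (PiM (?I n) ?N)" for A
      using measurable_sets[OF _ that, of "\<lambda>\<omega>. restrict \<omega> (?I n)" "obs_filtration S n'"] by (simp only: 1)
    then show ?thesis
      unfolding obs_filtration_def[of S n] sets_vimage_algebra
      using sets.top[of "obs_filtration S n'"] 1[of n']
      by (intro sets.sigma_sets_subset'[of _ "obs_filtration S n'"]) auto
  qed
  have "?I \<infinity> = {1..}" by auto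
  have r: "restrict \<omega> {1..} = \<omega>" if "\<omega> \<in> space (obs_seq_space S)" for \<omega>
    using that by (auto simp: obs_seq_space_def space_PiM PiE_iff extensional_def fun_eq_iff)
  have "(\<lambda>\<omega>. restrict \<omega> {1..}) -` A \<inter> space (obs_seq_space S) = A" if "A \<in> sets (obs_seq_space S)" for A
    using r sets.sets_into_space[OF that] by auto
  then have "{(\<lambda>\<omega>. restrict \<omega> {1..}) -` A \<inter> space (obs_seq_space S) |A. A \<in> sets (obs_seq_space S)} = sets (obs_seq_space S)"
    unfolding Setcompr_eq_image by (simp cong: image_cong)
  then show 3: "sets (obs_filtration S \<infinity>) = sets (obs_seq_space S)"
    unfolding obs_filtration_def sets_vimage_algebra \<open>?I \<infinity> = {1..}\<close> obs_seq_space_def[symmetric]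
    by (simp add: sets.sigma_sets_eq)
  show "subalgebra (obs_measure S \<pi> \<nu> m) (obs_filtration S n)"
    using 1 2[of n \<infinity>] 3 unfolding subalgebra_def obs_measure_def space_distr sets_distr by (metis enat_ord_code(3))
qed

lemma stopping_time_glr_cusum:
  fixes S :: "('n::finite, 'act::finite, 'y) signal_model"
  assumes S: "signal_model S"
  shows "stopping_time (obs_filtration S) (glr_cusum S \<gamma>)"
proof
  fix n
  have o[measurable]: "obs_pdf S m a \<in> borel_measurable (obs_space S)" if "m \<le> num_hyp S" for m a
    using S that by (auto simp: signal_model_def)
  have l: "llr S m \<in> borel_measurable (count_space UNIV \<Otimes>\<^sub>M obs_space S)" if "m \<le> num_hyp S" for m
  proof -
    note o[OF that, measurable] o[OF le0, measurable]
    have "(\<lambda>p. (\<lambda>a p. llr S m (a, snd p)) (fst p) p) \<in> borel_measurable (count_space UNIV \<Otimes>\<^sub>M obs_space S)"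
      by (rule measurable_compose_countable'[where I=UNIV])
         (auto simp: llr_def intro: countable_finite, measurable)
    then show ?thesis by simp
  qed
  have cm: "cusum S m t \<in> borel_measurable (obs_filtration S n)" if "m \<le> num_hyp S" "enat t \<le> n" for m t
    using that(2)
  proof (induction t)
    case (Suc t)
    have "(\<lambda>\<omega>. restrict \<omega> {t. 1 \<le> t \<and> enat t \<le> n}) \<in> obs_filtration S n \<rightarrow>\<^sub>M (PiM {t. 1 \<le> t \<and> enat t \<le> n} (\<lambda>_. count_space UNIV \<Otimes>\<^sub>M obs_space S))"
      unfolding obs_filtration_def
      by (rule measurable_vimage_algebra1) (auto simp: obs_seq_space_def space_PiM PiE_iff)
    then have "(\<lambda>\<omega>. restrict \<omega> {t. 1 \<le> t \<and> enat t \<le> n} (Suc t)) \<in> obs_filtration S n \<rightarrow>\<^sub>M (count_space UNIV \<Otimes>\<^sub>M obs_space S)"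
      by (rule measurable_compose[OF _ measurable_component_singleton]) (use Suc in auto)
    then have "(\<lambda>\<omega>. \<omega> (Suc t)) \<in> obs_filtration S n \<rightarrow>\<^sub>M (count_space UNIV \<Otimes>\<^sub>M obs_space S)"
      using Suc by simp
    note measurable_compose[OF this l[OF that(1)], measurable]
    have [measurable]: "cusum S m t \<in> borel_measurable (obs_filtration S n)"
      using Suc by (metis Suc_n_not_le_n enat_ord_simps(1) linear order_trans)
    show ?case by (simp add: cusum.simps[abs_def])
  qed (simp add: cusum.simps(1)[abs_def])
  have M1: "num_hyp S \<ge> 1" using S by (simp add: signal_model_def)
  have g: "glr_statistic S t \<omega> > c \<longleftrightarrow> (\<exists>m\<in>{1..num_hyp S}. cusum S m t \<omega> > c)" for t \<omega> c
    unfolding glr_statistic_def using M1 by (subst Max_gr_iff) auto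
  let ?h = "ereal (ln (real (num_hyp S) * \<gamma>))"
  show "Measurable.pred (obs_filtration S n) (\<lambda>\<omega>. glr_cusum S \<gamma> \<omega> \<le> n)"
  proof (cases n)
    case (enat k)
    have "glr_cusum S \<gamma> \<omega> \<le> n \<longleftrightarrow> (\<exists>t\<in>{..k}. \<exists>m\<in>{1..num_hyp S}. cusum S m t \<omega> > ?h)" for \<omega>
    proof
      assume a: "glr_cusum S \<gamma> \<omega> \<le> n"
      let ?A = "{enat t |t. glr_statistic S t \<omega> > ?h}"
      have "?A \<noteq> {}"
      proof
        assume "?A = {}"
        with a enat show False unfolding glr_cusum_def by (simp only: Inf_enat_def) simp
      qed
      then obtain u where "u \<in> ?A" by blast
      then have "Inf ?A \<in> ?A" by (rule wellorder_InfI)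
      then show "\<exists>t\<in>{..k}. \<exists>m\<in>{1..num_hyp S}. cusum S m t \<omega> > ?h"
        proof -
        from \<open>Inf ?A \<in> ?A\<close> obtain t where "Inf ?A = enat t" "glr_statistic S t \<omega> > ?h" by blast
        moreover from this a have "t \<le> k" unfolding glr_cusum_def enat by (metis enat_ord_simps(1))
        ultimately show ?thesis unfolding g by blast
      qed
    next
      assume "\<exists>t\<in>{..k}. \<exists>m\<in>{1..num_hyp S}. cusum S m t \<omega> > ?h"
      then show "glr_cusum S \<gamma> \<omega> \<le> n"
      proof -
        from \<open>\<exists>t\<in>{..k}. _ t\<close> obtain t where t: "t \<le> k" "glr_statistic S t \<omega> > ?h" unfolding g by blast
        have "Inf {enat t |t. glr_statistic S t \<omega> > ?h} \<le> enat t" by (rule Inf_lower) (use t in blast)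
        also have "\<dots> \<le> n" using t enat by simp
        finally show ?thesis unfolding glr_cusum_def .
      qed
    qed
    moreover have "Measurable.pred (obs_filtration S n) (\<lambda>\<omega>. \<exists>t\<in>{..k}. \<exists>m\<in>{1..num_hyp S}. cusum S m t \<omega> > ?h)"
      by (intro pred_intros_finite borel_measurable_pred_less borel_measurable_const cm) (auto simp: enat)
    ultimately show ?thesis by simp
  qed simp
qed

lemma measurable_delay:
  fixes S :: "('n::finite, 'act::finite, 'y) signal_model"
  assumes "stopping_time (obs_filtration S) \<tau>"
  shows "(\<lambda>\<omega>. ennreal_of_enat (\<tau> \<omega> + 1 - enat \<nu>)) \<in> borel_measurable (obs_measure S \<pi> \<nu>' m)"
proof -
  have "\<tau> \<in> obs_seq_space S \<rightarrow>\<^sub>M borel"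
    by (rule measurable_stopping_time[OF assms])
       (use obs_filtration_facts(2)[of _ \<infinity> S] obs_filtration_facts(3)[of S] in \<open>auto simp: obs_filtration_facts(1)\<close>)
  then have "\<tau> \<in> obs_seq_space S \<rightarrow>\<^sub>M count_space UNIV"
    using measurable_cong_sets[OF refl sets_borel_eq_count_space] by auto
  then show ?thesis
    unfolding obs_measure_def by (auto simp: measurable_distr_eq1)
qed

end

theory Submission
  imports Defs "HOL-Real_Asymp.Real_Asymp"
begin

text \<open>
  Let hypothesis \<open>m\<close> be true after the change. Until the alarm the CuSum statistic of \<open>m\<close> has to climb
  to \<open>log (M \<gamma>)\<close>, and it gains the Kullback-Leibler divergence of the chosen action per step. So the
  delay is about \<open>log \<gamma>\<close> divided by the long-run average divergence. The chain of windows of the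
  given policy \<open>\<pi>\<close> may be reducible, in which case this average depends on the closed class that the
  chain has entered, and the worst-case delay is governed by the least informative class that can be
  reached.

  The policy \<open>\<pi>\<^sub>1\<close> is obtained by averaging (lemma \<open>order_one_policy\<close>). Along a sequence of times at
  which the average switching cost of \<open>\<pi>\<close> tends to its limes superior, the averaged laws of the
  windows accumulate at a stationary law \<open>\<eta>\<close>. Let \<open>\<pi>\<^sub>1\<close> be the Markov chain of actions whose law of
  consecutive pairs is that of \<open>\<eta>\<close>, started in equilibrium; its switching cost is that of \<open>\<pi>\<close>. Closed
  classes of \<open>\<pi>\<^sub>1\<close> come from closed sets of windows of \<open>\<pi>\<close>, so its information rates are averages of
  rates of \<open>\<pi>\<close> and are at least the worst rate \<open>I\<close> among the classes that \<open>\<eta>\<close> charges. Therefore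
  \<open>WADD(\<pi>\<^sub>1) \<le> (1 + o(1)) log \<gamma> / I\<close> (lemma \<open>WADD_glr_le\<close>), whereas
  \<open>WADD(\<pi>) \<ge> (1 - o(1)) log \<gamma> / I\<close> (lemma \<open>WADD_hyp_eventually_gt\<close>). Conversely, \<open>\<pi>\<^sub>1\<close> can be regarded
  as a policy of window size \<open>W\<close> with the same observations, and the GLR CuSum satisfies the
  constraint on the average run length under every policy (lemma \<open>ARL_glr_cusum\<close>). So \<open>\<pi>\<^sub>1\<close> is
  feasible and the optimality of \<open>\<pi>\<close> shows that \<open>WADD(\<pi>\<^sub>1)\<close> is not asymptotically smaller than
  \<open>WADD(\<pi>)\<close> (lemma \<open>optimal_WADD_le_order_one\<close>).

  The delay bounds rest on means only, without a law of large numbers. By Wald's identity the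
  log-likelihood ratio collected until the alarm has the mean of the collected divergences, and an
  approximate solution of the Poisson equation turns these into rate times mean delay plus a bounded
  term (lemma \<open>wald_poisson_le\<close>). For the upper bound the log-likelihood ratios are truncated, which
  bounds the overshoot over the threshold. For the lower bound one has to show that an alarm needs
  information of order \<open>log \<gamma>\<close>. This follows from the Shiryaev-Roberts statistics, which dominate
  the CuSum statistics: weighted by the inverse likelihood of the change, each grows on average by at most
  one per step (lemma \<open>false_alarm_bound\<close>).

  The asymptotic comparison needs \<open>I > 0\<close>. If \<open>I\<close> were \<open>0\<close>, then on a closed class of \<open>\<pi>\<close> some hypothesis
  \<open>m\<close> would not be distinguishable from the absence of change. There only the other \<open>M - 1\<close> statistics
  could raise an alarm, and the delay would be at least about \<open>\<gamma> M / (M - 1)\<close>, or infinite if \<open>M = 1\<close>.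
  But stopping at the constant time \<open>\<lceil>\<gamma>\<rceil>\<close> has a delay of at most \<open>\<gamma> + 1\<close>, which contradicts the
  asymptotic optimality of \<open>\<pi>\<close>.
\<close>

section \<open>Finite Markov chains\<close>

text \<open>The Bolzano-Weierstrass theorem, once per index: a further subsequence does not destroy the
  convergence obtained for earlier indices.\<close>

lemma common_convergent_subseq:
  fixes f :: "'b \<Rightarrow> nat \<Rightarrow> real"
  assumes "finite X" "\<And>x. x \<in> X \<Longrightarrow> bounded (range (f x))"
  shows "\<exists>r. strict_mono r \<and> (\<forall>x\<in>X. convergent (\<lambda>n. f x (r n)))"
  using assms
proof (induction X rule: finite_induct)
  case empty
  show ?case by (rule exI[of _ id]) (simp add: strict_mono_def)
next
  case (insert x F)
  then obtain r where r: "strict_mono r" "\<forall>x\<in>F. convergent (\<lambda>n. f x (r n))" by auto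
  have "bounded (range (f x \<circ> r))"
    using insert.prems[of x] by (rule bounded_subset) auto
  then obtain l s where s: "strict_mono s" "((f x \<circ> r) \<circ> s) \<longlonglongrightarrow> l"
    using bounded_imp_convergent_subsequence by blast
  have "convergent (\<lambda>n. f y (r (s n)))" if "y \<in> F" for y
    using convergent_subseq_convergent[OF bspec[OF r(2) that] s(1)] by (simp add: o_def)
  moreover have "convergent (\<lambda>n. f x (r (s n)))"
    using s(2) by (auto simp: convergent_def o_def)
  ultimately show ?case
    using strict_mono_o[OF r(1) s(1)] by (intro exI[of _ "\<lambda>n. r (s n)"]) (auto simp: o_def)
qed

lemma integral_finite_pmf:
  fixes h :: "'b \<Rightarrow> real"
  assumes "finite \<Omega>" "set_pmf p \<subseteq> \<Omega>"
  shows "measure_pmf.expectation p h = (\<Sum>v\<in>\<Omega>. pmf p v * h v)"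
  using assms by (subst integral_measure_pmf[of \<Omega>]) auto

lemma integral_bind_finite_pmf:
  fixes h :: "'c \<Rightarrow> real"
  assumes "finite (set_pmf p)" "\<And>x. x \<in> set_pmf p \<Longrightarrow> finite (set_pmf (K x))"
  shows "measure_pmf.expectation (bind_pmf p K) h
    = measure_pmf.expectation p (\<lambda>x. measure_pmf.expectation (K x) h)"
  using assms
  by (subst pmf_expectation_bind[of "set_pmf p"]) (auto simp: integral_finite_pmf[of "set_pmf p"])

text \<open>The transition operator of a Markov chain on functions of the state.\<close>

definition step :: "('b \<Rightarrow> 'b pmf) \<Rightarrow> ('b \<Rightarrow> real) \<Rightarrow> 'b \<Rightarrow> real" where
  "step T h w = measure_pmf.expectation (T w) h"

lemma abs_step_le:
  assumes h: "\<And>v. \<bar>h v\<bar> \<le> H"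
  shows "\<bar>step T h w\<bar> \<le> H"
proof -
  have "\<bar>step T h w\<bar> \<le> measure_pmf.expectation (T w) (\<lambda>v. \<bar>h v\<bar>)"
    unfolding step_def by (rule integral_abs_bound)
  also have "\<dots> \<le> measure_pmf.expectation (T w) (\<lambda>v. H)"
    using h order_trans[OF abs_ge_zero h]
    by (intro integral_mono measure_pmf.integrable_const_bound[of _ H]) auto
  finally show ?thesis by simp
qed

lemma step_uminus: "step T (\<lambda>v. - h v) w = - step T h w"
  by (simp add: step_def)

locale finite_chain =
  fixes \<Omega> :: "'b set" and T :: "'b \<Rightarrow> 'b pmf"
  assumes finite_states: "finite \<Omega>"
    and closed_states: "w \<in> \<Omega> \<Longrightarrow> set_pmf (T w) \<subseteq> \<Omega>"
begin

lemma step_eq_sum: "w \<in> \<Omega> \<Longrightarrow> step T h w = (\<Sum>v\<in>\<Omega>. pmf (T w) v * h v)"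
  unfolding step_def using integral_finite_pmf[OF finite_states closed_states] by blast

lemma sum_pmf_states: "w \<in> \<Omega> \<Longrightarrow> (\<Sum>v\<in>\<Omega>. pmf (T w) v) = 1"
  using sum_pmf_eq_1[OF finite_states closed_states] by auto

lemma step_sum:
  "w \<in> \<Omega> \<Longrightarrow> step T (\<lambda>v. \<Sum>k\<in>I. c k * g k v) w = (\<Sum>k\<in>I. c k * step T (g k) w)"
  by (simp add: step_eq_sum sum_distrib_left sum.swap[of _ I]) (simp add: algebra_simps)

lemma step_abs_le:
  assumes "w \<in> \<Omega>" "\<And>v. v \<in> \<Omega> \<Longrightarrow> \<bar>h v\<bar> \<le> B"
  shows "\<bar>step T h w\<bar> \<le> B"
proof -
  have "\<bar>step T h w\<bar> \<le> (\<Sum>v\<in>\<Omega>. pmf (T w) v * B)"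
    unfolding step_eq_sum[OF assms(1)]
    by (rule order_trans[OF sum_abs]) (auto intro!: sum_mono mult_left_mono assms simp: abs_mult)
  also have "\<dots> = B" using sum_pmf_states[OF assms(1)] by (simp add: sum_distrib_right[symmetric])
  finally show ?thesis .
qed

definition cesaro :: "('b \<Rightarrow> real) \<Rightarrow> nat \<Rightarrow> 'b \<Rightarrow> real" where
  "cesaro f n w = (\<Sum>k<n. (step T ^^ k) f w) / real n"

lemma iterate_abs_le:
  assumes "\<And>v. v \<in> \<Omega> \<Longrightarrow> \<bar>f v\<bar> \<le> B" "w \<in> \<Omega>"
  shows "\<bar>(step T ^^ k) f w\<bar> \<le> B"
  using assms(2) by (induction k arbitrary: w) (auto intro: step_abs_le assms(1))

lemma cesaro_abs_le:
  assumes "\<And>v. v \<in> \<Omega> \<Longrightarrow> \<bar>f v\<bar> \<le> B" "w \<in> \<Omega>" "0 \<le> B"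
  shows "\<bar>cesaro f n w\<bar> \<le> B"
proof -
  have "\<bar>\<Sum>k<n. (step T ^^ k) f w\<bar> \<le> (\<Sum>k<n. B)"
    by (rule order_trans[OF sum_abs]) (intro sum_mono iterate_abs_le[OF assms(1,2)], assumption)
  then show ?thesis
    using assms(3) by (cases "n = 0") (auto simp: cesaro_def abs_divide divide_simps mult.commute)
qed

lemma step_cesaro_diff:
  assumes "w \<in> \<Omega>"
  shows "step T (cesaro f n) w - cesaro f n w = ((step T ^^ n) f w - f w) / real n"
proof -
  have "step T (cesaro f n) w = (\<Sum>k<n. (1 / real n) * (step T ^^ Suc k) f w)"
    using step_sum[OF assms, of "\<lambda>k. 1 / real n" "\<lambda>k. (step T ^^ k) f" "{..<n}"]
    by (simp add: cesaro_def[abs_def] sum_divide_distrib)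
  then have "step T (cesaro f n) w - cesaro f n w
      = (\<Sum>k<n. (step T ^^ Suc k) f w - (step T ^^ k) f w) / real n"
    unfolding cesaro_def
    by (simp add: sum_subtractf diff_divide_distrib sum_divide_distrib)
  also have "\<dots> = ((step T ^^ n) f w - f w) / real n"
    by (subst sum_lessThan_telescope) simp
  finally show ?thesis .
qed

text \<open>For each \<open>j\<close> the function \<open>f + T f + \<dots> + T\<^bsup>j - 1\<^esup> f\<close> has increment \<open>f - T\<^bsup>j\<^esup> f\<close> along the
  chain. Averaging over \<open>j < N\<close> replaces \<open>T\<^bsup>j\<^esup> f\<close> by its mean, so that \<open>f\<close> solves a Poisson equation
  whose error is the Cesaro mean.\<close>

lemma cesaro_poisson:
  fixes f :: "'b \<Rightarrow> real"
  assumes "w \<in> \<Omega>" "N > 0"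
  defines "h \<equiv> \<lambda>v. \<Sum>j<N. (1 / real N) * (\<Sum>k<j. 1 * (step T ^^ k) f v)"
  shows "f w - (h w - step T h w) = cesaro f N w"
proof -
  have "step T h w = (\<Sum>j<N. (1 / real N) * (\<Sum>k<j. 1 * (step T ^^ Suc k) f w))"
    unfolding h_def step_sum[OF assms(1)] by simp
  then have "h w - step T h w
     = (\<Sum>j<N. (1 / real N) * ((\<Sum>k<j. (step T ^^ k) f w - (step T ^^ Suc k) f w)))"
    unfolding h_def by (simp add: sum_subtractf diff_divide_distrib)
  also have "\<dots> = (\<Sum>j<N. (1 / real N) * (f w - (step T ^^ j) f w))"
    by (subst sum_lessThan_telescope') simp
  also have "\<dots> = f w - cesaro f N w"
    using assms(2) unfolding cesaro_def sum_distrib_left[symmetric] by (simp add: sum_subtractf field_simps)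
  finally show ?thesis by simp
qed

lemma expectation_step_invariant:
  assumes "set_pmf \<eta> \<subseteq> \<Omega>" "bind_pmf \<eta> T = \<eta>"
  shows "measure_pmf.expectation \<eta> (step T h) = measure_pmf.expectation \<eta> h"
proof -
  have "finite (set_pmf (T w))" if "w \<in> set_pmf \<eta>" for w
    using that assms(1) closed_states finite_states by (meson finite_subset subsetD)
  then have "measure_pmf.expectation (bind_pmf \<eta> T) h = measure_pmf.expectation \<eta> (step T h)"
    unfolding step_def using assms(1) finite_states
    by (intro integral_bind_finite_pmf) (auto intro: finite_subset)
  then show ?thesis by (simp add: assms(2))
qed

text \<open>\<open>g w\<close> is the long-run average of \<open>f\<close> along the chain started at \<open>w\<close>; on each irreducible
  closed class it is constant, equal to the stationary mean of \<open>f\<close>. Solving the Poisson equation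
  only up to \<open>\<epsilon>\<close> is enough for asymptotic statements and avoids inverting \<open>1 - T\<close> on a complement of
  the harmonic functions, for chains that may be reducible and periodic.\<close>

definition harmonic_part :: "('b \<Rightarrow> real) \<Rightarrow> ('b \<Rightarrow> real) \<Rightarrow> bool" where
  "harmonic_part f g \<longleftrightarrow>
     (\<forall>w\<in>\<Omega>. step T g w = g w) \<and>
     (\<forall>\<epsilon>>0. \<exists>h. \<forall>w\<in>\<Omega>. \<bar>f w - (h w - step T h w) - g w\<bar> \<le> \<epsilon>) \<and>
     (\<forall>\<eta>. set_pmf \<eta> \<subseteq> \<Omega> \<longrightarrow> bind_pmf \<eta> T = \<eta> \<longrightarrow>
        measure_pmf.expectation \<eta> f = measure_pmf.expectation \<eta> g)"

text \<open>\<open>g\<close> is a limit of Cesaro means along a subsequence that works for all of the finitely many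
  states. It is harmonic because one step of the chain changes the \<open>n\<close>-th mean by \<open>O(1 / n)\<close>, and
  the Cesaro means are the error terms of approximate Poisson equations.\<close>

lemma harmonic_decomposition: "\<exists>g. harmonic_part f g"
proof -
  define B where "B = (\<Sum>v\<in>\<Omega>. \<bar>f v\<bar>)"
  have B: "\<bar>f v\<bar> \<le> B" if "v \<in> \<Omega>" for v
    unfolding B_def using finite_states that by (intro member_le_sum) auto
  have B0: "0 \<le> B" unfolding B_def by (simp add: sum_nonneg)
  have "bounded (range (\<lambda>n. cesaro f n w))" if "w \<in> \<Omega>" for w
    unfolding bounded_iff using cesaro_abs_le[of f B, OF B that B0] by auto
  then obtain r where r: "strict_mono r" "\<forall>w\<in>\<Omega>. convergent (\<lambda>n. cesaro f (r n) w)"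
    using common_convergent_subseq[OF finite_states, of "\<lambda>w n. cesaro f n w"] by auto
  define g where "g w = lim (\<lambda>n. cesaro f (r n) w)" for w
  have g: "(\<lambda>n. cesaro f (r n) w) \<longlonglongrightarrow> g w" if "w \<in> \<Omega>" for w
    using r(2) that unfolding g_def by (simp add: convergent_LIMSEQ_iff)
  have harm: "step T g w = g w" if w: "w \<in> \<Omega>" for w
  proof -
    have 1: "(\<lambda>n. step T (cesaro f (r n)) w - cesaro f (r n) w) \<longlonglongrightarrow> step T g w - g w"
      unfolding step_eq_sum[OF w] by (intro tendsto_intros g w)
    have lim: "(\<lambda>n. 2 * B / real (r n)) \<longlonglongrightarrow> 0"
      by (rule real_tendsto_divide_at_top[OF tendsto_const
            filterlim_compose[OF filterlim_real_sequentially filterlim_subseq[OF r(1)]]])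
    have bd: "norm (step T (cesaro f (r n)) w - cesaro f (r n) w) \<le> 2 * B / real (r n)" for n
    proof -
      have "\<bar>(step T ^^ r n) f w - f w\<bar> \<le> 2 * B"
        using iterate_abs_le[of f B, OF B w, where k = "r n"] B[OF w] by linarith
      then have "\<bar>(step T ^^ r n) f w - f w\<bar> / \<bar>real (r n)\<bar> \<le> 2 * B / \<bar>real (r n)\<bar>"
        by (rule divide_right_mono) simp
      then show ?thesis unfolding step_cesaro_diff[OF w] real_norm_def abs_divide by (simp only: abs_of_nat)
    qed
    have 0: "(\<lambda>n. step T (cesaro f (r n)) w - cesaro f (r n) w) \<longlonglongrightarrow> 0"
      by (rule Lim_null_comparison[OF always_eventually[OF allI[OF bd]] lim])
    have "step T g w - g w = 0" by (rule LIMSEQ_unique[OF 1 0])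
    then show ?thesis by simp
  qed
  have appr: "\<exists>h. \<forall>w\<in>\<Omega>. \<bar>f w - (h w - step T h w) - g w\<bar> \<le> \<epsilon>" if "\<epsilon> > 0" for \<epsilon>
  proof -
    have "\<forall>\<^sub>F n in sequentially. \<forall>w\<in>\<Omega>. \<bar>cesaro f (r n) w - g w\<bar> < \<epsilon>"
    proof (intro eventually_ball_finite finite_states ballI)
      fix w assume "w \<in> \<Omega>"
      from tendstoD[OF g[OF this] that]
      show "\<forall>\<^sub>F n in sequentially. \<bar>cesaro f (r n) w - g w\<bar> < \<epsilon>" by (simp add: dist_real_def)
    qed
    then obtain n0 where n0: "\<And>n. n \<ge> n0 \<Longrightarrow> \<forall>w\<in>\<Omega>. \<bar>cesaro f (r n) w - g w\<bar> < \<epsilon>"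
      unfolding eventually_sequentially by blast
    define n where "n = Suc n0"
    have n: "0 < r n" "\<forall>w\<in>\<Omega>. \<bar>cesaro f (r n) w - g w\<bar> < \<epsilon>"
      using seq_suble[OF r(1), of n] n0[of n] by (auto simp: n_def)
    define h where "h v = (\<Sum>j<r n. (1 / real (r n)) * (\<Sum>k<j. 1 * (step T ^^ k) f v))" for v
    have "f w - (h w - step T h w) = cesaro f (r n) w" if "w \<in> \<Omega>" for w
      using cesaro_poisson[OF that n(1), of f] by (simp only: h_def[abs_def])
    then have "\<bar>f w - (h w - step T h w) - g w\<bar> \<le> \<epsilon>" if "w \<in> \<Omega>" for w
      using n(2) that by (simp only: less_imp_le)
    then show ?thesis by blast
  qed
  have exp: "measure_pmf.expectation \<eta> f = measure_pmf.expectation \<eta> g"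
    if \<eta>: "set_pmf \<eta> \<subseteq> \<Omega>" "bind_pmf \<eta> T = \<eta>" for \<eta>
  proof (rule ccontr)
    define d where "d = \<bar>measure_pmf.expectation \<eta> f - measure_pmf.expectation \<eta> g\<bar>"
    assume "measure_pmf.expectation \<eta> f \<noteq> measure_pmf.expectation \<eta> g"
    then have "d / 2 > 0" unfolding d_def by simp
    then obtain h where h: "\<forall>w\<in>\<Omega>. \<bar>f w - (h w - step T h w) - g w\<bar> \<le> d / 2" using appr by blast
    have fin: "finite (set_pmf \<eta>)" using finite_subset[OF \<eta>(1) finite_states] .
    have i: "integrable (measure_pmf \<eta>) u" for u :: "'b \<Rightarrow> real"
      by (rule integrable_measure_pmf_finite[OF fin])
    have "measure_pmf.expectation \<eta> (\<lambda>w. f w - (h w - step T h w) - g w)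
      = measure_pmf.expectation \<eta> f - measure_pmf.expectation \<eta> g"
      using expectation_step_invariant[OF \<eta>, of h] by (simp add: i)
    moreover have "\<bar>measure_pmf.expectation \<eta> (\<lambda>w. f w - (h w - step T h w) - g w)\<bar> \<le> d / 2"
    proof -
      have "\<bar>measure_pmf.expectation \<eta> (\<lambda>w. f w - (h w - step T h w) - g w)\<bar>
         \<le> measure_pmf.expectation \<eta> (\<lambda>w. \<bar>f w - (h w - step T h w) - g w\<bar>)"
        by (rule integral_abs_bound)
      also have "\<dots> \<le> measure_pmf.expectation \<eta> (\<lambda>w. d / 2)"
        using h \<eta>(1) by (intro integral_mono_AE i AE_pmfI) auto
      finally show ?thesis by simp
    qed
    ultimately have "d \<le> d / 2" unfolding d_def by (simp only:)
    then show False using \<open>d / 2 > 0\<close> by linarith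
  qed
  show ?thesis
    unfolding harmonic_part_def by (rule exI[of _ g], intro conjI ballI allI impI) (erule harm, erule appr, erule (1) exp)
qed

text \<open>The minimum principle: a mean that equals a lower bound of the averaged values forces all of
  them to be equal to it. The minimizers of a harmonic function are therefore a closed class.\<close>

lemma harmonic_minimal_closed:
  assumes harm: "\<And>w. w \<in> S \<Longrightarrow> step T g w = g w" and S: "S \<subseteq> \<Omega>" "\<And>w. w \<in> S \<Longrightarrow> set_pmf (T w) \<subseteq> S"
    and min: "\<And>w. w \<in> S \<Longrightarrow> c \<le> g w" and w: "w \<in> S" "g w = c" and v: "v \<in> set_pmf (T w)"
  shows "g v = c"
proof -
  have "integrable (measure_pmf (T w)) u" for u :: "'b \<Rightarrow> real"
    using w S closed_states finite_states by (meson finite_subset integrable_measure_pmf_finite subsetD)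
  note i = this
  have "measure_pmf.expectation (T w) (\<lambda>x. g x - c) = 0"
    using harm[OF w(1)] w(2) unfolding step_def by (simp add: i)
  moreover have nn: "AE x in T w. 0 \<le> g x - c"
    using subsetD[OF S(2)[OF w(1)]] min by (intro AE_pmfI) force
  ultimately have "AE x in T w. g x - c = 0"
    using integral_nonneg_eq_0_iff_AE[OF i nn] by simp
  then show ?thesis using v by (auto simp: AE_measure_pmf_iff)
qed

lemma invariant_support_closed:
  assumes "bind_pmf \<eta> T = \<eta>" "w \<in> set_pmf \<eta>"
  shows "set_pmf (T w) \<subseteq> set_pmf \<eta>"
  using assms by (metis UN_I set_bind_pmf subsetI)

text \<open>A stationary chain enters a set as often as it leaves it, and a closed set is never left.\<close>

lemma invariant_no_inflow:
  assumes \<eta>: "set_pmf \<eta> \<subseteq> \<Omega>" "bind_pmf \<eta> T = \<eta>"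
    and C: "\<And>w. w \<in> set_pmf \<eta> \<Longrightarrow> w \<in> C \<Longrightarrow> set_pmf (T w) \<subseteq> C"
    and w: "w \<in> set_pmf \<eta>" and v: "v \<in> set_pmf (T w)"
  shows "v \<in> C \<longleftrightarrow> w \<in> C"
proof -
  have fin: "finite (set_pmf \<eta>)" using finite_subset[OF \<eta>(1) finite_states] .
  have i: "integrable (measure_pmf \<eta>) u" for u :: "'b \<Rightarrow> real"
    by (rule integrable_measure_pmf_finite[OF fin])
  have "step T (indicator C) w = 1" if "w \<in> set_pmf \<eta>" "w \<in> C" for w
  proof -
    have "step T (indicator C) w = measure_pmf.expectation (T w) (\<lambda>_. 1)"
      unfolding step_def by (intro integral_cong_AE AE_pmfI) (use C[OF that] in \<open>auto simp: indicator_def\<close>)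
    then show ?thesis by simp
  qed
  then have nn: "AE w in \<eta>. 0 \<le> step T (indicator C) w - indicator C w"
    by (auto simp: AE_measure_pmf_iff indicator_def step_def)
  have "measure_pmf.expectation \<eta> (\<lambda>w. step T (indicator C) w - indicator C w) = 0"
    using expectation_step_invariant[OF \<eta>, of "indicator C"] by (simp add: i)
  then have "AE w in \<eta>. step T (indicator C) w - indicator C w = 0"
    using integral_nonneg_eq_0_iff_AE[OF i nn] by simp
  then have s: "step T (indicator C) w = indicator C w" using w by (auto simp: AE_measure_pmf_iff)
  show ?thesis
  proof
    assume "w \<in> C" then show "v \<in> C" using C[OF w] v by auto
  next
    assume vC: "v \<in> C"
    have "finite (set_pmf (T w))" using w \<eta>(1) closed_states finite_states by (meson finite_subset subsetD)
    moreover have "measure_pmf.prob (T w) C \<noteq> 0"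
      using vC v measure_measure_pmf_not_zero by fastforce
    ultimately show "w \<in> C" using s unfolding step_def by (auto simp: indicator_def split: if_splits)
  qed
qed

text \<open>No mass flows into the closed set, so its mass is preserved without help from outside.\<close>

lemma cond_invariant:
  assumes \<eta>: "set_pmf \<eta> \<subseteq> \<Omega>" "bind_pmf \<eta> T = \<eta>"
    and C: "\<And>w. w \<in> set_pmf \<eta> \<Longrightarrow> w \<in> C \<Longrightarrow> set_pmf (T w) \<subseteq> C"
    and ne: "set_pmf \<eta> \<inter> C \<noteq> {}"
  shows "bind_pmf (cond_pmf \<eta> C) T = cond_pmf \<eta> C"
proof (rule pmf_eqI)
  fix v
  have fin: "finite (set_pmf \<eta>)" using finite_subset[OF \<eta>(1) finite_states] .
  have "pmf (bind_pmf (cond_pmf \<eta> C) T) v = (\<Sum>w\<in>set_pmf \<eta>. pmf (cond_pmf \<eta> C) w * pmf (T w) v)"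
    unfolding pmf_bind using fin set_cond_pmf[OF ne] by (intro integral_finite_pmf) auto
  also have "\<dots> = (\<Sum>w\<in>set_pmf \<eta>. indicator C v / measure \<eta> C * (pmf \<eta> w * pmf (T w) v))"
  proof (intro sum.cong refl)
    fix w assume w: "w \<in> set_pmf \<eta>"
    show "pmf (cond_pmf \<eta> C) w * pmf (T w) v = indicator C v / measure \<eta> C * (pmf \<eta> w * pmf (T w) v)"
    proof (cases "v \<in> set_pmf (T w)")
      case True
      then show ?thesis using invariant_no_inflow[OF \<eta> C w True] by (simp add: pmf_cond[OF ne] indicator_def)
    qed (simp add: set_pmf_iff)
  qed
  also have "\<dots> = indicator C v / measure \<eta> C * pmf (bind_pmf \<eta> T) v"
    unfolding pmf_bind sum_distrib_left[symmetric] integral_finite_pmf[OF fin order_refl] ..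
  also have "\<dots> = pmf (cond_pmf \<eta> C) v"
    by (simp add: \<eta>(2) pmf_cond[OF ne] indicator_def)
  finally show "pmf (bind_pmf (cond_pmf \<eta> C) T) v = pmf (cond_pmf \<eta> C) v" .
qed

end

definition chain_law :: "('b \<Rightarrow> 'b pmf) \<Rightarrow> 'b pmf \<Rightarrow> nat \<Rightarrow> 'b pmf" where
  "chain_law T q k = ((\<lambda>p. bind_pmf p T) ^^ k) q"

lemma chain_law_simps [simp]:
  "chain_law T q 0 = q" "chain_law T q (Suc k) = bind_pmf (chain_law T q k) T"
  by (simp_all add: chain_law_def)

definition time_average :: "('b \<Rightarrow> 'b pmf) \<Rightarrow> 'b pmf \<Rightarrow> ('b \<Rightarrow> real) \<Rightarrow> nat \<Rightarrow> real" where
  "time_average T q f n = (\<Sum>k<n. measure_pmf.expectation (chain_law T q k) f) / real n"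

context finite_chain
begin

lemma set_chain_law: "set_pmf q \<subseteq> \<Omega> \<Longrightarrow> set_pmf (chain_law T q k) \<subseteq> \<Omega>"
  by (induction k) (auto dest: closed_states)

text \<open>The averaged laws of a chain accumulate at stationary laws. Here the subsequence is first chosen
  so that the costs realize their limes superior, and then refined so that the laws converge.\<close>

lemma invariant_limit:
  assumes q: "set_pmf q \<subseteq> \<Omega>"
  obtains \<eta> where "set_pmf \<eta> \<subseteq> (\<Union>k. set_pmf (chain_law T q k))" "bind_pmf \<eta> T = \<eta>"
    "ereal (measure_pmf.expectation \<eta> c) = limsup (\<lambda>n. ereal (time_average T q c n))"
proof -
  let ?L = "chain_law T q"
  define a where "a w n = (\<Sum>k<n. pmf (?L k) w) / real n" for w n
  have L: "set_pmf (?L k) \<subseteq> \<Omega>" for k using set_chain_law[OF q] .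
  have a0: "0 \<le> a w n" for w n unfolding a_def by (simp add: sum_nonneg)
  have a1: "a w n \<le> 1" for w n
  proof -
    have "(\<Sum>k<n. pmf (?L k) w) \<le> (\<Sum>k<n. 1)" by (intro sum_mono pmf_le_1)
    then show ?thesis unfolding a_def by (auto simp: divide_simps)
  qed
  obtain r where r: "strict_mono r"
    "((\<lambda>n. ereal (time_average T q c n)) \<circ> r) \<longlonglongrightarrow> limsup (\<lambda>n. ereal (time_average T q c n))"
    using limsup_subseq_lim by blast
  have "bounded (range (\<lambda>n. a w (r n)))" for w
    unfolding bounded_iff using a0 a1 by (auto intro!: exI[of _ 1])
  then obtain s where s: "strict_mono s" "\<forall>w\<in>\<Omega>. convergent (\<lambda>n. a w (r (s n)))"
    using common_convergent_subseq[OF finite_states, of "\<lambda>w n. a w (r n)"] by auto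
  define t where "t n = r (s n)" for n
  have t: "strict_mono t" using strict_mono_o[OF r(1) s(1)] by (simp add: t_def[abs_def] o_def)
  define e where "e w = (if w \<in> \<Omega> then lim (\<lambda>n. a w (t n)) else 0)" for w
  have e: "(\<lambda>n. a w (t n)) \<longlonglongrightarrow> e w" if "w \<in> \<Omega>" for w
    using s(2) that unfolding e_def t_def by (simp add: convergent_LIMSEQ_iff)
  have tpos: "\<forall>\<^sub>F n in sequentially. 0 < t n"
    unfolding eventually_sequentially using seq_suble[OF t] by (intro exI[of _ 1]) (metis One_nat_def less_le_trans not_less_eq_eq not_le)
  have e0: "0 \<le> e w" for w
    using LIMSEQ_le_const[OF e] a0 by (cases "w \<in> \<Omega>") (auto simp: e_def)
  have e1: "(\<Sum>w\<in>\<Omega>. e w) = 1"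
  proof -
    have "(\<lambda>n. \<Sum>w\<in>\<Omega>. a w (t n)) \<longlonglongrightarrow> (\<Sum>w\<in>\<Omega>. e w)" by (intro tendsto_sum e)
    moreover have "\<forall>\<^sub>F n in sequentially. (\<Sum>w\<in>\<Omega>. a w (t n)) = 1"
      using tpos
    proof eventually_elim
      fix n assume "0 < t n"
      have "(\<Sum>w\<in>\<Omega>. a w (t n)) = (\<Sum>k<t n. \<Sum>w\<in>\<Omega>. pmf (?L k) w) / real (t n)"
        unfolding a_def by (simp add: sum_divide_distrib sum.swap[of _ \<Omega>])
      also have "\<dots> = 1" using \<open>0 < t n\<close> by (simp add: sum_pmf_eq_1[OF finite_states L])
      finally show "(\<Sum>w\<in>\<Omega>. a w (t n)) = 1" .
    qed
    ultimately have "(\<lambda>n. 1) \<longlonglongrightarrow> (\<Sum>w\<in>\<Omega>. e w)" by (rule Lim_transform_eventually)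
    then show ?thesis by (simp add: LIMSEQ_const_iff)
  qed
  define \<eta> where "\<eta> = embed_pmf e"
  have pmf: "pmf \<eta> w = e w" for w unfolding \<eta>_def
  proof (rule pmf_embed_pmf[OF e0])
    have "(\<integral>\<^sup>+x. ennreal (e x) \<partial>count_space UNIV) = (\<Sum>x\<in>\<Omega>. ennreal (e x))"
      by (rule nn_integral_count_space'[OF finite_states]) (auto simp: e_def)
    then show "(\<integral>\<^sup>+x. ennreal (e x) \<partial>count_space UNIV) = 1" by (simp add: sum_ennreal e0 e1)
  qed
  have sub: "set_pmf \<eta> \<subseteq> \<Omega>" by (auto simp: set_pmf_iff pmf e_def split: if_splits)
  have supp: "set_pmf \<eta> \<subseteq> (\<Union>k. set_pmf (?L k))"
  proof
    fix w assume w: "w \<in> set_pmf \<eta>"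
    show "w \<in> (\<Union>k. set_pmf (?L k))"
    proof (rule ccontr)
      assume "w \<notin> (\<Union>k. set_pmf (?L k))"
      then have "pmf (?L k) w = 0" for k by (simp add: set_pmf_iff)
      then have "(\<lambda>n. 0) \<longlonglongrightarrow> e w" using e[of w] w sub by (auto simp: a_def)
      then have "e w = 0" by (simp add: LIMSEQ_const_iff)
      then show False using w by (simp add: set_pmf_iff pmf)
    qed
  qed
  have inv: "bind_pmf \<eta> T = \<eta>"
  proof (rule pmf_eqI)
    fix v
    show "pmf (bind_pmf \<eta> T) v = pmf \<eta> v"
    proof (cases "v \<in> \<Omega>")
      case True
      have bind_sum: "pmf (bind_pmf p T) v = (\<Sum>w\<in>\<Omega>. pmf p w * pmf (T w) v)" if "set_pmf p \<subseteq> \<Omega>" for p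
        unfolding pmf_bind by (rule integral_finite_pmf[OF finite_states that])
      have shift: "(\<Sum>w\<in>\<Omega>. a w n * pmf (T w) v) - a v n = (pmf (?L n) v - pmf (?L 0) v) / real n" for n
      proof -
        have "(\<Sum>w\<in>\<Omega>. a w n * pmf (T w) v) = (\<Sum>k<n. pmf (?L (Suc k)) v) / real n"
          unfolding a_def
          by (simp add: bind_sum[OF L] sum_divide_distrib sum_distrib_right sum.swap[of _ \<Omega>])
        then have "(\<Sum>w\<in>\<Omega>. a w n * pmf (T w) v) - a v n
           = (\<Sum>k<n. pmf (?L (Suc k)) v - pmf (?L k) v) / real n"
          by (simp add: a_def sum_subtractf diff_divide_distrib)
        then show ?thesis by (subst (asm) sum_lessThan_telescope)
      qed
      have lim: "(\<lambda>n. 1 / real (t n)) \<longlonglongrightarrow> 0"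
        by (rule real_tendsto_divide_at_top[OF tendsto_const
              filterlim_compose[OF filterlim_real_sequentially filterlim_subseq[OF t]]])
      have bd: "norm ((\<Sum>w\<in>\<Omega>. a w (t n) * pmf (T w) v) - a v (t n)) \<le> 1 / real (t n)" for n
      proof -
        have "\<bar>pmf (?L (t n)) v - pmf (?L 0) v\<bar> \<le> 1"
          using pmf_nonneg[of "?L (t n)" v] pmf_le_1[of "?L (t n)" v]
            pmf_nonneg[of "?L 0" v] pmf_le_1[of "?L 0" v] by linarith
        then have "\<bar>pmf (?L (t n)) v - pmf (?L 0) v\<bar> / \<bar>real (t n)\<bar> \<le> 1 / \<bar>real (t n)\<bar>"
          by (rule divide_right_mono) simp
        then show ?thesis unfolding shift real_norm_def abs_divide by (simp only: abs_of_nat)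
      qed
      have "(\<lambda>n. (\<Sum>w\<in>\<Omega>. a w (t n) * pmf (T w) v) - a v (t n)) \<longlonglongrightarrow> 0"
        by (rule Lim_null_comparison[OF always_eventually[OF allI[OF bd]] lim])
      moreover have "(\<lambda>n. (\<Sum>w\<in>\<Omega>. a w (t n) * pmf (T w) v) - a v (t n))
          \<longlonglongrightarrow> (\<Sum>w\<in>\<Omega>. e w * pmf (T w) v) - e v"
        by (intro tendsto_intros e True)
      ultimately have "(\<Sum>w\<in>\<Omega>. e w * pmf (T w) v) - e v = 0"
        using LIMSEQ_unique by blast
      then show ?thesis by (simp add: bind_sum[OF sub] pmf)
    next
      case False
      then have "v \<notin> set_pmf (bind_pmf \<eta> T)" "v \<notin> set_pmf \<eta>" using sub closed_states by fastforce+
      then show ?thesis by (simp only: set_pmf_iff not_not)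
    qed
  qed
  have "time_average T q c n = (\<Sum>w\<in>\<Omega>. a w n * c w)" for n
    unfolding time_average_def a_def
    by (simp add: integral_finite_pmf[OF finite_states L] sum_divide_distrib sum_distrib_right sum.swap[of _ \<Omega>])
  then have "(\<lambda>n. time_average T q c (t n)) \<longlonglongrightarrow> (\<Sum>w\<in>\<Omega>. e w * c w)"
    by (simp only:) (intro tendsto_intros e)
  then have "(\<lambda>n. time_average T q c (t n)) \<longlonglongrightarrow> measure_pmf.expectation \<eta> c"
    by (simp add: integral_finite_pmf[OF finite_states sub] pmf)
  then have 1: "(\<lambda>n. ereal (time_average T q c (t n))) \<longlonglongrightarrow> ereal (measure_pmf.expectation \<eta> c)"
    by simp
  have 2: "(\<lambda>n. ereal (time_average T q c (t n))) \<longlonglongrightarrow> limsup (\<lambda>n. ereal (time_average T q c n))"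
    using LIMSEQ_subseq_LIMSEQ[OF r(2) s(1)] by (simp add: o_def t_def)
  show thesis by (rule that[OF supp inv LIMSEQ_unique[OF 1 2]])
qed

end

section \<open>The stationary policy of window size one\<close>

text \<open>The first action of a window is the one being taken, so this is the expected cost of the next switch.\<close>

definition switching_cost :: "real ^ 'act ^ 'act \<Rightarrow> ('act::finite list \<Rightarrow> 'act list pmf) \<Rightarrow> 'act list \<Rightarrow> real" where
  "switching_cost C T w = step T (\<lambda>v. C $ hd w $ hd v) w"

lemma finite_windows: "finite {w::'act::finite list. length w = n}"
  using finite_lists_length_eq[OF finite_class.finite_UNIV, of n] by simp

lemma window_chain:
  fixes \<pi> :: "'act::finite policy"
  assumes "open_loop_policy W \<pi>" "W \<ge> 1"
  shows "finite_chain {w. length w = W} (snd \<pi>)" "set_pmf (fst \<pi>) \<subseteq> {w. length w = W}"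
proof -
  show "finite_chain {w. length w = W} (snd \<pi>)"
  proof (rule finite_chain.intro[OF finite_windows], rule subsetI)
    fix w v :: "'act list" assume w: "w \<in> {w. length w = W}" and v: "v \<in> set_pmf (snd \<pi> w)"
    have "\<forall>w'\<in>set_pmf (snd \<pi> w). \<exists>a. w' = tl w @ [a]"
      using assms(1) w unfolding open_loop_policy_def by simp
    from bspec[OF this v] obtain a where "v = tl w @ [a]" ..
    then show "v \<in> {w. length w = W}" using w assms(2) by simp
  qed
  have "\<forall>w\<in>set_pmf (fst \<pi>). length w = W"
    using assms(1) unfolding open_loop_policy_def by (rule conjunct1)
  then show "set_pmf (fst \<pi>) \<subseteq> {w. length w = W}" by (intro subsetI CollectI) (rule bspec)
qed

text \<open>The combinatorial core. Let \<open>\<eta>\<close> be a stationary law of the windows whose mean switching cost is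
  the average cost of \<open>\<pi>\<close>. The policy \<open>\<pi>\<^sub>1\<close> is the Markov chain of actions whose consecutive pairs
  have the law of two consecutive actions under \<open>\<eta>\<close>. It starts in its stationary law, and since the
  switching cost depends on consecutive pairs only, it has the same average cost.

  The number \<open>D m a\<close> stands for the information about hypothesis \<open>m\<close> that action \<open>a\<close> gives, and \<open>I\<close>
  is the least long-run average of \<open>D\<close>, over all \<open>m\<close> and all classes that \<open>\<eta>\<close> charges; it is
  attained for some \<open>m\<close> on the closed set \<open>B\<close>, which \<open>\<pi>\<close> reaches with positive probability. In the
  other direction, if \<open>\<pi>\<^sub>1\<close> cannot leave a set of actions, then under \<open>\<eta>\<close> neither can \<open>\<pi>\<close>. Hence every
  long-run average of \<open>\<pi>\<^sub>1\<close> is at least the mean of \<open>D\<close> under a conditional stationary law of \<open>\<pi>\<close>, and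
  therefore at least \<open>I\<close>.

  Both facts are expressed by Poisson inequalities with a small slack, which is the form in which
  the delay bounds use them. If \<open>I\<close> is \<open>0\<close>, no action used on \<open>B\<close> distinguishes \<open>m\<close> at all.\<close>

lemma order_one_policy:
  fixes \<pi> :: "'act::finite policy" and D :: "'m \<Rightarrow> 'act \<Rightarrow> real"
  assumes \<pi>: "open_loop_policy W \<pi>" "W \<ge> 1"
    and Ms: "finite Ms" "Ms \<noteq> {}"
    and D0: "\<And>m a. m \<in> Ms \<Longrightarrow> 0 \<le> D m a"
  obtains \<pi>\<^sub>1 A I m B where
    "open_loop_policy 1 \<pi>\<^sub>1"
    "limsup (\<lambda>n. ereal (time_average (snd \<pi>\<^sub>1) (fst \<pi>\<^sub>1) (switching_cost C (snd \<pi>\<^sub>1)) n))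
       = limsup (\<lambda>n. ereal (time_average (snd \<pi>) (fst \<pi>) (switching_cost C (snd \<pi>)) n))"
    "0 \<le> I"
    "set_pmf (fst \<pi>\<^sub>1) \<subseteq> A" "finite A" "\<And>v. v \<in> A \<Longrightarrow> set_pmf (snd \<pi>\<^sub>1 v) \<subseteq> A"
    "\<And>m \<epsilon>. m \<in> Ms \<Longrightarrow> \<epsilon> > 0 \<Longrightarrow>
       \<exists>h. \<forall>v\<in>A. h v - step (snd \<pi>\<^sub>1) h v + I - \<epsilon> \<le> D m (hd v)"
    "m \<in> Ms" "B \<noteq> {}" "finite B" "B \<subseteq> (\<Union>k. set_pmf (chain_law (snd \<pi>) (fst \<pi>) k))"
    "\<And>w. w \<in> B \<Longrightarrow> length w = W" "\<And>w. w \<in> B \<Longrightarrow> set_pmf (snd \<pi> w) \<subseteq> B"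
    "\<And>\<epsilon>. \<epsilon> > 0 \<Longrightarrow> \<exists>h. \<forall>w\<in>B. D m (hd w) \<le> h w - step (snd \<pi>) h w + I + \<epsilon>"
    "\<And>w. I = 0 \<Longrightarrow> w \<in> B \<Longrightarrow> D m (hd w) = 0"
proof -
  let ?T = "snd \<pi>"
  interpret finite_chain "{w. length w = W}" ?T by (rule window_chain[OF \<pi>])
  note q = window_chain(2)[OF \<pi>]
  obtain \<eta> where \<eta>_reach: "set_pmf \<eta> \<subseteq> (\<Union>k. set_pmf (chain_law ?T (fst \<pi>) k))"
    and inv: "bind_pmf \<eta> ?T = \<eta>"
    and cost: "ereal (measure_pmf.expectation \<eta> (switching_cost C ?T))
      = limsup (\<lambda>n. ereal (time_average ?T (fst \<pi>) (switching_cost C ?T) n))"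
    by (rule invariant_limit[OF q])
  define S where "S = set_pmf \<eta>"
  have S: "S \<subseteq> {w. length w = W}" using \<eta>_reach set_chain_law[OF q] unfolding S_def by blast
  note \<eta>S = S[unfolded S_def]
  have Sfin: "finite S" "S \<noteq> {}" using finite_subset[OF S finite_states] by (auto simp: S_def set_pmf_not_empty)
  have Scl: "set_pmf (?T w) \<subseteq> S" if "w \<in> S" for w
    using invariant_support_closed[OF inv] that by (simp add: S_def)
  have "\<forall>m. \<exists>g. harmonic_part (\<lambda>w. D m (hd w)) g" using harmonic_decomposition by blast
  then obtain g where g: "\<And>m. harmonic_part (\<lambda>w. D m (hd w)) (g m)" by metis
  note g_harm = g[unfolded harmonic_part_def, THEN conjunct1, rule_format]
    and g_appr = g[unfolded harmonic_part_def, THEN conjunct2, THEN conjunct1, rule_format]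
    and g_exp = g[unfolded harmonic_part_def, THEN conjunct2, THEN conjunct2, rule_format]
  have harm: "step ?T (g m) w = g m w" if "w \<in> S" for m w using g_harm S that by blast
  define V where "V = (\<lambda>(m, w). g m w) ` (Ms \<times> S)"
  have V: "finite V" "V \<noteq> {}" unfolding V_def using Ms Sfin by auto
  define I where "I = Min V"
  have "I \<in> V" unfolding I_def using V by (rule Min_in)
  then obtain m w0 where m: "m \<in> Ms" and w0: "w0 \<in> S" "g m w0 = I" unfolding V_def by auto
  have Imin: "I \<le> g m' w" if "m' \<in> Ms" "w \<in> S" for m' w
    unfolding I_def using that by (intro Min_le[OF V(1)]) (auto simp: V_def)
  (* By the minimum principle the states with the worst average form a closed class. *)
  define B where "B = {w \<in> S. g m w = I}"
  have Bcl: "set_pmf (?T w) \<subseteq> B" if "w \<in> B" for w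
  proof
    fix v assume v: "v \<in> set_pmf (?T w)"
    have "g m v = I"
      by (rule harmonic_minimal_closed[of S "g m" I w v]) (use harm S Scl Imin m that v in \<open>auto simp: B_def\<close>)
    then show "v \<in> B" using v Scl[of w] that unfolding B_def by auto
  qed
  have Bne: "set_pmf \<eta> \<inter> B \<noteq> {}" using w0 unfolding B_def S_def by auto
  have setB: "set_pmf (cond_pmf \<eta> B) = B" unfolding set_cond_pmf[OF Bne] by (auto simp: B_def S_def)
  have avg: "measure_pmf.expectation (cond_pmf \<eta> B) (\<lambda>w. D m (hd w)) = I"
  proof -
    have "bind_pmf (cond_pmf \<eta> B) ?T = cond_pmf \<eta> B"
      by (rule cond_invariant[OF \<eta>S inv _ Bne]) (rule Bcl)
    moreover have "set_pmf (cond_pmf \<eta> B) \<subseteq> {w. length w = W}" unfolding setB using S by (auto simp: B_def)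
    ultimately have "measure_pmf.expectation (cond_pmf \<eta> B) (\<lambda>w. D m (hd w))
        = measure_pmf.expectation (cond_pmf \<eta> B) (g m)" by (intro g_exp)
    also have "\<dots> = measure_pmf.expectation (cond_pmf \<eta> B) (\<lambda>_. I)"
      by (intro integral_cong_AE AE_pmfI) (unfold setB, auto simp: B_def)
    finally show ?thesis by simp
  qed
  have I0: "0 \<le> I" unfolding avg[symmetric] by (intro integral_nonneg_AE AE_pmfI D0 m)
  have degenerate: "D m (hd w) = 0" if "I = 0" "w \<in> B" for w
  proof -
    have "integrable (measure_pmf (cond_pmf \<eta> B)) (\<lambda>w. D m (hd w))"
      using finite_subset[OF _ Sfin(1), of B] by (intro integrable_measure_pmf_finite) (unfold setB, auto simp: B_def)
    moreover have nn: "AE w in cond_pmf \<eta> B. 0 \<le> D m (hd w)" using D0[OF m] by (intro AE_pmfI)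
    ultimately have "AE w in cond_pmf \<eta> B. D m (hd w) = 0"
      using integral_nonneg_eq_0_iff_AE[OF _ nn] avg that(1) by simp
    then show ?thesis using that(2) by (simp add: AE_measure_pmf_iff setB)
  qed
  have upper: "\<exists>h. \<forall>w\<in>B. D m (hd w) \<le> h w - step ?T h w + I + \<epsilon>" if \<epsilon>: "\<epsilon> > 0" for \<epsilon>
  proof -
    obtain h where h: "\<forall>w\<in>{w. length w = W}. \<bar>D m (hd w) - (h w - step ?T h w) - g m w\<bar> \<le> \<epsilon>"
      using g_appr[OF \<epsilon>] by blast
    have "D m (hd w) \<le> h w - step ?T h w + I + \<epsilon>" if "w \<in> B" for w
    proof -
      have "w \<in> {w. length w = W}" "g m w = I" using that S by (auto simp: B_def)
      with h have "\<bar>D m (hd w) - (h w - step ?T h w) - I\<bar> \<le> \<epsilon>" by fastforce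
      then show ?thesis by (simp add: abs_le_iff)
    qed
    then show ?thesis by blast
  qed

  (* rho is the law of two consecutive actions under eta, mu its marginal, and K its disintegration. *)
  define \<rho> where "\<rho> = bind_pmf \<eta> (\<lambda>w. map_pmf (\<lambda>v. (hd w, hd v)) (?T w))"
  define K where "K a = map_pmf snd (cond_pmf \<rho> {y. a = fst y})" for a
  define q\<^sub>1 where "q\<^sub>1 = map_pmf (\<lambda>w. [hd w]) \<eta>"
  define T\<^sub>1 :: "'act list \<Rightarrow> 'act list pmf" where "T\<^sub>1 v = map_pmf (\<lambda>b. [b]) (K (hd v))" for v
  define \<mu> where "\<mu> = map_pmf hd \<eta>"
  have fst\<rho>: "map_pmf fst \<rho> = \<mu>"
    by (simp add: \<rho>_def \<mu>_def map_bind_pmf pmf.map_comp o_def bind_return_pmf flip: map_pmf_def)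
  have snd\<rho>: "map_pmf snd \<rho> = \<mu>"
  proof -
    have "map_pmf snd \<rho> = map_pmf hd (bind_pmf \<eta> ?T)"
      by (simp add: \<rho>_def map_bind_pmf pmf.map_comp o_def)
    then show ?thesis by (simp add: inv \<mu>_def)
  qed
  have fsts: "set_pmf \<mu> = fst ` set_pmf \<rho>" unfolding fst\<rho>[symmetric] by simp
  have ne: "set_pmf \<rho> \<inter> {y. a = fst y} \<noteq> {}" if "a \<in> set_pmf \<mu>" for a using that unfolding fsts by auto
  have disint: "bind_pmf \<mu> (\<lambda>a. cond_pmf \<rho> {y. a = fst y}) = \<rho>"
  proof (rule bind_cond_pmf_cancel)
    show "set_pmf \<rho> \<inter> {y. x = fst y} \<noteq> {}" if "x \<in> set_pmf \<mu>" for x using ne[OF that] .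
    show "set_pmf \<mu> \<inter> {x. x = fst y} \<noteq> {}" if "y \<in> set_pmf \<rho>" for y using that unfolding fsts by auto
    show "measure \<rho> {y. x = fst y} = measure \<mu> {z. z = fst y}" if "x = fst y" for x y
    proof -
      have "(fst -` {z. z = fst y} :: ('act \<times> 'act) set) = {y. x = fst y}" using that by auto
      then show ?thesis unfolding fst\<rho>[symmetric] measure_map_pmf by (simp only:)
    qed
  qed
  have Kset: "b \<in> set_pmf (K a) \<longleftrightarrow> (a, b) \<in> set_pmf \<rho>" if "a \<in> set_pmf \<mu>" for a b
    unfolding K_def set_map_pmf set_cond_pmf[OF ne[OF that]] by force
  have q1: "q\<^sub>1 = map_pmf (\<lambda>a. [a]) \<mu>" by (simp add: q\<^sub>1_def \<mu>_def pmf.map_comp o_def)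
  have inv1: "bind_pmf q\<^sub>1 T\<^sub>1 = q\<^sub>1"
  proof -
    have "bind_pmf q\<^sub>1 T\<^sub>1 = map_pmf (\<lambda>a. [a]) (map_pmf snd (bind_pmf \<mu> (\<lambda>a. cond_pmf \<rho> {y. a = fst y})))"
      unfolding q1 T\<^sub>1_def[abs_def] K_def by (simp add: bind_map_pmf map_bind_pmf)
    then show ?thesis by (simp add: disint snd\<rho> q1)
  qed
  have law1: "chain_law T\<^sub>1 q\<^sub>1 k = q\<^sub>1" for k by (induction k) (simp_all add: inv1)
  have fin\<mu>: "finite (set_pmf \<mu>)" by (rule finite_subset[of _ UNIV]) auto
  have cost1: "measure_pmf.expectation q\<^sub>1 (switching_cost C T\<^sub>1)
      = measure_pmf.expectation \<eta> (switching_cost C ?T)"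
  proof -
    have "measure_pmf.expectation q\<^sub>1 (switching_cost C T\<^sub>1)
      = measure_pmf.expectation \<mu> (\<lambda>a. measure_pmf.expectation (cond_pmf \<rho> {y. a = fst y}) (\<lambda>y. C $ a $ snd y))"
      unfolding q1 switching_cost_def step_def T\<^sub>1_def K_def by simp
    also have "\<dots> = measure_pmf.expectation \<mu> (\<lambda>a. measure_pmf.expectation (cond_pmf \<rho> {y. a = fst y}) (\<lambda>y. C $ fst y $ snd y))"
      by (intro integral_cong_AE AE_pmfI) (auto simp: set_cond_pmf[OF ne])
    also have "\<dots> = measure_pmf.expectation \<rho> (\<lambda>y. C $ fst y $ snd y)"
      by (subst (2) disint[symmetric], subst integral_bind_finite_pmf) (auto intro: finite_subset[OF subset_UNIV finite_class.finite_UNIV])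
    also have "\<dots> = measure_pmf.expectation \<eta> (switching_cost C ?T)"
      unfolding \<rho>_def switching_cost_def step_def
      by (subst integral_bind_finite_pmf) (use Sfin in \<open>auto simp: S_def intro: finite_subset[OF subset_UNIV finite_class.finite_UNIV]\<close>)
    finally show ?thesis .
  qed
  have cost_eq: "limsup (\<lambda>n. ereal (time_average T\<^sub>1 q\<^sub>1 (switching_cost C T\<^sub>1) n))
      = limsup (\<lambda>n. ereal (time_average ?T (fst \<pi>) (switching_cost C ?T) n))"
  proof -
    have "\<forall>\<^sub>F n in sequentially. ereal (time_average T\<^sub>1 q\<^sub>1 (switching_cost C T\<^sub>1) n)
        = ereal (measure_pmf.expectation \<eta> (switching_cost C ?T))"
      using eventually_gt_at_top[of 0] by eventually_elim (simp add: time_average_def law1 cost1)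
    then have "limsup (\<lambda>n. ereal (time_average T\<^sub>1 q\<^sub>1 (switching_cost C T\<^sub>1) n))
        = limsup (\<lambda>n. ereal (measure_pmf.expectation \<eta> (switching_cost C ?T)))"
      by (rule Limsup_eq)
    also have "\<dots> = ereal (measure_pmf.expectation \<eta> (switching_cost C ?T))"
      by (rule Limsup_const) simp
    finally show ?thesis using cost by simp
  qed
  have ol1: "open_loop_policy 1 (q\<^sub>1, T\<^sub>1)"
    unfolding open_loop_policy_def by (auto simp: q1 T\<^sub>1_def length_Suc_conv)
  interpret one: finite_chain "{v. length v = 1}" T\<^sub>1
    using window_chain(1)[OF ol1] by simp
  have sub1: "set_pmf q\<^sub>1 \<subseteq> {v. length v = 1}" by (auto simp: q1)
  have lower: "\<exists>h. \<forall>v\<in>set_pmf q\<^sub>1. h v - step T\<^sub>1 h v + I - \<epsilon> \<le> D m' (hd v)"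
    if m': "m' \<in> Ms" and \<epsilon>: "\<epsilon> > 0" for m' \<epsilon>
  proof -
    obtain g1 where "one.harmonic_part (\<lambda>w. D m' (hd w)) g1"
      using one.harmonic_decomposition by blast
    note g1 = this[unfolded one.harmonic_part_def, THEN conjunct1, rule_format]
      and g1_appr = this[unfolded one.harmonic_part_def, THEN conjunct2, THEN conjunct1, rule_format]
      and g1_exp = this[unfolded one.harmonic_part_def, THEN conjunct2, THEN conjunct2, rule_format]
    have fin1: "finite (set_pmf q\<^sub>1)" by (rule finite_subset[OF sub1 one.finite_states])
    define c where "c = Min (g1 ` set_pmf q\<^sub>1)"
    define A where "A = {v \<in> set_pmf q\<^sub>1. g1 v = c}"
    have cmin: "c \<le> g1 v" if "v \<in> set_pmf q\<^sub>1" for v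
      unfolding c_def using fin1 that by (intro Min_le) auto
    have "c \<in> g1 ` set_pmf q\<^sub>1" unfolding c_def using fin1 by (intro Min_in) (auto simp: set_pmf_not_empty)
    then have Ane: "set_pmf q\<^sub>1 \<inter> A \<noteq> {}" unfolding A_def by auto
    note cl1 = one.invariant_support_closed[OF inv1]
    have Acl: "set_pmf (T\<^sub>1 v) \<subseteq> A" if "v \<in> A" for v
    proof
      fix u assume u: "u \<in> set_pmf (T\<^sub>1 v)"
      have "g1 u = c"
        by (rule one.harmonic_minimal_closed[of "set_pmf q\<^sub>1" g1 c v u])
           (use g1 sub1 cl1 cmin that u in \<open>auto simp: A_def\<close>)
      then show "u \<in> A" using u cl1[of v] that unfolding A_def by auto
    qed
    (* The windows whose first action lies in the minimal class A of the new chain. They are closed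
       under eta, so that A inherits its average from a conditional stationary law of the windows. *)
    define C' where "C' = (\<lambda>w. [hd w]) -` A"
    have C'ne: "set_pmf \<eta> \<inter> C' \<noteq> {}" using Ane unfolding C'_def q\<^sub>1_def by auto
    have C'cl: "set_pmf (?T w) \<subseteq> C'" if w: "w \<in> set_pmf \<eta>" "w \<in> C'" for w
    proof
      fix v assume v: "v \<in> set_pmf (?T w)"
      have "(hd w, hd v) \<in> set_pmf \<rho>" unfolding \<rho>_def using w v by auto
      moreover have "hd w \<in> set_pmf \<mu>" using w by (auto simp: \<mu>_def)
      ultimately have "[hd v] \<in> set_pmf (T\<^sub>1 [hd w])" by (auto simp: T\<^sub>1_def Kset)
      then show "v \<in> C'" using Acl[of "[hd w]"] w(2) unfolding C'_def by auto
    qed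
    have "set_pmf (cond_pmf q\<^sub>1 A) \<subseteq> {v. length v = 1}" using sub1 by (auto simp: set_cond_pmf[OF Ane])
    moreover have "bind_pmf (cond_pmf q\<^sub>1 A) T\<^sub>1 = cond_pmf q\<^sub>1 A"
      by (rule one.cond_invariant[OF sub1 inv1 _ Ane]) (rule Acl)
    ultimately have "measure_pmf.expectation (cond_pmf q\<^sub>1 A) (\<lambda>w. D m' (hd w)) = measure_pmf.expectation (cond_pmf q\<^sub>1 A) g1"
      by (rule g1_exp)
    also have "\<dots> = measure_pmf.expectation (cond_pmf q\<^sub>1 A) (\<lambda>_. c)"
      by (intro integral_cong_AE AE_pmfI) (unfold set_cond_pmf[OF Ane], auto simp: A_def)
    finally have c1: "measure_pmf.expectation (cond_pmf q\<^sub>1 A) (\<lambda>w. D m' (hd w)) = c" by simp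
    have "cond_pmf q\<^sub>1 A = map_pmf (\<lambda>w. [hd w]) (cond_pmf \<eta> C')"
      unfolding q\<^sub>1_def C'_def by (rule cond_map_pmf) (use C'ne in \<open>simp add: C'_def\<close>)
    with c1 have c2: "measure_pmf.expectation (cond_pmf \<eta> C') (\<lambda>w. D m' (hd w)) = c" by simp
    have setC: "set_pmf (cond_pmf \<eta> C') \<subseteq> S" by (auto simp: set_cond_pmf[OF C'ne] S_def)
    have "bind_pmf (cond_pmf \<eta> C') ?T = cond_pmf \<eta> C'"
      by (rule cond_invariant[OF \<eta>S inv _ C'ne]) (rule C'cl)
    then have c3: "measure_pmf.expectation (cond_pmf \<eta> C') (g m') = c"
      using g_exp[OF order_trans[OF setC S], of m'] c2 by simp
    have "measure_pmf.expectation (cond_pmf \<eta> C') (\<lambda>_. I) \<le> measure_pmf.expectation (cond_pmf \<eta> C') (g m')"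
      using setC Imin[OF m'] finite_subset[OF setC Sfin(1)]
      by (intro integral_mono_AE AE_pmfI integrable_measure_pmf_finite) auto
    with c3 have "I \<le> c" by simp
    obtain h where h: "\<forall>w\<in>{v. length v = 1}. \<bar>D m' (hd w) - (h w - step T\<^sub>1 h w) - g1 w\<bar> \<le> \<epsilon>"
      using g1_appr[OF \<epsilon>] by blast
    have "h v - step T\<^sub>1 h v + I - \<epsilon> \<le> D m' (hd v)" if "v \<in> set_pmf q\<^sub>1" for v
      using bspec[OF h subsetD[OF sub1 that]] cmin[OF that] \<open>I \<le> c\<close> by (simp add: abs_le_iff)
    then show ?thesis by blast
  qed
  show thesis
  proof (rule that[of "(q\<^sub>1, T\<^sub>1)" I "set_pmf q\<^sub>1" m B], goal_cases)
    case 1 show ?case by (rule ol1)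
  next
    case 2 show ?case using cost_eq by simp
  next
    case 3 show ?case by (rule I0)
  next
    case (6 v) then show ?case using one.invariant_support_closed[OF inv1] by simp
  next
    case (7 m' \<epsilon>) then show ?case using lower by simp
  next
    case 9 show ?case using Bne by auto
  next
    case 11 show ?case using \<eta>_reach by (auto simp: B_def S_def)
  next
    case (14 \<epsilon>) then show ?case by (rule upper)
  qed (use m Bcl S Sfin degenerate finite_subset[OF sub1 one.finite_states] in \<open>auto simp: B_def\<close>)
qed

section \<open>The law of the chain of windows\<close>

text \<open>The law of the first \<open>t + 1\<close> windows, as lists.\<close>

primrec path_pmf :: "('b \<Rightarrow> 'b pmf) \<Rightarrow> 'b pmf \<Rightarrow> nat \<Rightarrow> 'b list pmf" where
  "path_pmf T q 0 = map_pmf (\<lambda>w. [w]) q"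
| "path_pmf T q (Suc t) = bind_pmf (path_pmf T q t) (\<lambda>l. map_pmf (\<lambda>w. l @ [w]) (T (last l)))"

lemma length_path: "l \<in> set_pmf (path_pmf T q t) \<Longrightarrow> length l = Suc t"
  by (induction t arbitrary: l) auto

lemma set_path:
  "l \<in> set_pmf (path_pmf T q t) \<Longrightarrow>
     l ! 0 \<in> set_pmf q \<and> (\<forall>i<t. l ! Suc i \<in> set_pmf (T (l ! i)))"
proof (induction t arbitrary: l)
  case (Suc t)
  then obtain l' w where l': "l' \<in> set_pmf (path_pmf T q t)" "w \<in> set_pmf (T (last l'))" "l = l' @ [w]"
    by auto
  have len: "length l' = Suc t" using length_path[OF l'(1)] .
  have "last l' = l' ! t" using len by (subst last_conv_nth) auto
  then show ?case using Suc.IH[OF l'(1)] l'(2,3) len by (auto simp: nth_append less_Suc_eq)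
qed auto

lemma pmf_path:
  "pmf (path_pmf T q t) l =
     (if length l = Suc t then pmf q (l ! 0) * (\<Prod>i<t. pmf (T (l ! i)) (l ! Suc i)) else 0)"
proof (cases "length l = Suc t")
  case False
  then show ?thesis using length_path[of l T q t] by (auto simp: set_pmf_iff)
next
  case True
  then show ?thesis
  proof (induction t arbitrary: l)
    case 0
    then obtain w where l: "l = [w]" by (auto simp: length_Suc_conv)
    have "pmf (map_pmf (\<lambda>w. [w]) q) [w] = pmf q w" by (rule pmf_map_inj') (simp add: inj_def)
    then show ?case by (simp add: l)
  next
    case (Suc t)
    then have "l \<noteq> []" by auto
    then obtain l0 v where l: "l = l0 @ [v]" by (metis append_butlast_last_id)
    with Suc.prems have len: "length l0 = Suc t" by simp
    have last: "last l0 = l0 ! t" using len by (subst last_conv_nth) auto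
    have "pmf (map_pmf (\<lambda>w. l' @ [w]) (T (last l'))) (l0 @ [v])
        = indicator {l0} l' * pmf (T (last l0)) v" for l'
    proof (cases "l' = l0")
      case True
      then show ?thesis using pmf_map_inj'[of "\<lambda>w. l0 @ [w]" "T (last l0)" v] by (simp add: inj_def)
    next
      case False
      then have "l0 @ [v] \<notin> set_pmf (map_pmf (\<lambda>w. l' @ [w]) (T (last l')))" by auto
      then show ?thesis using False by (simp only: set_pmf_iff not_not) simp
    qed
    then have "pmf (path_pmf T q (Suc t)) l = pmf (path_pmf T q t) l0 * pmf (T (last l0)) v"
      by (simp add: l pmf_bind measure_pmf_single)
    also have "\<dots> = pmf q (l ! 0) * (\<Prod>i<Suc t. pmf (T (l ! i)) (l ! Suc i))"
      unfolding Suc.IH[OF len] using len by (simp add: l last nth_append)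
    finally show ?case using Suc.prems by simp
  qed
qed

lemma map_last_path: "map_pmf last (path_pmf T q t) = chain_law T q t"
proof (induction t)
  case 0
  show ?case by (simp add: pmf.map_comp o_def)
next
  case (Suc t)
  have "map_pmf last (path_pmf T q (Suc t)) = bind_pmf (path_pmf T q t) (\<lambda>l. T (last l))"
    by (simp add: map_bind_pmf pmf.map_comp o_def)
  also have "\<dots> = bind_pmf (map_pmf last (path_pmf T q t)) T" by (simp add: bind_map_pmf)
  finally show ?case by (simp add: Suc)
qed

lemma space_window_measure [simp]: "space (window_measure (\<pi> :: 'act::finite policy)) = UNIV"
  using sets_eq_imp_space_eq[OF sets_window_measure[of \<pi>]] by (simp add: space_PiM)

lemma measurable_window_coordinate [measurable]:
  "(\<lambda>w. w k) \<in> window_measure (\<pi> :: 'act::finite policy) \<rightarrow>\<^sub>M count_space UNIV"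
  by (simp add: measurable_cong_sets[OF sets_window_measure refl] measurable_component_singleton)

lemma map_upt_eq_iff: "map w [0..<n] = l \<longleftrightarrow> length l = n \<and> (\<forall>i<n. w i = l ! i)"
  by (auto simp: list_eq_iff_nth_eq)

lemma measurable_window_prefix:
  "(\<lambda>w. map w [0..<n]) \<in> window_measure (\<pi> :: 'act::finite policy) \<rightarrow>\<^sub>M count_space UNIV"
proof -
  have "(\<lambda>w. map w [0..<n]) -` {l} \<inter> space (window_measure \<pi>) \<in> sets (window_measure \<pi>)" for l :: "'act list list"
  proof -
    have "(\<lambda>w. map w [0..<n]) -` {l} \<inter> space (window_measure \<pi>)
      = {w \<in> space (window_measure \<pi>). length l = n \<and> (\<forall>i\<in>{..<n}. w i = l ! i)}"
      by (auto simp: map_upt_eq_iff)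
    moreover have "{w \<in> space (window_measure \<pi>). w i = l ! i} \<in> sets (window_measure \<pi>)" for i
      using measurable_sets[OF measurable_window_coordinate[of i \<pi>], of "{l ! i}"] by (simp add: vimage_def)
    then have "{w \<in> space (window_measure \<pi>). length l = n \<and> (\<forall>i\<in>{..<n}. w i = l ! i)} \<in> sets (window_measure \<pi>)"
      by (intro sets.sets_Collect_conj sets.sets_Collect_const sets.sets_Collect_finite_All) auto
    ultimately show ?thesis by simp
  qed
  then show ?thesis
    unfolding measurable_count_space_eq_countable[OF countableI_type] by blast
qed

text \<open>Reduces computations with finitely many windows to discrete distributions on lists.\<close>

lemma distr_window_prefix:
  fixes \<pi> :: "'act::finite policy"
  shows "distr (window_measure \<pi>) (count_space UNIV) (\<lambda>w. map w [0..<Suc t])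
    = measure_pmf (path_pmf (snd \<pi>) (fst \<pi>) t)"
proof (rule measure_eqI_countable[where A = UNIV])
  fix l :: "'act list list"
  show "emeasure (distr (window_measure \<pi>) (count_space UNIV) (\<lambda>w. map w [0..<Suc t])) {l}
      = emeasure (measure_pmf (path_pmf (snd \<pi>) (fst \<pi>) t)) {l}"
  proof (cases "length l = Suc t")
    case True
    have "(\<lambda>w. map w [0..<Suc t]) -` {l} = {w. \<forall>i\<le>t. w i = l ! i}"
      using True by (simp add: vimage_def map_upt_eq_iff less_Suc_eq_le del: upt_Suc)
    then show ?thesis
      using True
      by (simp add: emeasure_distr[OF measurable_window_prefix] emeasure_window_measure_cylinder
            emeasure_pmf_single pmf_path del: upt_Suc)
  next
    case False
    then have "(\<lambda>w. map w [0..<Suc t]) -` {l} = {}"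
      by (simp add: vimage_def map_upt_eq_iff del: upt_Suc)
    then show ?thesis
      using False
      by (simp add: emeasure_distr[OF measurable_window_prefix] emeasure_pmf_single pmf_path del: upt_Suc)
  qed
qed auto

lemma integral_window_prefix:
  fixes \<pi> :: "'act::finite policy" and g :: "'act list list \<Rightarrow> real"
  shows "(\<integral>w. g (map w [0..<Suc t]) \<partial>window_measure \<pi>)
    = measure_pmf.expectation (path_pmf (snd \<pi>) (fst \<pi>) t) g"
  unfolding distr_window_prefix[symmetric]
  by (rule integral_distr[symmetric, OF measurable_window_prefix]) simp

lemma AE_window_prefix:
  fixes \<pi> :: "'act::finite policy"
  assumes "\<And>l. l \<in> set_pmf (path_pmf (snd \<pi>) (fst \<pi>) t) \<Longrightarrow> P l"
  shows "AE w in window_measure \<pi>. P (map w [0..<Suc t])"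
proof -
  have "AE l in distr (window_measure \<pi>) (count_space UNIV) (\<lambda>w. map w [0..<Suc t]). P l"
    unfolding distr_window_prefix using assms by (intro AE_pmfI)
  then show ?thesis by (subst (asm) AE_distr_iff[OF measurable_window_prefix]) auto
qed

lemma AE_window_transitions:
  fixes \<pi> :: "'act::finite policy"
  shows "AE w in window_measure \<pi>. w 0 \<in> set_pmf (fst \<pi>) \<and> (\<forall>k. w (Suc k) \<in> set_pmf (snd \<pi> (w k)))"
proof -
  have "AE w in window_measure \<pi>. w 0 \<in> set_pmf (fst \<pi>) \<and> (\<forall>i<k. w (Suc i) \<in> set_pmf (snd \<pi> (w i)))" for k
    using AE_window_prefix[of \<pi> k "\<lambda>l. l ! 0 \<in> set_pmf (fst \<pi>) \<and> (\<forall>i<k. l ! Suc i \<in> set_pmf (snd \<pi> (l ! i)))"]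
      set_path[of _ "snd \<pi>" "fst \<pi>" k]
    by (auto simp del: upt_Suc)
  then have "AE w in window_measure \<pi>. \<forall>k. w 0 \<in> set_pmf (fst \<pi>) \<and> (\<forall>i<k. w (Suc i) \<in> set_pmf (snd \<pi> (w i)))"
    by (subst AE_all_countable) simp
  then show ?thesis by eventually_elim blast
qed

lemma integral_window_coordinate:
  fixes \<pi> :: "'act::finite policy" and g :: "'act list \<Rightarrow> real"
  shows "(\<integral>w. g (w t) \<partial>window_measure \<pi>) = measure_pmf.expectation (chain_law (snd \<pi>) (fst \<pi>) t) g"
  using integral_window_prefix[where g = "\<lambda>l. g (last l)" and t = t and \<pi> = \<pi>]
  by (simp flip: map_last_path)

text \<open>The Markov property, integrated against functions of the past. Windows that are visited have length \<open>W\<close>,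
  so all distributions that occur have finite support.\<close>

lemma window_markov:
  fixes \<pi> :: "'act::finite policy" and g :: "'act list list \<Rightarrow> real"
  assumes \<pi>: "open_loop_policy W \<pi>" "W \<ge> 1"
  shows "(\<integral>w. g (map w [0..<Suc t]) * h (w (Suc t)) \<partial>window_measure \<pi>)
    = (\<integral>w. g (map w [0..<Suc t]) * step (snd \<pi>) h (w t) \<partial>window_measure \<pi>)"
proof -
  interpret finite_chain "{w. length w = W}" "snd \<pi>" by (rule window_chain[OF \<pi>])
  let ?P = "path_pmf (snd \<pi>) (fst \<pi>)"
  have lens: "\<forall>x\<in>set l. length x = W" if "l \<in> set_pmf (?P t)" for l t
    using that
  proof (induction t arbitrary: l)
    case (Suc t)
    then obtain l' v where l': "l' \<in> set_pmf (?P t)" "v \<in> set_pmf (snd \<pi> (last l'))" "l = l' @ [v]" by auto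
    have "last l' \<in> set l'" using length_path[OF l'(1)] by (intro last_in_set) auto
    with Suc.IH[OF l'(1)] have "last l' \<in> {w. length w = W}" by simp
    from subsetD[OF closed_states[OF this] l'(2)] show ?case using Suc.IH[OF l'(1)] l'(3) by auto
  qed (use window_chain(2)[OF \<pi>] in auto)
  have fin: "finite (set_pmf (?P t))" for t
    by (rule finite_subset[OF _ finite_lists_length_eq[OF finite_states, of "Suc t"]])
       (auto dest: lens length_path)
  have fin': "finite (set_pmf (snd \<pi> (last l)))" if "l \<in> set_pmf (?P t)" for l t
  proof -
    have "last l \<in> set l" using length_path[OF that] by (intro last_in_set) auto
    with lens[OF that] have "last l \<in> {w. length w = W}" by simp
    then show ?thesis using closed_states finite_states finite_subset by blast
  qed
  have "(\<integral>w. g (map w [0..<Suc t]) * h (w (Suc t)) \<partial>window_measure \<pi>)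
     = measure_pmf.expectation (?P (Suc t)) (\<lambda>l. g (butlast l) * h (last l))"
    using integral_window_prefix[where g = "\<lambda>l. g (butlast l) * h (last l)" and t = "Suc t" and \<pi> = \<pi>]
    by (simp add: butlast_append)
  also have "\<dots> = measure_pmf.expectation (?P t) (\<lambda>l. g l * step (snd \<pi>) h (last l))"
    unfolding path_pmf.simps step_def using fin fin'
    by (subst integral_bind_finite_pmf) auto
  also have "\<dots> = (\<integral>w. g (map w [0..<Suc t]) * step (snd \<pi>) h (w t) \<partial>window_measure \<pi>)"
    using integral_window_prefix[where g = "\<lambda>l. g l * step (snd \<pi>) h (last l)" and t = t and \<pi> = \<pi>]
    by simp
  finally show ?thesis .
qed

section \<open>Lifting a policy of window size one\<close>

text \<open>The windows of size \<open>W\<close> of the action sequence that \<open>\<pi>\<close> produces.\<close>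

definition lift_policy :: "nat \<Rightarrow> 'act policy \<Rightarrow> 'act policy" where
  "lift_policy W \<pi> =
     (map_pmf (map hd) (path_pmf (snd \<pi>) (fst \<pi>) (W - 1)),
      \<lambda>w. map_pmf (\<lambda>v. tl w @ [hd v]) (snd \<pi> [last w]))"

lemma open_loop_lift_policy: "W \<ge> 1 \<Longrightarrow> open_loop_policy W (lift_policy W \<pi>)"
  unfolding open_loop_policy_def lift_policy_def fst_conv snd_conv set_map_pmf
  by (intro conjI ballI allI impI) (elim imageE, simp add: length_path, blast)

text \<open>From a list of windows of size one, that is, of actions, the first \<open>n\<close> windows of size \<open>W\<close>.\<close>

definition sliding_windows :: "nat \<Rightarrow> nat \<Rightarrow> 'act list list \<Rightarrow> 'act list list" where
  "sliding_windows W n l = map (\<lambda>k. map (\<lambda>i. hd (l ! (k + i))) [0..<W]) [0..<n]"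

lemma sliding_windows_snoc:
  assumes "length l = Suc (t + W)"
  shows "sliding_windows (Suc W) (Suc (Suc t)) (l @ [v])
    = sliding_windows (Suc W) (Suc t) l @ [tl (last (sliding_windows (Suc W) (Suc t) l)) @ [hd v]]"
proof -
  have "sliding_windows (Suc W) (Suc t) (l @ [v]) = sliding_windows (Suc W) (Suc t) l"
    unfolding sliding_windows_def using assms
    by (intro map_cong refl arg_cong[where f = hd]) (auto simp: nth_append)
  moreover have "map (\<lambda>i. hd ((l @ [v]) ! (Suc t + i))) [0..<Suc W]
      = tl (map (\<lambda>i. hd (l ! (t + i))) [0..<Suc W]) @ [hd v]"
    using assms by (intro nth_equalityI) (auto simp: nth_append nth_tl less_Suc_eq simp del: upt_Suc)
  ultimately show ?thesis by (simp add: sliding_windows_def del: upt_Suc) (simp add: sliding_windows_def)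
qed

lemma path_lift_policy:
  fixes \<pi> :: "'act::finite policy"
  assumes \<pi>: "open_loop_policy 1 \<pi>"
  shows "path_pmf (snd (lift_policy (Suc W) \<pi>)) (fst (lift_policy (Suc W) \<pi>)) t
    = map_pmf (sliding_windows (Suc W) (Suc t)) (path_pmf (snd \<pi>) (fst \<pi>) (t + W))"
proof (induction t)
  case 0
  have "map_pmf (\<lambda>l. [map hd l]) (path_pmf (snd \<pi>) (fst \<pi>) W)
     = map_pmf (sliding_windows (Suc W) (Suc 0)) (path_pmf (snd \<pi>) (fst \<pi>) W)"
  proof (rule map_pmf_cong[OF refl])
    fix l assume "l \<in> set_pmf (path_pmf (snd \<pi>) (fst \<pi>) W)"
    from length_path[OF this] show "[map hd l] = sliding_windows (Suc W) (Suc 0) l"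
      by (intro nth_equalityI) (simp_all add: sliding_windows_def list_eq_iff_nth_eq[of "map hd l"] del: upt_Suc)
  qed
  then show ?case by (simp add: lift_policy_def pmf.map_comp o_def)
next
  case (Suc t)
  let ?s = "sliding_windows (Suc W) (Suc t)"
  have *: "map_pmf (\<lambda>v. ?s l @ [tl (last (?s l)) @ [hd v]]) (snd \<pi> [last (last (?s l))])
     = map_pmf (\<lambda>v. sliding_windows (Suc W) (Suc (Suc t)) (l @ [v])) (snd \<pi> (last l))"
    if l: "l \<in> set_pmf (path_pmf (snd \<pi>) (fst \<pi>) (t + W))" for l
  proof -
    have len: "length l = Suc (t + W)" by (rule length_path[OF l])
    have "last l = l ! (t + W)" using len by (subst last_conv_nth) auto
    moreover have "length (l ! (t + W)) = 1"
    proof (cases "t + W")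
      case 0
      then show ?thesis using set_path[OF l] \<pi> unfolding open_loop_policy_def by auto
    next
      case (Suc j)
      have "length (l ! i) = 1" if "i \<le> t + W" for i
        using that
      proof (induction i)
        case 0 then show ?case using set_path[OF l] \<pi> unfolding open_loop_policy_def by auto
      next
        case (Suc i)
        then have "l ! Suc i \<in> set_pmf (snd \<pi> (l ! i))" "length (l ! i) = 1" using set_path[OF l] by auto
        with \<pi> obtain a where "l ! Suc i = tl (l ! i) @ [a]" unfolding open_loop_policy_def by blast
        then show ?case using \<open>length (l ! i) = 1\<close> by simp
      qed
      then show ?thesis by simp
    qed
    ultimately have "[hd (l ! (t + W))] = last l" by (cases "l ! (t + W)") auto
    moreover have "last (last (?s l)) = hd (l ! (t + W))" by (simp add: sliding_windows_def)
    ultimately show ?thesis using sliding_windows_snoc[OF len] by simp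
  qed
  have "path_pmf (snd (lift_policy (Suc W) \<pi>)) (fst (lift_policy (Suc W) \<pi>)) (Suc t)
    = bind_pmf (path_pmf (snd \<pi>) (fst \<pi>) (t + W))
        (\<lambda>l. map_pmf (\<lambda>v. ?s l @ [tl (last (?s l)) @ [hd v]]) (snd \<pi> [last (last (?s l))]))"
    unfolding path_pmf.simps(2) Suc.IH by (simp add: lift_policy_def bind_map_pmf pmf.map_comp o_def)
  also have "\<dots> = bind_pmf (path_pmf (snd \<pi>) (fst \<pi>) (t + W))
        (\<lambda>l. map_pmf (\<lambda>v. sliding_windows (Suc W) (Suc (Suc t)) (l @ [v])) (snd \<pi> (last l)))"
    by (rule bind_pmf_cong[OF refl *])
  also have "\<dots> = map_pmf (sliding_windows (Suc W) (Suc (Suc t))) (path_pmf (snd \<pi>) (fst \<pi>) (Suc t + W))"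
    by (simp add: map_bind_pmf pmf.map_comp o_def)
  finally show ?case .
qed

text \<open>The lifted window sequence is a function of the action sequence; both laws agree on finitely
  many coordinates by the corresponding fact about paths.\<close>

lemma window_measure_lift_policy:
  fixes \<pi> :: "'act::finite policy" and W :: nat
  assumes \<pi>: "open_loop_policy 1 \<pi>"
  defines "\<Phi> \<equiv> \<lambda>(v :: nat \<Rightarrow> 'act list) k. map (\<lambda>i. hd (v (k + i))) [0..<Suc W]"
  shows "\<Phi> \<in> window_measure \<pi> \<rightarrow>\<^sub>M PiM UNIV (\<lambda>_. count_space UNIV)"
    and "distr (window_measure \<pi>) (PiM UNIV (\<lambda>_. count_space UNIV)) \<Phi> = window_measure (lift_policy (Suc W) \<pi>)"
proof -
  show \<Phi>: "\<Phi> \<in> window_measure \<pi> \<rightarrow>\<^sub>M PiM UNIV (\<lambda>_. count_space UNIV)"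
  proof (rule measurable_PiM_single')
    fix k :: nat
    have "\<Phi> v k = (\<lambda>l. map (\<lambda>i. hd (l ! (k + i))) [0..<Suc W]) (map v [0..<k + Suc W])" for v
      unfolding \<Phi>_def by (intro map_cong refl) (simp del: upt_Suc)
    then show "(\<lambda>v. \<Phi> v k) \<in> window_measure \<pi> \<rightarrow>\<^sub>M count_space UNIV"
      by (simp only:) (rule measurable_compose[OF measurable_window_prefix], simp)
  qed (simp add: PiE_UNIV_domain)
  show "distr (window_measure \<pi>) (PiM UNIV (\<lambda>_. count_space UNIV)) \<Phi> = window_measure (lift_policy (Suc W) \<pi>)"
  proof (rule measure_eqI_PiM_infinite)
    fix A :: "nat \<Rightarrow> 'act list set" and J :: "nat set"
    assume J: "finite J"
    define t where "t = Max (insert 0 J)"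
    have t: "j < Suc t" if "j \<in> J" for j using J that unfolding t_def by (simp add: less_Suc_eq_le)
    let ?E = "prod_emb UNIV (\<lambda>_. count_space UNIV) J (Pi\<^sub>E J A)"
    define F where "F = {l :: 'act list list. \<forall>j\<in>J. l ! j \<in> A j}"
    have E: "w \<in> ?E \<longleftrightarrow> map w [0..<Suc t] \<in> F" for w :: "nat \<Rightarrow> 'act list"
      unfolding F_def prod_emb_def space_PiM PiE_UNIV_domain
      by (auto simp: PiE_iff restrict_def extensional_def t simp del: upt_Suc)
    have Es: "?E \<in> sets (PiM UNIV (\<lambda>_. count_space UNIV))"
      using J by (intro sets_PiM_I) auto
    have "emeasure (distr (window_measure \<pi>) (PiM UNIV (\<lambda>_. count_space UNIV)) \<Phi>) ?E
       = emeasure (window_measure \<pi>) {w. map (\<Phi> w) [0..<Suc t] \<in> F}"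
      by (subst emeasure_distr[OF \<Phi> Es]) (auto simp: E vimage_def simp del: upt_Suc)
    also have "\<dots> = emeasure (window_measure \<pi>)
        ((\<lambda>w. map w [0..<Suc (t + W)]) -` (sliding_windows (Suc W) (Suc t) -` F) \<inter> space (window_measure \<pi>))"
    proof -
      have "map (\<Phi> w) [0..<Suc t] = sliding_windows (Suc W) (Suc t) (map w [0..<Suc (t + W)])" for w
        unfolding sliding_windows_def \<Phi>_def by (intro map_cong refl) (simp del: upt_Suc)
      then show ?thesis by (simp add: vimage_def del: upt_Suc)
    qed
    also have "\<dots> = emeasure (measure_pmf (path_pmf (snd \<pi>) (fst \<pi>) (t + W))) (sliding_windows (Suc W) (Suc t) -` F)"
      unfolding distr_window_prefix[symmetric] by (rule emeasure_distr[symmetric, OF measurable_window_prefix]) simp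
    also have "\<dots> = emeasure (measure_pmf (path_pmf (snd (lift_policy (Suc W) \<pi>)) (fst (lift_policy (Suc W) \<pi>)) t)) F"
      unfolding path_lift_policy[OF \<pi>] by simp
    also have "\<dots> = emeasure (window_measure (lift_policy (Suc W) \<pi>)) ((\<lambda>w. map w [0..<Suc t]) -` F \<inter> space (window_measure (lift_policy (Suc W) \<pi>)))"
      unfolding distr_window_prefix[symmetric] by (rule emeasure_distr[OF measurable_window_prefix]) simp
    also have "(\<lambda>w. map w [0..<Suc t]) -` F \<inter> space (window_measure (lift_policy (Suc W) \<pi>)) = ?E"
      by (auto simp: E vimage_def simp del: upt_Suc)
    finally show "emeasure (distr (window_measure \<pi>) (PiM UNIV (\<lambda>_. count_space UNIV)) \<Phi>) ?E
       = emeasure (window_measure (lift_policy (Suc W) \<pi>)) ?E" .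
  next
    show "finite_measure (distr (window_measure \<pi>) (PiM UNIV (\<lambda>_. count_space UNIV)) \<Phi>)"
      by (intro prob_space.finite_measure prob_space.prob_space_distr prob_space_window_measure \<Phi>)
  qed simp_all
qed

text \<open>The observations depend on the policy only through the action sequence, which lifting keeps.\<close>

lemma obs_measure_lift_policy:
  fixes S :: "('n::finite, 'act::finite, 'y) signal_model"
  assumes S: "signal_model S" and m: "m \<le> num_hyp S"
    and \<pi>: "open_loop_policy 1 \<pi>" and W: "W \<ge> 1"
  shows "obs_measure S (lift_policy W \<pi>) \<nu> m = obs_measure S \<pi> \<nu> m"
proof -
  obtain W' where W': "W = Suc W'" using W by (cases W) auto
  let ?X = "PiM {1..} (\<lambda>t::nat. signal_law S (if enat t < \<nu> then 0 else m))"
  let ?f = "\<lambda>(w, x). \<lambda>t\<in>{1..}. (action_at w t, act S (action_at w t) (x t))"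
  define \<Phi> where "\<Phi> = (\<lambda>(v :: nat \<Rightarrow> 'act list) k. map (\<lambda>i. hd (v (k + i))) [0..<Suc W'])"
  note \<Phi> = window_measure_lift_policy[OF \<pi>, of W', folded \<Phi>_def]
  interpret X: prob_space ?X
    by (intro prob_space_PiM prob_space_signal_law[OF S]) (use m in auto)
  have X: "distr ?X ?X (\<lambda>x. x) = ?X" by simp
  have "window_measure (lift_policy W \<pi>) \<Otimes>\<^sub>M ?X
    = distr (window_measure \<pi>) (PiM UNIV (\<lambda>_. count_space UNIV)) \<Phi> \<Otimes>\<^sub>M distr ?X ?X (\<lambda>x. x)"
    unfolding W' \<Phi>(2)[symmetric] by simp
  also have "\<dots> = distr (window_measure \<pi> \<Otimes>\<^sub>M ?X) (PiM UNIV (\<lambda>_. count_space UNIV) \<Otimes>\<^sub>M ?X) (\<lambda>(w, x). (\<Phi> w, x))"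
    by (rule pair_measure_distr[OF \<Phi>(1)]) (simp_all only: measurable_ident_sets X X.sigma_finite_measure_axioms)
  finally have pair: "window_measure (lift_policy W \<pi>) \<Otimes>\<^sub>M ?X
    = distr (window_measure \<pi> \<Otimes>\<^sub>M ?X) (PiM UNIV (\<lambda>_. count_space UNIV) \<Otimes>\<^sub>M ?X) (\<lambda>(w, x). (\<Phi> w, x))" .
  have \<Phi>m: "(\<lambda>(w, x). (\<Phi> w, x)) \<in> window_measure \<pi> \<Otimes>\<^sub>M ?X \<rightarrow>\<^sub>M PiM UNIV (\<lambda>_. count_space UNIV) \<Otimes>\<^sub>M ?X"
    using \<Phi>(1) by measurable
  have fm: "?f \<in> PiM UNIV (\<lambda>_. count_space UNIV) \<Otimes>\<^sub>M ?X \<rightarrow>\<^sub>M obs_seq_space S"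
    using measurable_obs_map[OF S, of "lift_policy W \<pi>" \<nu> m]
    by (subst (asm) measurable_cong_sets[OF sets_pair_measure_cong[OF sets_window_measure refl] refl])
  have hd: "action_at (\<Phi> w) t = action_at w t" for w t
    unfolding action_at_def \<Phi>_def by (simp add: upt_conv_Cons del: upt_Suc)
  have "obs_measure S (lift_policy W \<pi>) \<nu> m = distr (window_measure \<pi> \<Otimes>\<^sub>M ?X) (obs_seq_space S) (?f \<circ> (\<lambda>(w, x). (\<Phi> w, x)))"
    unfolding obs_measure_def pair by (rule distr_distr[OF fm \<Phi>m])
  also have "?f \<circ> (\<lambda>(w, x). (\<Phi> w, x)) = ?f" by (auto simp: fun_eq_iff hd)
  finally show ?thesis by (simp add: obs_measure_def)
qed

section \<open>One step of the observed process\<close>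

text \<open>Coordinate \<open>t\<close> is split off the product measure and integrated first.\<close>

lemma nn_integral_PiM_coordinate:
  fixes M :: "nat \<Rightarrow> 'a measure"
  assumes prob: "\<And>i. i \<in> I \<Longrightarrow> prob_space (M i)" and t: "t \<in> I"
    and g [measurable]: "g \<in> borel_measurable (PiM I M)" and \<phi> [measurable]: "\<phi> \<in> borel_measurable (M t)"
    and indep: "\<And>x z. x \<in> space (PiM I M) \<Longrightarrow> z \<in> space (M t) \<Longrightarrow> g (x(t := z)) = g x"
  shows "(\<integral>\<^sup>+x. g x * \<phi> (x t) \<partial>PiM I M) = (\<integral>\<^sup>+x. g x \<partial>PiM I M) * (\<integral>\<^sup>+z. \<phi> z \<partial>M t)"
proof -
  let ?J = "I - {t}"
  have ins: "insert t ?J = I" using t by auto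
  interpret J: prob_space "PiM ?J M" by (intro prob_space_PiM prob) auto
  interpret Mt: prob_space "M t" using prob[OF t] .
  have D: "distr (M t \<Otimes>\<^sub>M PiM ?J M) (PiM I M) (\<lambda>(z, X). X(t := z)) = PiM I M"
    using distr_pair_PiM_eq_PiM[of ?J M t, unfolded ins] prob t by simp
  have upd [measurable]: "(\<lambda>(z, X). X(t := z)) \<in> M t \<Otimes>\<^sub>M PiM ?J M \<rightarrow>\<^sub>M PiM I M"
    using measurable_add_dim[of t ?J M] unfolding ins
    by (subst measurable_pair_swap_iff) (simp add: split_beta')
  have upd_in: "X(t := z) \<in> space (PiM I M)" if "X \<in> space (PiM ?J M)" "z \<in> space (M t)" for X z
    using that t by (auto simp: space_PiM PiE_iff extensional_def)
  obtain z0 where z0: "z0 \<in> space (M t)" using Mt.not_empty by auto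
  have gX: "g (X(t := z)) = g (X(t := z0))" if "X \<in> space (PiM ?J M)" "z \<in> space (M t)" for X z
    using indep[OF upd_in[OF that(1) z0] that(2)] by simp
  have z0m: "(\<lambda>X. X(t := z0)) \<in> PiM ?J M \<rightarrow>\<^sub>M PiM I M"
    using measurable_compose[OF measurable_Pair1'[OF z0, of "PiM ?J M"] upd] by simp
  have split: "(\<integral>\<^sup>+x. g x * f (x t) \<partial>PiM I M)
      = (\<integral>\<^sup>+X. g (X(t := z0)) \<partial>PiM ?J M) * (\<integral>\<^sup>+z. f z \<partial>M t)"
    if [measurable]: "f \<in> borel_measurable (M t)" for f
  proof -
    have [measurable]: "(\<lambda>x. f (x t)) \<in> borel_measurable (PiM I M)"
      by (rule measurable_compose[OF measurable_component_singleton[OF t, of M] that])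
    have "(\<integral>\<^sup>+x. g x * f (x t) \<partial>PiM I M)
       = (\<integral>\<^sup>+p. (\<lambda>x. g x * f (x t)) ((\<lambda>(z, X). X(t := z)) p) \<partial>(M t \<Otimes>\<^sub>M PiM ?J M))"
      by (subst D[symmetric], rule nn_integral_distr[OF upd]) simp
    also have "\<dots> = (\<integral>\<^sup>+p. f (fst p) * g ((snd p)(t := z0)) \<partial>(M t \<Otimes>\<^sub>M PiM ?J M))"
      by (intro nn_integral_cong) (auto simp: space_pair_measure gX mult.commute)
    also have "\<dots> = (\<integral>\<^sup>+z. \<integral>\<^sup>+X. f z * g (X(t := z0)) \<partial>PiM ?J M \<partial>M t)"
      using measurable_compose[OF z0m g] by (subst J.nn_integral_fst[symmetric]) simp_all
    also have "\<dots> = (\<integral>\<^sup>+X. g (X(t := z0)) \<partial>PiM ?J M) * (\<integral>\<^sup>+z. f z \<partial>M t)"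
      using measurable_compose[OF z0m g]
      by (simp add: nn_integral_cmult nn_integral_multc mult.commute)
    finally show ?thesis .
  qed
  have "(\<integral>\<^sup>+x. g x \<partial>PiM I M) = (\<integral>\<^sup>+X. g (X(t := z0)) \<partial>PiM ?J M)"
    using split[of "\<lambda>_. 1"] by (simp add: Mt.emeasure_space_1)
  then show ?thesis by (simp add: split[OF \<phi>])
qed

locale detection_model =
  fixes S :: "('n::finite, 'act::finite, 'y) signal_model"
  assumes model: "signal_model S" and KL: "finite_KL S"
begin

lemma num_hyp_ge_1: "num_hyp S \<ge> 1" using model by (simp add: signal_model_def)

lemma measurable_obs_pdf [measurable]: "m \<le> num_hyp S \<Longrightarrow> obs_pdf S m a \<in> borel_measurable (obs_space S)"
  using model by (auto simp: signal_model_def)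

lemma obs_pdf_nonneg: "m \<le> num_hyp S \<Longrightarrow> 0 \<le> obs_pdf S m a y"
  using model by (auto simp: signal_model_def)

lemma measurable_act [measurable]: "act S a \<in> borel \<rightarrow>\<^sub>M obs_space S"
  using model by (auto simp: signal_model_def)

lemma sets_ref_measure [measurable_cong]: "sets (ref_measure S a) = sets (obs_space S)"
  using model by (auto simp: signal_model_def)

lemma obs_law_density:
  "m \<le> num_hyp S \<Longrightarrow> obs_law S m a = density (ref_measure S a) (\<lambda>y. ennreal (obs_pdf S m a y))"
  using model by (auto simp: signal_model_def)

lemma sets_signal_law [measurable_cong, simp]: "sets (signal_law S m) = sets borel"
  by (simp add: signal_law_def)

lemma sets_obs_law [measurable_cong, simp]: "sets (obs_law S m a) = sets (obs_space S)"
  by (simp add: obs_law_def)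

lemma act_signal_law: "act S a \<in> signal_law S m \<rightarrow>\<^sub>M obs_space S"
  using measurable_act by (simp add: measurable_cong_sets[OF sets_signal_law refl])

lemma prob_space_obs_law: "m \<le> num_hyp S \<Longrightarrow> prob_space (obs_law S m a)"
  unfolding obs_law_def
  by (intro prob_space.prob_space_distr prob_space_signal_law[OF model] act_signal_law)

abbreviation obs_pair_space :: "('act \<times> 'y) measure" where
  "obs_pair_space \<equiv> count_space UNIV \<Otimes>\<^sub>M obs_space S"

lemma measurable_action_cases:
  assumes "\<And>a. f a \<in> obs_space S \<rightarrow>\<^sub>M N"
  shows "(\<lambda>p. f (fst p) (snd p)) \<in> obs_pair_space \<rightarrow>\<^sub>M N"
proof (rule measurable_compose_countable'[where f = "\<lambda>i p. f i (snd p)" and g = fst and I = UNIV])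
  show "(\<lambda>p. f i (snd p)) \<in> obs_pair_space \<rightarrow>\<^sub>M N" for i
    by (rule measurable_compose[OF measurable_snd[of "count_space UNIV" "obs_space S"] assms[of i]])
qed (simp_all add: countable_finite)

abbreviation signal_seq :: "enat \<Rightarrow> nat \<Rightarrow> (nat \<Rightarrow> real ^ 'n) measure" where
  "signal_seq \<nu> m \<equiv> PiM {1..} (\<lambda>t. signal_law S (if enat t < \<nu> then 0 else m))"

text \<open>Windows and signal are kept next to each other: the current window contains actions that lie
  in the future, so it is not a function of the observed past.\<close>

definition joint :: "'act policy \<Rightarrow> enat \<Rightarrow> nat \<Rightarrow> ((nat \<Rightarrow> 'act list) \<times> (nat \<Rightarrow> real ^ 'n)) measure" where
  "joint \<pi> \<nu> m = window_measure \<pi> \<Otimes>\<^sub>M signal_seq \<nu> m"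

definition observe :: "(nat \<Rightarrow> 'act list) \<times> (nat \<Rightarrow> real ^ 'n) \<Rightarrow> nat \<Rightarrow> 'act \<times> 'y" where
  "observe = (\<lambda>(w, x). \<lambda>t\<in>{1..}. (action_at w t, act S (action_at w t) (x t)))"

lemma observe_apply: "t \<ge> 1 \<Longrightarrow> observe p t = (hd (fst p (t - 1)), act S (hd (fst p (t - 1))) (snd p t))"
  by (cases p) (simp add: observe_def action_at_def)

lemma measurable_observe [measurable]: "observe \<in> joint \<pi> \<nu> m \<rightarrow>\<^sub>M obs_seq_space S"
  unfolding joint_def observe_def by (rule measurable_obs_map[OF model])

lemma obs_measure_eq_distr: "obs_measure S \<pi> \<nu> m = distr (joint \<pi> \<nu> m) (obs_seq_space S) observe"
  by (simp add: obs_measure_def joint_def observe_def)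

lemma prob_space_signal_seq: "m \<le> num_hyp S \<Longrightarrow> prob_space (signal_seq \<nu> m)"
  by (intro prob_space_PiM prob_space_signal_law[OF model]) auto

lemma prob_space_joint: "m \<le> num_hyp S \<Longrightarrow> prob_space (joint \<pi> \<nu> m)"
  unfolding joint_def by (intro prob_space_pair prob_space_window_measure prob_space_signal_seq)

lemma sets_obs_measure [measurable_cong, simp]: "sets (obs_measure S \<pi> \<nu> m) = sets (obs_seq_space S)"
  by (simp add: obs_measure_def)

lemma space_obs_measure [simp]: "space (obs_measure S \<pi> \<nu> m) = space (obs_seq_space S)"
  by (simp add: obs_measure_def)

lemma measurable_obs_filtration_full: "f \<in> obs_filtration S n \<rightarrow>\<^sub>M N \<Longrightarrow> f \<in> obs_seq_space S \<rightarrow>\<^sub>M N"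
  using measurable_from_subalg[of "obs_seq_space S" "obs_filtration S n" f N]
    obs_filtration_facts(1)[of S] obs_filtration_facts(2)[of n \<infinity> S] obs_filtration_facts(3)[of S]
  by (simp add: subalgebra_def)

lemma obs_filtration_mono:
  assumes "n \<le> n'" "f \<in> obs_filtration S n \<rightarrow>\<^sub>M N"
  shows "f \<in> obs_filtration S n' \<rightarrow>\<^sub>M N"
proof (rule measurable_from_subalg[OF _ assms(2)])
  show "subalgebra (obs_filtration S n') (obs_filtration S n)"
    unfolding subalgebra_def obs_filtration_facts(1) using obs_filtration_facts(2)[OF assms(1)] by blast
qed

lemma sets_obs_filtration_full: "A \<in> sets (obs_filtration S n) \<Longrightarrow> A \<in> sets (obs_seq_space S)"
  using obs_filtration_facts(2)[of n \<infinity> S] obs_filtration_facts(3)[of S] by auto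

lemma measurable_observation:
  assumes "1 \<le> t" "enat t \<le> n"
  shows "(\<lambda>\<omega>. \<omega> t) \<in> obs_filtration S n \<rightarrow>\<^sub>M obs_pair_space"
proof -
  have "(\<lambda>\<omega>. restrict \<omega> {t. 1 \<le> t \<and> enat t \<le> n}) \<in> obs_filtration S n \<rightarrow>\<^sub>M (PiM {t. 1 \<le> t \<and> enat t \<le> n} (\<lambda>_. obs_pair_space))"
    unfolding obs_filtration_def
    by (rule measurable_vimage_algebra1) (auto simp: obs_seq_space_def space_PiM PiE_iff)
  then have "(\<lambda>\<omega>. restrict \<omega> {t. 1 \<le> t \<and> enat t \<le> n} t) \<in> obs_filtration S n \<rightarrow>\<^sub>M obs_pair_space"
    by (rule measurable_compose[OF _ measurable_component_singleton]) (use assms in auto)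
  then show ?thesis using assms by simp
qed

lemma measurable_observation_full: "1 \<le> t \<Longrightarrow> (\<lambda>\<omega>. \<omega> t) \<in> obs_seq_space S \<rightarrow>\<^sub>M obs_pair_space"
  by (rule measurable_obs_filtration_full[OF measurable_observation[of t "enat t"]]) simp_all

text \<open>A function that is measurable with respect to the past depends only on the first \<open>n\<close>
  observations, because its level sets are preimages under the restriction to them.\<close>

lemma obs_filtration_measurable_eq:
  fixes g :: "(nat \<Rightarrow> 'act \<times> 'y) \<Rightarrow> 'b :: t1_space"
  assumes g: "g \<in> borel_measurable (obs_filtration S (enat n))"
    and \<omega>: "\<omega> \<in> space (obs_seq_space S)" "\<omega>' \<in> space (obs_seq_space S)"
    and eq: "\<And>t. 1 \<le> t \<Longrightarrow> t \<le> n \<Longrightarrow> \<omega> t = \<omega>' t"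
  shows "g \<omega> = g \<omega>'"
proof -
  let ?r = "\<lambda>\<omega>. restrict \<omega> {t. 1 \<le> t \<and> enat t \<le> enat n}"
  have "g -` {g \<omega>} \<inter> space (obs_seq_space S) \<in> sets (obs_filtration S (enat n))"
    using measurable_sets[OF g, of "{g \<omega>}"] by (simp add: obs_filtration_facts(1))
  then obtain B where B: "g -` {g \<omega>} \<inter> space (obs_seq_space S) = ?r -` B \<inter> space (obs_seq_space S)"
    unfolding obs_filtration_def
    by (subst (asm) sets_vimage_algebra2) (auto simp: obs_seq_space_def space_PiM PiE_iff)
  have "?r \<omega> = ?r \<omega>'" using eq by (auto simp: restrict_def)
  moreover have "?r \<omega> \<in> B" using B \<omega>(1) by blast
  ultimately have "\<omega>' \<in> ?r -` B \<inter> space (obs_seq_space S)" using \<omega>(2) by simp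
  then have "\<omega>' \<in> g -` {g \<omega>} \<inter> space (obs_seq_space S)" using B by (simp only:)
  then show ?thesis by simp
qed

lemma space_joint: "space (joint \<pi> \<nu> m) = UNIV \<times> space (signal_seq \<nu> m)"
  by (simp add: joint_def space_pair_measure)

lemma observe_in_space: "x \<in> space (signal_seq \<nu> m) \<Longrightarrow> observe (w, x) \<in> space (obs_seq_space S)"
  using measurable_space[OF measurable_observe[of undefined \<nu> m], of "(w, x)"] by (simp add: space_joint)

text \<open>Given the past and the current action, the current observation is a fresh draw: for fixed
  windows the past does not involve the signal at time \<open>t\<close>, which is independent of the rest.\<close>

lemma nn_integral_next_observation:
  fixes m t :: nat and \<nu> :: enat
  assumes m: "m \<le> num_hyp S" and t: "1 \<le> t"
    and g: "g \<in> borel_measurable (obs_filtration S (enat (t - 1)))"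
    and \<phi>: "\<phi> \<in> borel_measurable obs_pair_space"
  defines "\<theta> \<equiv> (if enat t < \<nu> then 0 else m)"
  shows "(\<integral>\<^sup>+\<omega>. g \<omega> * \<phi> (\<omega> t) \<partial>obs_measure S \<pi> \<nu> m)
    = (\<integral>\<^sup>+\<omega>. g \<omega> * (\<integral>\<^sup>+y. \<phi> (fst (\<omega> t), y) \<partial>obs_law S \<theta> (fst (\<omega> t))) \<partial>obs_measure S \<pi> \<nu> m)"
proof -
  interpret X: prob_space "signal_seq \<nu> m" by (rule prob_space_signal_seq[OF m])
  define \<Psi> where "\<Psi> a = (\<integral>\<^sup>+y. \<phi> (a, y) \<partial>obs_law S \<theta> a)" for a
  have g' [measurable]: "g \<in> borel_measurable (obs_seq_space S)" by (rule measurable_obs_filtration_full[OF g])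
  note [measurable] = measurable_observation_full[OF t] \<phi>
  have fm: "(\<lambda>p. g (observe p) * \<phi> (observe p t)) \<in> borel_measurable (joint \<pi> \<nu> m)"
    using measurable_compose[OF measurable_observe g'] 
      measurable_compose[OF measurable_observe measurable_compose[OF measurable_observation_full[OF t] \<phi>]]
    by measurable
  have \<Psi>m: "(\<lambda>\<omega>. \<Psi> (fst (\<omega> t))) \<in> borel_measurable (obs_seq_space S)"
    by (rule measurable_compose[OF measurable_observation_full[OF t]])
       (rule measurable_compose[OF measurable_fst], simp)
  have fm2: "(\<lambda>p. g (observe p) * \<Psi> (fst (observe p t))) \<in> borel_measurable (joint \<pi> \<nu> m)"
    using measurable_compose[OF measurable_observe g'] measurable_compose[OF measurable_observe \<Psi>m]
    by measurable
  have inner: "(\<integral>\<^sup>+x. g (observe (w, x)) * \<phi> (observe (w, x) t) \<partial>signal_seq \<nu> m)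
      = (\<integral>\<^sup>+x. g (observe (w, x)) * \<Psi> (fst (observe (w, x) t)) \<partial>signal_seq \<nu> m)" for w
  proof -
    let ?a = "hd (w (t - 1))"
    have gm: "(\<lambda>x. g (observe (w, x))) \<in> borel_measurable (signal_seq \<nu> m)"
      using measurable_compose[OF measurable_Pair1'[of w "window_measure \<pi>" "signal_seq \<nu> m"]
          measurable_compose[OF measurable_observe g', unfolded joint_def]] by simp
    have am: "act S ?a \<in> signal_law S \<theta> \<rightarrow>\<^sub>M obs_space S" by (rule act_signal_law)
    have \<phi>a: "(\<lambda>y. \<phi> (?a, y)) \<in> borel_measurable (obs_space S)"
      by (rule measurable_compose[OF _ \<phi>]) (rule measurable_Pair1', simp)
    have "(\<integral>\<^sup>+x. g (observe (w, x)) * \<phi> (observe (w, x) t) \<partial>signal_seq \<nu> m)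
       = (\<integral>\<^sup>+x. g (observe (w, x)) * (\<lambda>z. \<phi> (?a, act S ?a z)) (x t) \<partial>signal_seq \<nu> m)"
      using t by (simp add: observe_apply)
    also have "\<dots> = (\<integral>\<^sup>+x. g (observe (w, x)) \<partial>signal_seq \<nu> m) * (\<integral>\<^sup>+z. \<phi> (?a, act S ?a z) \<partial>signal_law S \<theta>)"
      unfolding \<theta>_def
    proof (rule nn_integral_PiM_coordinate)
      show "(\<lambda>z. \<phi> (?a, act S ?a z)) \<in> borel_measurable (signal_law S (if enat t < \<nu> then 0 else m))"
        using measurable_compose[OF am \<phi>a] unfolding \<theta>_def .
      fix x z assume x: "x \<in> space (signal_seq \<nu> m)" and z: "z \<in> space (signal_law S (if enat t < \<nu> then 0 else m))"
      have x': "x(t := z) \<in> space (signal_seq \<nu> m)"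
        using x z t by (auto simp: space_PiM PiE_iff extensional_def)
      show "g (observe (w, x(t := z))) = g (observe (w, x))"
        by (rule obs_filtration_measurable_eq[OF g observe_in_space[OF x'] observe_in_space[OF x]])
           (use t in \<open>auto simp: observe_apply\<close>)
    qed (use t gm m in \<open>auto intro: prob_space_signal_law[OF model]\<close>)
    also have "(\<integral>\<^sup>+z. \<phi> (?a, act S ?a z) \<partial>signal_law S \<theta>) = \<Psi> ?a"
      unfolding \<Psi>_def obs_law_def using am \<phi>a by (intro nn_integral_distr[symmetric]) simp_all
    also have "(\<integral>\<^sup>+x. g (observe (w, x)) \<partial>signal_seq \<nu> m) * \<Psi> ?a
       = (\<integral>\<^sup>+x. g (observe (w, x)) * \<Psi> (fst (observe (w, x) t)) \<partial>signal_seq \<nu> m)"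
      using t gm by (simp add: observe_apply nn_integral_multc)
    finally show ?thesis .
  qed
  have "(\<integral>\<^sup>+\<omega>. g \<omega> * \<phi> (\<omega> t) \<partial>obs_measure S \<pi> \<nu> m) = (\<integral>\<^sup>+p. g (observe p) * \<phi> (observe p t) \<partial>joint \<pi> \<nu> m)"
    unfolding obs_measure_eq_distr
    by (rule nn_integral_distr[OF measurable_observe]) measurable
  also have "\<dots> = (\<integral>\<^sup>+w. \<integral>\<^sup>+x. g (observe (w, x)) * \<phi> (observe (w, x) t) \<partial>signal_seq \<nu> m \<partial>window_measure \<pi>)"
    using X.nn_integral_fst[OF fm[unfolded joint_def]] unfolding joint_def by simp
  also have "\<dots> = (\<integral>\<^sup>+w. \<integral>\<^sup>+x. g (observe (w, x)) * \<Psi> (fst (observe (w, x) t)) \<partial>signal_seq \<nu> m \<partial>window_measure \<pi>)"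
    by (simp only: inner)
  also have "\<dots> = (\<integral>\<^sup>+p. g (observe p) * \<Psi> (fst (observe p t)) \<partial>joint \<pi> \<nu> m)"
    using X.nn_integral_fst[OF fm2[unfolded joint_def]] unfolding joint_def by simp
  also have "\<dots> = (\<integral>\<^sup>+\<omega>. g \<omega> * \<Psi> (fst (\<omega> t)) \<partial>obs_measure S \<pi> \<nu> m)"
    unfolding obs_measure_eq_distr using \<Psi>m g'
    by (intro nn_integral_distr[symmetric, OF measurable_observe]) measurable
  finally show ?thesis unfolding \<Psi>_def .
qed

lemma AE_observation:
  assumes m: "m \<le> num_hyp S" and t: "1 \<le> t"
    and P: "Measurable.pred obs_pair_space P"
    and AE: "\<And>a. AE y in obs_law S (if enat t < \<nu> then 0 else m) a. P (a, y)"
  shows "AE \<omega> in obs_measure S \<pi> \<nu> m. P (\<omega> t)"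
proof -
  let ?\<phi> = "\<lambda>z. indicator {z. \<not> P z} z :: ennreal"
  have \<phi>: "?\<phi> \<in> borel_measurable obs_pair_space" using P by measurable
  have "(\<integral>\<^sup>+\<omega>. 1 * ?\<phi> (\<omega> t) \<partial>obs_measure S \<pi> \<nu> m) = (\<integral>\<^sup>+\<omega>. 1 * 0 \<partial>obs_measure S \<pi> \<nu> m)"
  proof (subst nn_integral_next_observation[OF m t _ \<phi>], goal_cases)
    case 2
    have "(\<integral>\<^sup>+y. ?\<phi> (a, y) \<partial>obs_law S (if enat t < \<nu> then 0 else m) a) = (\<integral>\<^sup>+y. 0 \<partial>obs_law S (if enat t < \<nu> then 0 else m) a)" for a
    proof (rule nn_integral_cong_AE)
      show "AE y in obs_law S (if enat t < \<nu> then 0 else m) a. ?\<phi> (a, y) = 0"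
        using AE[of a] by eventually_elim simp
    qed
    then show ?case by simp
  qed simp
  then have "(\<integral>\<^sup>+\<omega>. ?\<phi> (\<omega> t) \<partial>obs_measure S \<pi> \<nu> m) = 0" by simp
  moreover have "(\<lambda>\<omega>. ?\<phi> (\<omega> t)) \<in> borel_measurable (obs_measure S \<pi> \<nu> m)"
    using measurable_compose[OF measurable_observation_full[OF t] \<phi>]
    by (simp add: measurable_cong_sets[OF sets_obs_measure refl])
  ultimately have "AE \<omega> in obs_measure S \<pi> \<nu> m. ?\<phi> (\<omega> t) = 0" by (simp add: nn_integral_0_iff_AE)
  then show ?thesis by eventually_elim (simp add: indicator_def split: if_splits)
qed

text \<open>The preceding fact for signed functions, through positive and negative parts; a
  function of the action alone is bounded, since there are finitely many actions.\<close>

lemma integral_next_observation: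
  fixes \<phi> :: "'act \<times> 'y \<Rightarrow> real"
  assumes m: "m \<le> num_hyp S" and t: "1 \<le> t"
    and E: "E \<in> sets (obs_filtration S (enat (t - 1)))"
    and \<phi>: "\<phi> \<in> borel_measurable obs_pair_space"
    and int: "\<And>a. integrable (obs_law S (if enat t < \<nu> then 0 else m) a) (\<lambda>y. \<phi> (a, y))"
  shows "integrable (obs_measure S \<pi> \<nu> m) (\<lambda>\<omega>. indicator E \<omega> * \<phi> (\<omega> t))"
    and "(\<integral>\<omega>. indicator E \<omega> * \<phi> (\<omega> t) \<partial>obs_measure S \<pi> \<nu> m)
      = (\<integral>\<omega>. indicator E \<omega> * (\<integral>y. \<phi> (fst (\<omega> t), y) \<partial>obs_law S (if enat t < \<nu> then 0 else m) (fst (\<omega> t))) \<partial>obs_measure S \<pi> \<nu> m)"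
proof -
  let ?L = "obs_law S (if enat t < \<nu> then 0 else m)" and ?O = "obs_measure S \<pi> \<nu> m"
  interpret O: prob_space ?O by (rule prob_space_obs_measure[OF model m])
  have E' [measurable]: "E \<in> sets (obs_seq_space S)" by (rule sets_obs_filtration_full[OF E])
  note [measurable] = measurable_observation_full[OF t]
  have fin_meas: "(\<lambda>\<omega>. f (fst (\<omega> t))) \<in> borel_measurable ?O" for f :: "'act \<Rightarrow> real"
    by (rule measurable_compose[of "\<lambda>\<omega>. fst (\<omega> t)" _ "count_space UNIV"]) measurable
  have fin_int: "integrable ?O (\<lambda>\<omega>. indicator E \<omega> * f (fst (\<omega> t)))" for f :: "'act \<Rightarrow> real"
  proof (rule O.integrable_const_bound[of _ "Max (range (\<lambda>a. \<bar>f a\<bar>))"])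
    show "(\<lambda>\<omega>. indicator E \<omega> * f (fst (\<omega> t))) \<in> borel_measurable ?O" using fin_meas by measurable
    have le: "\<bar>f a\<bar> \<le> Max (range (\<lambda>a. \<bar>f a\<bar>))" for a by (intro Max_ge) auto
    have "0 \<le> Max (range (\<lambda>a. \<bar>f a\<bar>))" by (rule order_trans[OF abs_ge_zero le])
    with le show "AE \<omega> in ?O. norm (indicator E \<omega> * f (fst (\<omega> t))) \<le> Max (range (\<lambda>a. \<bar>f a\<bar>))"
      by (auto simp: indicator_def)
  qed
  have pos: "integrable ?O (\<lambda>\<omega>. indicator E \<omega> * u (\<omega> t)) \<and>
      (\<integral>\<omega>. indicator E \<omega> * u (\<omega> t) \<partial>?O) = (\<integral>\<omega>. indicator E \<omega> * (\<integral>y. u (fst (\<omega> t), y) \<partial>?L (fst (\<omega> t))) \<partial>?O)"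
    if u [measurable]: "u \<in> borel_measurable obs_pair_space" and u0: "\<And>z. 0 \<le> u z"
      and ui: "\<And>a. integrable (?L a) (\<lambda>y. u (a, y))" for u :: "'act \<times> 'y \<Rightarrow> real"
  proof -
    have um [measurable]: "(\<lambda>\<omega>. u (\<omega> t)) \<in> borel_measurable ?O"
      using measurable_compose[OF measurable_observation_full[OF t] u]
      by (simp add: measurable_cong_sets[OF sets_obs_measure refl])
    have "(\<integral>\<^sup>+\<omega>. ennreal (indicator E \<omega> * u (\<omega> t)) \<partial>?O) = (\<integral>\<^sup>+\<omega>. indicator E \<omega> * ennreal (u (\<omega> t)) \<partial>?O)"
      by (intro nn_integral_cong) (auto simp: indicator_def)
    also have "\<dots> = (\<integral>\<^sup>+\<omega>. indicator E \<omega> * (\<integral>\<^sup>+y. ennreal (u (fst (\<omega> t), y)) \<partial>?L (fst (\<omega> t))) \<partial>?O)"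
      by (rule nn_integral_next_observation[OF m t]) (use E in measurable)
    also have "\<dots> = (\<integral>\<^sup>+\<omega>. ennreal (indicator E \<omega> * (\<integral>y. u (fst (\<omega> t), y) \<partial>?L (fst (\<omega> t)))) \<partial>?O)"
      by (intro nn_integral_cong) (auto simp: indicator_def nn_integral_eq_integral[OF ui] u0)
    also have "\<dots> = ennreal (\<integral>\<omega>. indicator E \<omega> * (\<integral>y. u (fst (\<omega> t), y) \<partial>?L (fst (\<omega> t))) \<partial>?O)"
      by (rule nn_integral_eq_integral[OF fin_int])
         (intro AE_I2 mult_nonneg_nonneg integral_nonneg_AE u0, simp)
    finally have eq: "(\<integral>\<^sup>+\<omega>. ennreal (indicator E \<omega> * u (\<omega> t)) \<partial>?O)
       = ennreal (\<integral>\<omega>. indicator E \<omega> * (\<integral>y. u (fst (\<omega> t), y) \<partial>?L (fst (\<omega> t))) \<partial>?O)" .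
    have nn: "0 \<le> (\<integral>\<omega>. indicator E \<omega> * (\<integral>y. u (fst (\<omega> t), y) \<partial>?L (fst (\<omega> t))) \<partial>?O)"
      by (intro integral_nonneg_AE AE_I2 mult_nonneg_nonneg u0) simp
    have "has_bochner_integral ?O (\<lambda>\<omega>. indicator E \<omega> * u (\<omega> t))
       (\<integral>\<omega>. indicator E \<omega> * (\<integral>y. u (fst (\<omega> t), y) \<partial>?L (fst (\<omega> t))) \<partial>?O)"
      by (rule has_bochner_integral_nn_integral[OF _ _ nn eq]) (auto simp: u0)
    then show ?thesis by (simp add: has_bochner_integral_iff)
  qed
  have p: "integrable (?L a) (\<lambda>y. max 0 (\<phi> (a, y)))" "integrable (?L a) (\<lambda>y. max 0 (- \<phi> (a, y)))" for a
    using int[of a] by auto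
  have \<phi>' [measurable]: "(\<lambda>z. max 0 (\<phi> z)) \<in> borel_measurable obs_pair_space" "(\<lambda>z. max 0 (- \<phi> z)) \<in> borel_measurable obs_pair_space"
    using \<phi> by measurable
  note P = pos[OF \<phi>'(1) _ p(1)] and N = pos[OF \<phi>'(2) _ p(2)]
  have split: "\<phi> z = max 0 (\<phi> z) - max 0 (- \<phi> z)" for z by (simp add: max_def)
  have eq1: "indicator E \<omega> * \<phi> (\<omega> t) = indicator E \<omega> * max 0 (\<phi> (\<omega> t)) - indicator E \<omega> * max 0 (- \<phi> (\<omega> t))" for \<omega>
    by (subst split) (simp add: algebra_simps)
  show "integrable ?O (\<lambda>\<omega>. indicator E \<omega> * \<phi> (\<omega> t))"
    unfolding eq1 using P N by simp
  have "(\<integral>\<omega>. indicator E \<omega> * \<phi> (\<omega> t) \<partial>?O)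
    = (\<integral>\<omega>. indicator E \<omega> * (\<integral>y. max 0 (\<phi> (fst (\<omega> t), y)) \<partial>?L (fst (\<omega> t))) \<partial>?O)
      - (\<integral>\<omega>. indicator E \<omega> * (\<integral>y. max 0 (- \<phi> (fst (\<omega> t), y)) \<partial>?L (fst (\<omega> t))) \<partial>?O)"
    unfolding eq1 using P N by simp
  also have "\<dots> = (\<integral>\<omega>. indicator E \<omega> * (\<integral>y. max 0 (\<phi> (fst (\<omega> t), y)) \<partial>?L (fst (\<omega> t)))
      - indicator E \<omega> * (\<integral>y. max 0 (- \<phi> (fst (\<omega> t), y)) \<partial>?L (fst (\<omega> t))) \<partial>?O)"
    by (rule Bochner_Integration.integral_diff[symmetric, OF fin_int fin_int])
  also have "\<dots> = (\<integral>\<omega>. indicator E \<omega> * (\<integral>y. \<phi> (fst (\<omega> t), y) \<partial>?L (fst (\<omega> t))) \<partial>?O)"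
  proof (intro Bochner_Integration.integral_cong refl)
    fix \<omega>
    have "(\<integral>y. \<phi> (a, y) \<partial>?L a) = (\<integral>y. max 0 (\<phi> (a, y)) \<partial>?L a) - (\<integral>y. max 0 (- \<phi> (a, y)) \<partial>?L a)" for a
      using Bochner_Integration.integral_diff[OF p(1)[of a] p(2)[of a]] by (simp only: split[symmetric])
    then show "indicator E \<omega> * (\<integral>y. max 0 (\<phi> (fst (\<omega> t), y)) \<partial>?L (fst (\<omega> t)))
      - indicator E \<omega> * (\<integral>y. max 0 (- \<phi> (fst (\<omega> t), y)) \<partial>?L (fst (\<omega> t)))
      = indicator E \<omega> * (\<integral>y. \<phi> (fst (\<omega> t), y) \<partial>?L (fst (\<omega> t)))"
      by (simp add: right_diff_distrib)
  qed
  finally show "(\<integral>\<omega>. indicator E \<omega> * \<phi> (\<omega> t) \<partial>?O) = (\<integral>\<omega>. indicator E \<omega> * (\<integral>y. \<phi> (fst (\<omega> t), y) \<partial>?L (fst (\<omega> t))) \<partial>?O)" .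
qed

text \<open>The windows are a Markov chain also relative to the observed past: for a fixed signal, an event
  of the first \<open>t\<close> observations is an event of the first \<open>t\<close> windows.\<close>

lemma integral_next_window:
  fixes h :: "'act list \<Rightarrow> real"
  assumes m: "m \<le> num_hyp S" and \<pi>: "open_loop_policy W \<pi>" "W \<ge> 1"
    and E: "E \<in> sets (obs_filtration S (enat t))"
    and h: "\<And>w. \<bar>h w\<bar> \<le> H"
  shows "(\<integral>p. indicator E (observe p) * h (fst p (Suc t)) \<partial>joint \<pi> \<nu> m)
       = (\<integral>p. indicator E (observe p) * step (snd \<pi>) h (fst p t) \<partial>joint \<pi> \<nu> m)"
proof -
  interpret X: prob_space "signal_seq \<nu> m" by (rule prob_space_signal_seq[OF m])
  interpret V: prob_space "window_measure \<pi>" by (rule prob_space_window_measure)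
  interpret P: pair_prob_space "window_measure \<pi>" "signal_seq \<nu> m" ..
  interpret J: prob_space "joint \<pi> \<nu> m" by (rule prob_space_joint[OF m])
  have E': "E \<in> sets (obs_seq_space S)" by (rule sets_obs_filtration_full[OF E])
  have Eind: "(indicator E :: _ \<Rightarrow> real) \<in> borel_measurable (obs_filtration S (enat t))" using E by measurable
  have Em [measurable]: "(\<lambda>p. indicator E (observe p) :: real) \<in> borel_measurable (joint \<pi> \<nu> m)"
    by (rule measurable_compose[OF measurable_observe]) (use E' in measurable)
  have wm: "(\<lambda>p. f (fst p k)) \<in> borel_measurable (joint \<pi> \<nu> m)" for f :: "'act list \<Rightarrow> real" and k
    unfolding joint_def
    by (rule measurable_compose[OF measurable_fst measurable_compose[OF measurable_window_coordinate]]) simp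
  have H0: "0 \<le> H" using order_trans[OF abs_ge_zero h] by blast
  have step_le: "\<bar>step (snd \<pi>) h w\<bar> \<le> H" for w by (rule abs_step_le[OF h])
  have int: "integrable (joint \<pi> \<nu> m) (\<lambda>p. indicator E (observe p) * f (fst p k))"
    if "\<And>w. \<bar>f w\<bar> \<le> H" for f :: "'act list \<Rightarrow> real" and k
  proof (rule J.integrable_const_bound[of _ H])
    show "AE p in joint \<pi> \<nu> m. norm (indicator E (observe p) * f (fst p k)) \<le> H"
      using that H0 by (auto simp: indicator_def)
    show "(\<lambda>p. indicator E (observe p) * f (fst p k)) \<in> borel_measurable (joint \<pi> \<nu> m)"
      using Em wm[of f k] by (rule borel_measurable_times)
  qed
  have int_h: "integrable (joint \<pi> \<nu> m) (\<lambda>p. indicator E (observe p) * h (fst p (Suc t)))" using h by (rule int)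
  have int_step: "integrable (joint \<pi> \<nu> m) (\<lambda>p. indicator E (observe p) * step (snd \<pi>) h (fst p t))"
    using step_le by (rule int)
  have inner: "(\<integral>w. indicator E (observe (w, x)) * h (w (Suc t)) \<partial>window_measure \<pi>)
      = (\<integral>w. indicator E (observe (w, x)) * step (snd \<pi>) h (w t) \<partial>window_measure \<pi>)"
    if x: "x \<in> space (signal_seq \<nu> m)" for x
  proof -
    (* The event looks at the windows below Suc t only, so the default window [] has no influence. *)
    define G where "G l = (indicator E (observe (\<lambda>i. if i < length l then l ! i else [], x)) :: real)" for l
    have "indicator E (observe (w, x)) = G (map w [0..<Suc t])" for w
      unfolding G_def
      by (rule obs_filtration_measurable_eq[OF Eind observe_in_space[OF x] observe_in_space[OF x]])
         (auto simp: observe_apply simp del: upt_Suc)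
    then show ?thesis by (simp only: window_markov[OF \<pi>])
  qed
  have "(\<integral>p. indicator E (observe p) * h (fst p (Suc t)) \<partial>joint \<pi> \<nu> m)
      = (\<integral>x. \<integral>w. indicator E (observe (w, x)) * h (w (Suc t)) \<partial>window_measure \<pi> \<partial>signal_seq \<nu> m)"
    using P.integral_snd[of "\<lambda>w x. indicator E (observe (w, x)) * h (w (Suc t))"] int_h
    unfolding joint_def by (simp add: split_beta')
  also have "\<dots> = (\<integral>x. \<integral>w. indicator E (observe (w, x)) * step (snd \<pi>) h (w t) \<partial>window_measure \<pi> \<partial>signal_seq \<nu> m)"
    by (intro Bochner_Integration.integral_cong refl inner)
  also have "\<dots> = (\<integral>p. indicator E (observe p) * step (snd \<pi>) h (fst p t) \<partial>joint \<pi> \<nu> m)"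
    using P.integral_snd[of "\<lambda>w x. indicator E (observe (w, x)) * step (snd \<pi>) h (w t)"] int_step
    unfolding joint_def by (simp add: split_beta')
  finally show ?thesis .
qed

section \<open>Likelihood ratios\<close>

text \<open>The likelihood ratio of one observation. Division by zero gives \<open>0\<close>, on a set that is null
  under hypothesis \<open>i\<close>.\<close>

definition ratio :: "nat \<Rightarrow> nat \<Rightarrow> 'act \<times> 'y \<Rightarrow> real" where
  "ratio j i z = obs_pdf S j (fst z) (snd z) / obs_pdf S i (fst z) (snd z)"

lemma measurable_pdf_pair [measurable]:
  "i \<le> num_hyp S \<Longrightarrow> (\<lambda>z. obs_pdf S i (fst z) (snd z)) \<in> borel_measurable obs_pair_space"
  by (rule measurable_action_cases) simp

lemma measurable_ratio [measurable]:
  "j \<le> num_hyp S \<Longrightarrow> i \<le> num_hyp S \<Longrightarrow> ratio j i \<in> borel_measurable obs_pair_space"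
  unfolding ratio_def[abs_def] by measurable

lemma ratio_nonneg: "j \<le> num_hyp S \<Longrightarrow> i \<le> num_hyp S \<Longrightarrow> 0 \<le> ratio j i z"
  unfolding ratio_def by (intro divide_nonneg_nonneg obs_pdf_nonneg)

text \<open>The mean is the mass that \<open>p\<^sub>j\<close> gives to the set where \<open>p\<^sub>i\<close> is positive.\<close>

lemma nn_integral_ratio_le_1:
  assumes j: "j \<le> num_hyp S" and i: "i \<le> num_hyp S"
  shows "(\<integral>\<^sup>+y. ennreal (ratio j i (a, y)) \<partial>obs_law S i a) \<le> 1"
proof -
  note [measurable] = measurable_obs_pdf[OF j] measurable_obs_pdf[OF i]
  have "(\<integral>\<^sup>+y. ennreal (ratio j i (a, y)) \<partial>obs_law S i a)
      = (\<integral>\<^sup>+y. ennreal (obs_pdf S i a y) * ennreal (ratio j i (a, y)) \<partial>ref_measure S a)"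
    unfolding obs_law_density[OF i] by (rule nn_integral_density) (simp_all add: ratio_def)
  also have "\<dots> \<le> (\<integral>\<^sup>+y. ennreal (obs_pdf S j a y) \<partial>ref_measure S a)"
    by (intro nn_integral_mono)
       (auto simp: ratio_def ennreal_mult'[symmetric] obs_pdf_nonneg i j intro!: ennreal_leI)
  also have "\<dots> = emeasure (obs_law S j a) (space (obs_law S j a))"
    unfolding obs_law_density[OF j] by (simp add: emeasure_density cong: nn_integral_cong)
  also have "\<dots> = 1" by (rule prob_space.emeasure_space_1[OF prob_space_obs_law[OF j]])
  finally show ?thesis .
qed

lemma measurable_pdf_ref:
  "i \<le> num_hyp S \<Longrightarrow> (\<lambda>y. ennreal (obs_pdf S i a y)) \<in> borel_measurable (ref_measure S a')"
  by (simp add: measurable_cong_sets[OF sets_ref_measure refl])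

lemma AE_obs_pdf_pos:
  assumes "i \<le> num_hyp S"
  shows "AE y in obs_law S i a. 0 < obs_pdf S i a y"
  unfolding obs_law_density[OF assms]
  by (subst AE_density[OF measurable_pdf_ref[OF assms]]) simp

lemma AE_base_pdf_pos:
  assumes m: "m \<le> num_hyp S"
  shows "AE y in obs_law S m a. 0 < obs_pdf S 0 a y"
proof (cases "m = 0")
  case True
  show ?thesis unfolding True by (rule AE_obs_pdf_pos) simp
next
  case False
  then have "absolutely_continuous (obs_law S 0 a) (obs_law S m a)"
    using KL m by (auto simp: finite_KL_def)
  then show ?thesis
    by (rule absolutely_continuous_AE[rotated]) (simp_all add: AE_obs_pdf_pos)
qed

definition log_ratio :: "nat \<Rightarrow> 'act \<times> 'y \<Rightarrow> real" where
  "log_ratio m z = ln (ratio m 0 z)"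

lemma measurable_log_ratio [measurable]:
  "m \<le> num_hyp S \<Longrightarrow> log_ratio m \<in> borel_measurable obs_pair_space"
  unfolding log_ratio_def[abs_def] by (intro borel_measurable_ln measurable_ratio) simp_all

lemma measurable_section: "\<phi> \<in> obs_pair_space \<rightarrow>\<^sub>M N \<Longrightarrow> (\<lambda>y. \<phi> (a, y)) \<in> obs_law S m a' \<rightarrow>\<^sub>M N"
  by (rule measurable_compose[of "Pair a"])
     (simp_all add: measurable_cong_sets[OF sets_obs_law refl] measurable_Pair1')

text \<open>By absolute continuity \<open>p\<^sub>m\<close> vanishes where \<open>p\<^sub>0\<close> does, so the ratio of the densities is a
  Radon-Nikodym derivative, and its logarithm is almost surely the entropy density.\<close>

lemma integrable_log_ratio:
  assumes m: "m \<in> {1..num_hyp S}"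
  shows "integrable (obs_law S m a) (\<lambda>y. log_ratio m (a, y))"
proof -
  have m': "m \<le> num_hyp S" using m by simp
  note [measurable] = measurable_obs_pdf[OF m'] measurable_obs_pdf[OF le0]
  have ac: "absolutely_continuous (obs_law S 0 a) (obs_law S m a)"
    and ent: "integrable (obs_law S m a) (entropy_density (exp 1) (obs_law S 0 a) (obs_law S m a))"
    using KL m by (auto simp: finite_KL_def)
  have sets_eq: "sets (obs_law S m a) = sets (obs_law S 0 a)" by simp
  interpret P0: prob_space "obs_law S 0 a" by (rule prob_space_obs_law) simp
  have "AE y in ref_measure S a. 0 < obs_pdf S m a y \<longrightarrow> 0 < obs_pdf S 0 a y"
    using AE_base_pdf_pos[OF m', of a] unfolding obs_law_density[OF m']
    by (subst (asm) AE_density[OF measurable_pdf_ref[OF m']]) simp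
  then have "AE y in ref_measure S a. ennreal (obs_pdf S 0 a y) * ennreal (ratio m 0 (a, y)) = ennreal (obs_pdf S m a y)"
  proof eventually_elim
    case (elim y)
    show ?case
    proof (cases "obs_pdf S 0 a y = 0")
      case True
      then have "obs_pdf S m a y = 0" using elim obs_pdf_nonneg[OF m', of a y] by linarith
      then show ?thesis using True by simp
    next
      case False
      then show ?thesis by (simp add: ratio_def ennreal_mult'[symmetric] obs_pdf_nonneg)
    qed
  qed
  then have "density (ref_measure S a) (\<lambda>y. ennreal (obs_pdf S 0 a y) * ennreal (ratio m 0 (a, y)))
     = density (ref_measure S a) (\<lambda>y. ennreal (obs_pdf S m a y))"
    by (intro density_cong) (simp_all add: ratio_def)
  then have "density (obs_law S 0 a) (\<lambda>y. ennreal (ratio m 0 (a, y))) = obs_law S m a"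
    unfolding obs_law_density[OF m'] obs_law_density[OF le0]
    by (subst density_density_eq) (simp_all add: ratio_def)
  then have "AE y in obs_law S 0 a. ennreal (ratio m 0 (a, y)) = RN_deriv (obs_law S 0 a) (obs_law S m a) y"
    by (intro P0.RN_deriv_unique) (rule measurable_section, use m' in measurable)
  then have "AE y in obs_law S m a. ennreal (ratio m 0 (a, y)) = RN_deriv (obs_law S 0 a) (obs_law S m a) y"
    by (rule absolutely_continuous_AE[OF sets_eq ac])
  then have eq: "AE y in obs_law S m a. entropy_density (exp 1) (obs_law S 0 a) (obs_law S m a) y = log_ratio m (a, y)"
  proof eventually_elim
    case (elim y)
    then have "enn2real (RN_deriv (obs_law S 0 a) (obs_law S m a) y) = ratio m 0 (a, y)"
      using ratio_nonneg[OF m' le0] by (metis enn2real_ennreal)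
    then show ?case by (simp add: entropy_density_def log_ratio_def log_def)
  qed
  show ?thesis
    by (rule Bochner_Integration.integrable_cong_AE_imp[OF ent _ eq])
       (rule measurable_section, use m' in measurable)
qed

text \<open>The Kullback-Leibler divergence of \<open>p\<^sub>m(\<cdot> | a)\<close> from \<open>p\<^sub>0(\<cdot> | a)\<close>.\<close>

definition kl :: "nat \<Rightarrow> 'act \<Rightarrow> real" where
  "kl m a = (\<integral>y. log_ratio m (a, y) \<partial>obs_law S m a)"

text \<open>The inequality \<open>x - 1 - ln x \<ge> 0\<close>, with equality only at \<open>1\<close>, applied to \<open>x = p\<^sub>0 / p\<^sub>m\<close>, whose
  mean is at most \<open>1\<close>.\<close>

lemma kl_facts:
  assumes m: "m \<in> {1..num_hyp S}"
  shows "0 \<le> kl m a" and "kl m a = 0 \<Longrightarrow> AE y in obs_law S m a. log_ratio m (a, y) = 0"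
proof -
  let ?P = "obs_law S m a"
  have m': "m \<le> num_hyp S" using m by simp
  interpret prob_space ?P by (rule prob_space_obs_law[OF m'])
  have meas: "(\<lambda>y. ratio 0 m (a, y)) \<in> borel_measurable ?P"
    by (rule measurable_section) (use m' in measurable)
  have le1: "(\<integral>\<^sup>+y. ennreal (ratio 0 m (a, y)) \<partial>?P) \<le> 1" by (rule nn_integral_ratio_le_1) (use m' in simp_all)
  have int: "integrable ?P (\<lambda>y. ratio 0 m (a, y))"
    using le1 ratio_nonneg[OF le0 m'] meas
    by (intro integrableI_nonneg) (auto intro: le_less_trans)
  have le1': "(\<integral>y. ratio 0 m (a, y) \<partial>?P) \<le> 1"
    using le1 by (subst (asm) nn_integral_eq_integral[OF int]) (auto simp: ratio_nonneg m')
  define f where "f y = log_ratio m (a, y) - 1 + ratio 0 m (a, y)" for y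
  have fi: "integrable ?P f" unfolding f_def[abs_def] using integrable_log_ratio[OF m] int by simp
  have fE: "(\<integral>y. f y \<partial>?P) = kl m a - 1 + (\<integral>y. ratio 0 m (a, y) \<partial>?P)"
    unfolding f_def kl_def using integrable_log_ratio[OF m] int by (simp add: prob_space)
  have pos: "AE y in ?P. 0 < ratio 0 m (a, y) \<and> log_ratio m (a, y) = - ln (ratio 0 m (a, y))"
    using AE_obs_pdf_pos[OF m', of a] AE_base_pdf_pos[OF m', of a]
    by eventually_elim (simp add: ratio_def log_ratio_def ln_div)
  have f0: "AE y in ?P. 0 \<le> f y"
    using pos
  proof eventually_elim
    case (elim y)
    then show ?case using ln_le_minus_one[of "ratio 0 m (a, y)"] by (simp add: f_def)
  qed
  have "0 \<le> (\<integral>y. f y \<partial>?P)" using f0 by (rule integral_nonneg_AE)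
  then show "0 \<le> kl m a" using fE le1' by linarith
  assume "kl m a = 0"
  then have "(\<integral>y. f y \<partial>?P) = 0" using \<open>0 \<le> (\<integral>y. f y \<partial>?P)\<close> fE le1' by linarith
  then have "AE y in ?P. f y = 0" using integral_nonneg_eq_0_iff_AE[OF fi f0] by simp
  with pos show "AE y in ?P. log_ratio m (a, y) = 0"
  proof eventually_elim
    case (elim y)
    then have "ln (ratio 0 m (a, y)) = ratio 0 m (a, y) - 1" by (simp add: f_def)
    then have "ratio 0 m (a, y) = 1" using elim ln_eq_minus_one by blast
    then show ?case using elim by simp
  qed
qed

section \<open>The Shiryaev-Roberts statistic\<close>

text \<open>The sum, over the starting points \<open>1 \<le> k \<le> t\<close>, of the likelihood ratio of the observations from \<open>k\<close>
  to \<open>t\<close>.\<close>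

primrec sr_stat :: "nat \<Rightarrow> nat \<Rightarrow> (nat \<Rightarrow> 'act \<times> 'y) \<Rightarrow> real" where
  "sr_stat j 0 \<omega> = 0"
| "sr_stat j (Suc t) \<omega> = (1 + sr_stat j t \<omega>) * ratio j 0 (\<omega> (Suc t))"

text \<open>The likelihood ratio of no change against a change at \<open>\<nu>\<close>, for the first \<open>t\<close> observations; it is
  the exponential of minus the sum of the log-likelihood ratios since the change.\<close>

primrec inv_likelihood :: "enat \<Rightarrow> nat \<Rightarrow> nat \<Rightarrow> (nat \<Rightarrow> 'act \<times> 'y) \<Rightarrow> real" where
  "inv_likelihood \<nu> m 0 \<omega> = 1"
| "inv_likelihood \<nu> m (Suc t) \<omega> =
     inv_likelihood \<nu> m t \<omega> * (if enat (Suc t) < \<nu> then 1 else ratio 0 m (\<omega> (Suc t)))"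

text \<open>The product of the two preceding processes. In the recursion below each new factor has mean at
  most one under the law of the observation that it uses, whether that observation comes before or
  after the change. Working with this process under the true law takes the place of a change of
  measure to the law without change.\<close>

primrec sr_weighted :: "enat \<Rightarrow> nat \<Rightarrow> nat \<Rightarrow> nat \<Rightarrow> (nat \<Rightarrow> 'act \<times> 'y) \<Rightarrow> real" where
  "sr_weighted \<nu> m j 0 \<omega> = 0"
| "sr_weighted \<nu> m j (Suc t) \<omega> =
     (inv_likelihood \<nu> m t \<omega> + sr_weighted \<nu> m j t \<omega>) * ratio j (if enat (Suc t) < \<nu> then 0 else m) (\<omega> (Suc t))"

text \<open>The observations at which no density under consideration vanishes; almost surely all are.\<close>

definition regular_obs :: "enat \<Rightarrow> nat \<Rightarrow> (nat \<Rightarrow> 'act \<times> 'y) \<Rightarrow> bool" where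
  "regular_obs \<nu> m \<omega> \<longleftrightarrow> (\<forall>t\<ge>1. 0 < obs_pdf S 0 (fst (\<omega> t)) (snd (\<omega> t)) \<and>
     (\<nu> \<le> enat t \<longrightarrow> 0 < obs_pdf S m (fst (\<omega> t)) (snd (\<omega> t))))"

lemma AE_regular_obs:
  assumes m: "m \<le> num_hyp S"
  shows "AE \<omega> in obs_measure S \<pi> \<nu> m. regular_obs \<nu> m \<omega>"
proof -
  have "AE \<omega> in obs_measure S \<pi> \<nu> m. 1 \<le> t \<longrightarrow> 0 < obs_pdf S 0 (fst (\<omega> t)) (snd (\<omega> t)) \<and>
     (\<nu> \<le> enat t \<longrightarrow> 0 < obs_pdf S m (fst (\<omega> t)) (snd (\<omega> t)))" for t
  proof (cases "1 \<le> t")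
    case True
    note [measurable] = measurable_pdf_pair[OF m] measurable_pdf_pair[OF le0]
    have "AE \<omega> in obs_measure S \<pi> \<nu> m. (\<lambda>z. 0 < obs_pdf S 0 (fst z) (snd z) \<and>
       (\<nu> \<le> enat t \<longrightarrow> 0 < obs_pdf S m (fst z) (snd z))) (\<omega> t)"
    proof (rule AE_observation[OF m True])
      show "Measurable.pred obs_pair_space (\<lambda>z. 0 < obs_pdf S 0 (fst z) (snd z) \<and>
         (\<nu> \<le> enat t \<longrightarrow> 0 < obs_pdf S m (fst z) (snd z)))" by measurable
      show "AE y in obs_law S (if enat t < \<nu> then 0 else m) a.
          0 < obs_pdf S 0 (fst (a, y)) (snd (a, y)) \<and> (\<nu> \<le> enat t \<longrightarrow> 0 < obs_pdf S m (fst (a, y)) (snd (a, y)))" for a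
      proof (cases "enat t < \<nu>")
        case True
        then show ?thesis using AE_obs_pdf_pos[OF le0, of a] by simp
      next
        case False
        then show ?thesis using AE_obs_pdf_pos[OF m, of a] AE_base_pdf_pos[OF m, of a] by simp
      qed
    qed
    then show ?thesis by simp
  qed simp
  then show ?thesis unfolding regular_obs_def by (subst AE_all_countable) simp
qed

lemma sr_stat_nonneg: "j \<le> num_hyp S \<Longrightarrow> 0 \<le> sr_stat j t \<omega>"
  by (induction t) (simp_all add: ratio_nonneg)

lemma inv_likelihood_nonneg: "m \<le> num_hyp S \<Longrightarrow> 0 \<le> inv_likelihood \<nu> m t \<omega>"
  by (induction t) (simp_all add: ratio_nonneg)

lemma sr_weighted_nonneg: "m \<le> num_hyp S \<Longrightarrow> j \<le> num_hyp S \<Longrightarrow> 0 \<le> sr_weighted \<nu> m j t \<omega>"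
  by (induction t) (simp_all add: ratio_nonneg inv_likelihood_nonneg)

lemma sr_weighted_eq:
  assumes "regular_obs \<nu> m \<omega>"
  shows "sr_weighted \<nu> m j t \<omega> = sr_stat j t \<omega> * inv_likelihood \<nu> m t \<omega>"
proof (induction t)
  case (Suc t)
  have "0 < obs_pdf S 0 (fst (\<omega> (Suc t))) (snd (\<omega> (Suc t)))"
    using assms unfolding regular_obs_def by auto
  then have eq: "ratio j m (\<omega> (Suc t)) = ratio j 0 (\<omega> (Suc t)) * ratio 0 m (\<omega> (Suc t))"
    by (simp add: ratio_def)
  show ?case by (simp add: Suc eq algebra_simps)
qed simp

text \<open>CuSum maximizes over the starting points where the Shiryaev-Roberts statistic sums; a
  maximum at \<open>0\<close> corresponds to an empty set of observations.\<close>

lemma cusum_le_ln_sr: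
  assumes reg: "regular_obs \<nu> m \<omega>" and j: "j \<le> num_hyp S"
  shows "cusum S j t \<omega> \<le> ereal (ln (max 1 (sr_stat j t \<omega>)))"
proof (induction t)
  case (Suc t)
  let ?z = "\<omega> (Suc t)" and ?R = "sr_stat j t \<omega>"
  have p0: "0 < obs_pdf S 0 (fst ?z) (snd ?z)" using reg unfolding regular_obs_def by auto
  have R0: "0 \<le> ?R" by (rule sr_stat_nonneg[OF j])
  have "cusum S j t \<omega> + llr S j ?z \<le> ereal (ln (max 1 (sr_stat j (Suc t) \<omega>)))"
  proof (cases "obs_pdf S j (fst ?z) (snd ?z) = 0")
    case True
    then have "llr S j ?z = -\<infinity>" by (simp add: llr_def split_beta')
    moreover have "cusum S j t \<omega> \<noteq> \<infinity>" using Suc by auto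
    ultimately have eq: "cusum S j t \<omega> + llr S j ?z = -\<infinity>" by simp
    show ?thesis unfolding eq by simp
  next
    case False
    then have "0 < obs_pdf S j (fst ?z) (snd ?z)" using obs_pdf_nonneg[OF j, of "fst ?z" "snd ?z"] by simp
    then have r: "0 < ratio j 0 ?z" using p0 by (simp add: ratio_def)
    have "llr S j ?z = ereal (ln (ratio j 0 ?z))"
      using p0 False by (simp add: llr_def split_beta' ratio_def)
    then have "cusum S j t \<omega> + llr S j ?z \<le> ereal (ln (max 1 ?R)) + ereal (ln (ratio j 0 ?z))"
      using Suc by (simp add: add_mono del: plus_ereal.simps)
    also have "\<dots> = ereal (ln (max 1 ?R * ratio j 0 ?z))" using r by (simp add: ln_mult)
    also have "\<dots> \<le> ereal (ln (max 1 (sr_stat j (Suc t) \<omega>)))"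
    proof -
      have "max 1 ?R * ratio j 0 ?z \<le> (1 + ?R) * ratio j 0 ?z" using R0 r by (intro mult_right_mono) auto
      then have "max 1 ?R * ratio j 0 ?z \<le> max 1 (sr_stat j (Suc t) \<omega>)" by simp
      moreover have "0 < max 1 ?R * ratio j 0 ?z" using r by simp
      ultimately show ?thesis by simp
    qed
    finally show ?thesis .
  qed
  then show ?case by simp
qed simp

lemma sr_stat_gt:
  assumes reg: "regular_obs \<nu> m \<omega>" and j: "j \<le> num_hyp S" and c: "1 \<le> c"
    and cr: "cusum S j t \<omega> > ereal (ln c)"
  shows "c < sr_stat j t \<omega>"
proof -
  have "ereal (ln c) < ereal (ln (max 1 (sr_stat j t \<omega>)))" using cr cusum_le_ln_sr[OF reg j] by (rule less_le_trans)
  then have "c < max 1 (sr_stat j t \<omega>)" using c by simp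
  then show ?thesis using c by (auto simp: max_def split: if_splits)
qed

lemma measurable_next [measurable]:
  assumes "i \<le> num_hyp S" "j \<le> num_hyp S" "1 \<le> t" "enat t \<le> n"
  shows "(\<lambda>\<omega>. ratio j i (\<omega> t)) \<in> borel_measurable (obs_filtration S n)"
  by (rule measurable_compose[OF measurable_observation[OF assms(3,4)] measurable_ratio[OF assms(2,1)]])

lemma measurable_inv_likelihood:
  assumes "m \<le> num_hyp S"
  shows "inv_likelihood \<nu> m t \<in> borel_measurable (obs_filtration S (enat t))"
proof (induction t)
  case (Suc t)
  have "inv_likelihood \<nu> m t \<in> borel_measurable (obs_filtration S (enat (Suc t)))"
    by (rule obs_filtration_mono[OF _ Suc]) simp
  moreover have "(\<lambda>\<omega>. ratio 0 m (\<omega> (Suc t))) \<in> borel_measurable (obs_filtration S (enat (Suc t)))"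
    using assms by (intro measurable_next) auto
  ultimately show ?case by (cases "enat (Suc t) < \<nu>") (simp_all add: inv_likelihood.simps(2)[abs_def])
qed (simp add: inv_likelihood.simps(1)[abs_def])

lemma measurable_sr_weighted:
  assumes m: "m \<le> num_hyp S" and j: "j \<le> num_hyp S"
  shows "sr_weighted \<nu> m j t \<in> borel_measurable (obs_filtration S (enat t))"
proof (induction t)
  case (Suc t)
  have "sr_weighted \<nu> m j t \<in> borel_measurable (obs_filtration S (enat (Suc t)))"
    by (rule obs_filtration_mono[OF _ Suc]) simp
  moreover have "inv_likelihood \<nu> m t \<in> borel_measurable (obs_filtration S (enat (Suc t)))"
    by (rule obs_filtration_mono[OF _ measurable_inv_likelihood[OF m]]) simp
  moreover have "(\<lambda>\<omega>. ratio j (if enat (Suc t) < \<nu> then 0 else m) (\<omega> (Suc t))) \<in> borel_measurable (obs_filtration S (enat (Suc t)))"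
    using m j by (intro measurable_next) auto
  ultimately show ?case by (simp add: sr_weighted.simps(2)[abs_def])
qed (simp add: sr_weighted.simps(1)[abs_def])

lemma nn_integral_times_ratio_le:
  assumes m: "m \<le> num_hyp S" and j: "j \<le> num_hyp S"
    and g: "g \<in> borel_measurable (obs_filtration S (enat t))"
  shows "(\<integral>\<^sup>+\<omega>. g \<omega> * ennreal (ratio j (if enat (Suc t) < \<nu> then 0 else m) (\<omega> (Suc t))) \<partial>obs_measure S \<pi> \<nu> m)
    \<le> (\<integral>\<^sup>+\<omega>. g \<omega> \<partial>obs_measure S \<pi> \<nu> m)"
proof -
  let ?i = "if enat (Suc t) < \<nu> then 0 else m"
  have i: "?i \<le> num_hyp S" using m by simp
  have "(\<integral>\<^sup>+\<omega>. g \<omega> * ennreal (ratio j ?i (\<omega> (Suc t))) \<partial>obs_measure S \<pi> \<nu> m)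
    = (\<integral>\<^sup>+\<omega>. g \<omega> * (\<integral>\<^sup>+y. ennreal (ratio j ?i (fst (\<omega> (Suc t)), y)) \<partial>obs_law S ?i (fst (\<omega> (Suc t)))) \<partial>obs_measure S \<pi> \<nu> m)"
    by (rule nn_integral_next_observation[OF m, of "Suc t" g "\<lambda>z. ennreal (ratio j ?i z)"])
       (use g measurable_ratio[OF j i] in auto)
  also have "\<dots> \<le> (\<integral>\<^sup>+\<omega>. g \<omega> * 1 \<partial>obs_measure S \<pi> \<nu> m)"
    by (intro nn_integral_mono mult_left_mono nn_integral_ratio_le_1 j i) simp
  finally show ?thesis by simp
qed

lemma measurable_obs_measure: "f \<in> obs_filtration S n \<rightarrow>\<^sub>M N \<Longrightarrow> f \<in> obs_measure S \<pi> \<nu> m \<rightarrow>\<^sub>M N"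
  by (drule measurable_obs_filtration_full) (simp add: measurable_cong_sets[OF sets_obs_measure refl])

lemma nn_integral_inv_likelihood_le_1:
  assumes m: "m \<le> num_hyp S"
  shows "(\<integral>\<^sup>+\<omega>. ennreal (inv_likelihood \<nu> m t \<omega>) \<partial>obs_measure S \<pi> \<nu> m) \<le> 1"
proof (induction t)
  case 0
  show ?case using prob_space.emeasure_space_1[OF prob_space_obs_measure[OF model m, of \<pi> \<nu>]] by simp
next
  case (Suc t)
  show ?case
  proof (cases "enat (Suc t) < \<nu>")
    case True
    then show ?thesis using Suc by simp
  next
    case False
    have "(\<integral>\<^sup>+\<omega>. ennreal (inv_likelihood \<nu> m (Suc t) \<omega>) \<partial>obs_measure S \<pi> \<nu> m)
      = (\<integral>\<^sup>+\<omega>. ennreal (inv_likelihood \<nu> m t \<omega>) * ennreal (ratio 0 (if enat (Suc t) < \<nu> then 0 else m) (\<omega> (Suc t))) \<partial>obs_measure S \<pi> \<nu> m)"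
      using False by (simp add: ennreal_mult inv_likelihood_nonneg m ratio_nonneg)
    also have "\<dots> \<le> (\<integral>\<^sup>+\<omega>. ennreal (inv_likelihood \<nu> m t \<omega>) \<partial>obs_measure S \<pi> \<nu> m)"
      using measurable_inv_likelihood[OF m] by (intro nn_integral_times_ratio_le m) auto
    finally show ?thesis using Suc by (rule order_trans)
  qed
qed

text \<open>The weighted statistic grows by at most the weight of one step, on average, and only on the
  event \<open>E t\<close> that observation still goes on at time \<open>t\<close>. Its value at the end is therefore bounded by
  the accumulated weight.\<close>

lemma sr_optional_stopping:
  fixes \<nu> :: enat and \<pi> :: "'act policy" and m :: nat
  assumes m: "m \<le> num_hyp S" and J: "finite J" "\<And>j. j \<in> J \<Longrightarrow> j \<le> num_hyp S"
    and E: "\<And>t. E t \<in> sets (obs_filtration S (enat t))" "\<And>t. E (Suc t) \<subseteq> E t"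
  defines "P \<equiv> obs_measure S \<pi> \<nu> m"
  shows "(\<Sum>t<n. \<Sum>j\<in>J. \<integral>\<^sup>+\<omega>. indicator (E t - E (Suc t)) \<omega> * ennreal (sr_weighted \<nu> m j (Suc t) \<omega>) \<partial>P)
    \<le> of_nat (card J) * (\<Sum>t<n. \<integral>\<^sup>+\<omega>. indicator (E t) \<omega> * ennreal (inv_likelihood \<nu> m t \<omega>) \<partial>P)"
proof -
  define u where "u j t = (\<integral>\<^sup>+\<omega>. indicator (E t) \<omega> * ennreal (sr_weighted \<nu> m j t \<omega>) \<partial>P)" for j t
  define c where "c t = (\<integral>\<^sup>+\<omega>. indicator (E t) \<omega> * ennreal (inv_likelihood \<nu> m t \<omega>) \<partial>P)" for t
  define s where "s j t = (\<integral>\<^sup>+\<omega>. indicator (E t - E (Suc t)) \<omega> * ennreal (sr_weighted \<nu> m j (Suc t) \<omega>) \<partial>P)" for j t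
  have EO: "E t \<in> sets P" for t using sets_obs_filtration_full[OF E(1)] by (simp add: P_def)
  have step: "u j (Suc t) + s j t \<le> c t + u j t" if j: "j \<le> num_hyp S" for j t
  proof -
    have V: "(\<lambda>\<omega>. ennreal (sr_weighted \<nu> m j t \<omega>)) \<in> borel_measurable P" for t
      unfolding P_def using measurable_obs_measure[OF measurable_sr_weighted[OF m j]] by measurable
    have Q: "(\<lambda>\<omega>. ennreal (inv_likelihood \<nu> m t \<omega>)) \<in> borel_measurable P" for t
      unfolding P_def using measurable_obs_measure[OF measurable_inv_likelihood[OF m]] by measurable
    note [measurable] = V Q EO
    have "u j (Suc t) + s j t = (\<integral>\<^sup>+\<omega>. indicator (E (Suc t)) \<omega> * ennreal (sr_weighted \<nu> m j (Suc t) \<omega>)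
        + indicator (E t - E (Suc t)) \<omega> * ennreal (sr_weighted \<nu> m j (Suc t) \<omega>) \<partial>P)"
      unfolding u_def s_def by (rule nn_integral_add[symmetric]) measurable
    also have "\<dots> = (\<integral>\<^sup>+\<omega>. (indicator (E t) \<omega> * (ennreal (inv_likelihood \<nu> m t \<omega>) + ennreal (sr_weighted \<nu> m j t \<omega>)))
        * ennreal (ratio j (if enat (Suc t) < \<nu> then 0 else m) (\<omega> (Suc t))) \<partial>P)"
      using E(2)[of t] m j
      by (intro nn_integral_cong)
         (auto simp: indicator_def ennreal_mult[symmetric] ennreal_plus[symmetric] inv_likelihood_nonneg
            sr_weighted_nonneg ratio_nonneg simp del: ennreal_plus)
    also have "\<dots> \<le> (\<integral>\<^sup>+\<omega>. indicator (E t) \<omega> * (ennreal (inv_likelihood \<nu> m t \<omega>) + ennreal (sr_weighted \<nu> m j t \<omega>)) \<partial>P)"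
      unfolding P_def
      by (intro nn_integral_times_ratio_le m j borel_measurable_times_ennreal borel_measurable_add borel_measurable_indicator E
            measurable_compose[OF measurable_inv_likelihood[OF m] measurable_ennreal]
            measurable_compose[OF measurable_sr_weighted[OF m j] measurable_ennreal])
    also have "\<dots> = c t + u j t"
      unfolding c_def u_def distrib_left by (rule nn_integral_add) measurable
    finally show ?thesis .
  qed
  have "(\<Sum>j\<in>J. u j n) + (\<Sum>t<n. \<Sum>j\<in>J. s j t) \<le> of_nat (card J) * (\<Sum>t<n. c t)"
  proof (induction n)
    case 0
    show ?case by (simp add: u_def)
  next
    case (Suc n)
    have "(\<Sum>j\<in>J. u j (Suc n)) + (\<Sum>t<Suc n. \<Sum>j\<in>J. s j t)
       = (\<Sum>j\<in>J. u j (Suc n) + s j n) + (\<Sum>t<n. \<Sum>j\<in>J. s j t)"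
      by (simp add: sum.distrib algebra_simps)
    also have "\<dots> \<le> (\<Sum>j\<in>J. c n + u j n) + (\<Sum>t<n. \<Sum>j\<in>J. s j t)"
      by (intro add_right_mono sum_mono step J)
    also have "\<dots> = of_nat (card J) * c n + ((\<Sum>j\<in>J. u j n) + (\<Sum>t<n. \<Sum>j\<in>J. s j t))"
      by (simp add: sum.distrib algebra_simps)
    also have "\<dots> \<le> of_nat (card J) * c n + of_nat (card J) * (\<Sum>t<n. c t)"
      by (intro add_left_mono Suc)
    finally show ?case by (simp add: algebra_simps)
  qed
  moreover have "(\<Sum>t<n. \<Sum>j\<in>J. s j t) \<le> (\<Sum>j\<in>J. u j n) + (\<Sum>t<n. \<Sum>j\<in>J. s j t)" by simp
  ultimately show ?thesis unfolding s_def c_def by (rule order_trans[rotated])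
qed

text \<open>When one of the CuSum statistics in \<open>J\<close> crosses \<open>ln b\<close>, a Shiryaev-Roberts statistic exceeds \<open>b\<close>.
  Since these statistics accumulate slowly, the weighted probability of such crossings is at
  most \<open>card J / b\<close> per time step.\<close>

lemma false_alarm_bound:
  assumes m: "m \<le> num_hyp S" and J: "finite J" "\<And>j. j \<in> J \<Longrightarrow> j \<le> num_hyp S" and b: "1 \<le> b"
    and E: "\<And>t. E t \<in> sets (obs_filtration S (enat t))" "\<And>t. E (Suc t) \<subseteq> E t"
    and X: "\<And>t. X t \<subseteq> E t - E (Suc t)" "\<And>t. X t \<in> sets (obs_seq_space S)"
    and cross: "\<And>t. AE \<omega> in obs_measure S \<pi> \<nu> m. \<omega> \<in> X t \<longrightarrow> (\<exists>j\<in>J. cusum S j (Suc t) \<omega> > ereal (ln b))"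
  shows "ennreal b * (\<Sum>t<n. \<integral>\<^sup>+\<omega>. indicator (X t) \<omega> * ennreal (inv_likelihood \<nu> m (Suc t) \<omega>) \<partial>obs_measure S \<pi> \<nu> m)
    \<le> of_nat (card J) * (\<Sum>t<n. \<integral>\<^sup>+\<omega>. indicator (E t) \<omega> * ennreal (inv_likelihood \<nu> m t \<omega>) \<partial>obs_measure S \<pi> \<nu> m)"
proof -
  let ?O = "obs_measure S \<pi> \<nu> m"
  have V: "(\<lambda>\<omega>. ennreal (sr_weighted \<nu> m j t \<omega>)) \<in> borel_measurable ?O" if "j \<in> J" for j t
    using measurable_obs_measure[OF measurable_sr_weighted[OF m J(2)[OF that]]] by measurable
  have EO: "E t \<in> sets ?O" for t using sets_obs_filtration_full[OF E(1)] by simp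
  have "ennreal b * (\<integral>\<^sup>+\<omega>. indicator (X t) \<omega> * ennreal (inv_likelihood \<nu> m (Suc t) \<omega>) \<partial>?O)
     \<le> (\<Sum>j\<in>J. \<integral>\<^sup>+\<omega>. indicator (E t - E (Suc t)) \<omega> * ennreal (sr_weighted \<nu> m j (Suc t) \<omega>) \<partial>?O)" for t
  proof -
    note [measurable] = EO
    have Q: "(\<lambda>\<omega>. ennreal (inv_likelihood \<nu> m (Suc t) \<omega>)) \<in> borel_measurable ?O"
      using measurable_obs_measure[OF measurable_inv_likelihood[OF m]] by measurable
    have "AE \<omega> in ?O. ennreal b * (indicator (X t) \<omega> * ennreal (inv_likelihood \<nu> m (Suc t) \<omega>))
       \<le> (\<Sum>j\<in>J. indicator (E t - E (Suc t)) \<omega> * ennreal (sr_weighted \<nu> m j (Suc t) \<omega>))"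
      using cross[of t] AE_regular_obs[OF m, of \<nu> \<pi>]
    proof eventually_elim
      case (elim \<omega>)
      show ?case
      proof (cases "\<omega> \<in> X t")
        case True
        then obtain j where j: "j \<in> J" "cusum S j (Suc t) \<omega> > ereal (ln b)" using elim by blast
        have "b \<le> sr_stat j (Suc t) \<omega>"
          using sr_stat_gt[OF elim(2) J(2)[OF j(1)] b j(2)] by simp
        then have "b * inv_likelihood \<nu> m (Suc t) \<omega> \<le> sr_weighted \<nu> m j (Suc t) \<omega>"
          unfolding sr_weighted_eq[OF elim(2)] by (intro mult_right_mono inv_likelihood_nonneg m)
        then have "ennreal b * ennreal (inv_likelihood \<nu> m (Suc t) \<omega>) \<le> ennreal (sr_weighted \<nu> m j (Suc t) \<omega>)"
          using b by (subst ennreal_mult[symmetric]) (auto simp: inv_likelihood_nonneg m intro: ennreal_leI simp del: inv_likelihood.simps sr_weighted.simps)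
        also have "\<dots> \<le> (\<Sum>j\<in>J. ennreal (sr_weighted \<nu> m j (Suc t) \<omega>))"
          using J(1) j(1) by (intro member_le_sum) auto
        finally show ?thesis using True X(1)[of t] by (auto simp: indicator_def simp del: inv_likelihood.simps sr_weighted.simps)
      qed simp
    qed
    then have "(\<integral>\<^sup>+\<omega>. ennreal b * (indicator (X t) \<omega> * ennreal (inv_likelihood \<nu> m (Suc t) \<omega>)) \<partial>?O)
       \<le> (\<integral>\<^sup>+\<omega>. (\<Sum>j\<in>J. indicator (E t - E (Suc t)) \<omega> * ennreal (sr_weighted \<nu> m j (Suc t) \<omega>)) \<partial>?O)"
      by (rule nn_integral_mono_AE)
    moreover have "ennreal b * (\<integral>\<^sup>+\<omega>. indicator (X t) \<omega> * ennreal (inv_likelihood \<nu> m (Suc t) \<omega>) \<partial>?O)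
       \<le> (\<integral>\<^sup>+\<omega>. ennreal b * (indicator (X t) \<omega> * ennreal (inv_likelihood \<nu> m (Suc t) \<omega>)) \<partial>?O)"
      using Q X(2)[of t] by (subst nn_integral_cmult) (auto intro: borel_measurable_times_ennreal)
    moreover have "(\<integral>\<^sup>+\<omega>. (\<Sum>j\<in>J. indicator (E t - E (Suc t)) \<omega> * ennreal (sr_weighted \<nu> m j (Suc t) \<omega>)) \<partial>?O)
      = (\<Sum>j\<in>J. \<integral>\<^sup>+\<omega>. indicator (E t - E (Suc t)) \<omega> * ennreal (sr_weighted \<nu> m j (Suc t) \<omega>) \<partial>?O)"
      by (intro nn_integral_sum borel_measurable_times_ennreal borel_measurable_indicator sets.Diff EO V)
    ultimately show ?thesis by (simp only: order_trans)
  qed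
  then have "(\<Sum>t<n. ennreal b * (\<integral>\<^sup>+\<omega>. indicator (X t) \<omega> * ennreal (inv_likelihood \<nu> m (Suc t) \<omega>) \<partial>?O))
    \<le> (\<Sum>t<n. \<Sum>j\<in>J. \<integral>\<^sup>+\<omega>. indicator (E t - E (Suc t)) \<omega> * ennreal (sr_weighted \<nu> m j (Suc t) \<omega>) \<partial>?O)"
    by (rule sum_mono)
  also have "\<dots> \<le> of_nat (card J) * (\<Sum>t<n. \<integral>\<^sup>+\<omega>. indicator (E t) \<omega> * ennreal (inv_likelihood \<nu> m t \<omega>) \<partial>?O)"
    by (rule sr_optional_stopping[OF m J E])
  finally show ?thesis by (simp add: sum_distrib_left)
qed

section \<open>Alarms without a change\<close>

abbreviation threshold :: "real \<Rightarrow> real" where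
  "threshold \<gamma> \<equiv> real (num_hyp S) * \<gamma>"

lemma threshold_ge_1: "1 \<le> \<gamma> \<Longrightarrow> 1 \<le> threshold \<gamma>"
  using num_hyp_ge_1 mult_mono[of 1 "real (num_hyp S)" 1 \<gamma>] by simp

lemma glr_statistic_gt:
  "glr_statistic S t \<omega> > c \<longleftrightarrow> (\<exists>j\<in>{1..num_hyp S}. cusum S j t \<omega> > c)"
  unfolding glr_statistic_def using num_hyp_ge_1 by (subst Max_gr_iff) auto

lemma cusum_le_threshold:
  assumes "enat t < glr_cusum S \<gamma> \<omega>" "j \<in> {1..num_hyp S}"
  shows "cusum S j t \<omega> \<le> ereal (ln (threshold \<gamma>))"
proof (rule ccontr)
  assume "\<not> ?thesis"
  then have "glr_statistic S t \<omega> > ereal (ln (threshold \<gamma>))"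
    unfolding glr_statistic_gt using assms(2) by (auto simp: not_le)
  then have "glr_cusum S \<gamma> \<omega> \<le> enat t"
    unfolding glr_cusum_def by (intro Inf_lower) blast
  then show False using assms(1) by simp
qed

lemma glr_cusum_crossing:
  assumes "glr_cusum S \<gamma> \<omega> = enat t"
  shows "\<exists>j\<in>{1..num_hyp S}. cusum S j t \<omega> > ereal (ln (threshold \<gamma>))"
proof -
  let ?A = "{enat t |t. glr_statistic S t \<omega> > ereal (ln (threshold \<gamma>))}"
  have "?A \<noteq> {}"
  proof
    assume "?A = {}"
    with assms show False unfolding glr_cusum_def by (simp only: Inf_enat_def) simp
  qed
  then obtain u where "u \<in> ?A" by blast
  then have "Inf ?A \<in> ?A" by (rule wellorder_InfI)
  then have "enat t \<in> ?A" using assms unfolding glr_cusum_def by simp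
  then show ?thesis by (auto simp: glr_statistic_gt)
qed

definition survive :: "real \<Rightarrow> nat \<Rightarrow> (nat \<Rightarrow> 'act \<times> 'y) set" where
  "survive \<gamma> t = {\<omega> \<in> space (obs_seq_space S). enat t < glr_cusum S \<gamma> \<omega>}"

lemma survive_sets: "survive \<gamma> t \<in> sets (obs_filtration S (enat t))"
proof -
  have "Measurable.pred (obs_filtration S (enat t)) (\<lambda>\<omega>. glr_cusum S \<gamma> \<omega> \<le> enat t)"
    by (rule stopping_timeD[OF stopping_time_glr_cusum[OF model]])
  then have "{\<omega> \<in> space (obs_filtration S (enat t)). \<not> glr_cusum S \<gamma> \<omega> \<le> enat t} \<in> sets (obs_filtration S (enat t))"
    by measurable
  then show ?thesis by (simp add: survive_def obs_filtration_facts(1) not_le)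
qed

lemma survive_antimono: "t \<le> t' \<Longrightarrow> survive \<gamma> t' \<subseteq> survive \<gamma> t"
  by (auto simp: survive_def intro: le_less_trans[of "enat t" "enat t'"])

lemma survive_0:
  assumes "1 \<le> \<gamma>"
  shows "survive \<gamma> 0 = space (obs_seq_space S)"
proof -
  have "enat 0 < glr_cusum S \<gamma> \<omega>" for \<omega>
  proof (rule ccontr)
    assume "\<not> ?thesis"
    then have "glr_cusum S \<gamma> \<omega> = enat 0" by (simp add: zero_enat_def[symmetric])
    from glr_cusum_crossing[OF this] show False using threshold_ge_1[OF assms] by (auto simp: ln_ge_zero)
  qed
  then show ?thesis by (auto simp: survive_def)
qed

lemma crossing_at:
  assumes "\<omega> \<in> survive \<gamma> t - survive \<gamma> (Suc t)"
  shows "\<exists>j\<in>{1..num_hyp S}. cusum S j (Suc t) \<omega> > ereal (ln (threshold \<gamma>))"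
proof -
  have "enat t < glr_cusum S \<gamma> \<omega>" "\<not> enat (Suc t) < glr_cusum S \<gamma> \<omega>" using assms by (auto simp: survive_def)
  then have "glr_cusum S \<gamma> \<omega> = enat (Suc t)" by (cases "glr_cusum S \<gamma> \<omega>") auto
  then show ?thesis by (rule glr_cusum_crossing)
qed

lemma survive_in_obs: "survive \<gamma> t \<in> sets (obs_measure S \<pi> \<nu> m)"
  using sets_obs_filtration_full[OF survive_sets] by simp

lemma inv_likelihood_before: "enat t < \<nu> \<Longrightarrow> inv_likelihood \<nu> m t \<omega> = 1"
proof (induction t)
  case (Suc t)
  have "enat t < \<nu>" by (rule le_less_trans[OF _ Suc.prems]) simp
  then show ?case using Suc by simp
qed simp

text \<open>Before the change all weights are \<open>1\<close>. The \<open>M\<close> statistics together grow by \<open>M\<close> per time step on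
  average, and an alarm needs one of them to reach \<open>M \<gamma>\<close>; the factor \<open>M\<close> cancels.\<close>

lemma early_alarm:
  fixes \<nu> :: enat and \<pi> :: "'act policy" and k m :: nat
  assumes m: "m \<le> num_hyp S" and \<gamma>: "1 \<le> \<gamma>" and k: "enat k < \<nu>"
  defines "P \<equiv> obs_measure S \<pi> \<nu> m"
  shows "\<gamma> * (1 - measure P (survive \<gamma> k)) \<le> (\<Sum>t<k. measure P (survive \<gamma> t))"
proof -
  interpret P: prob_space P unfolding P_def by (rule prob_space_obs_measure[OF model m])
  have sP: "survive \<gamma> t \<in> sets P" for t unfolding P_def by (rule survive_in_obs)
  have lt: "enat t < \<nu>" if "t \<le> k" for t using that k by (meson enat_ord_simps(1) le_less_trans)
  have "ennreal (threshold \<gamma>) * (\<Sum>t<k. \<integral>\<^sup>+\<omega>. indicator (survive \<gamma> t - survive \<gamma> (Suc t)) \<omega> * ennreal (inv_likelihood \<nu> m (Suc t) \<omega>) \<partial>P)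
     \<le> of_nat (card {1..num_hyp S}) * (\<Sum>t<k. \<integral>\<^sup>+\<omega>. indicator (survive \<gamma> t) \<omega> * ennreal (inv_likelihood \<nu> m t \<omega>) \<partial>P)"
    unfolding P_def
  proof (rule false_alarm_bound[OF m])
    show "survive \<gamma> t - survive \<gamma> (Suc t) \<in> sets (obs_seq_space S)" for t
      using sP by (auto simp: P_def)
    show "AE \<omega> in obs_measure S \<pi> \<nu> m. \<omega> \<in> survive \<gamma> t - survive \<gamma> (Suc t) \<longrightarrow>
        (\<exists>j\<in>{1..num_hyp S}. cusum S j (Suc t) \<omega> > ereal (ln (threshold \<gamma>)))" for t
      by (intro AE_I2 impI crossing_at)
  qed (use threshold_ge_1[OF \<gamma>] survive_sets survive_antimono in auto)
  also have "(\<Sum>t<k. \<integral>\<^sup>+\<omega>. indicator (survive \<gamma> t - survive \<gamma> (Suc t)) \<omega> * ennreal (inv_likelihood \<nu> m (Suc t) \<omega>) \<partial>P)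
     = (\<Sum>t<k. ennreal (measure P (survive \<gamma> t) - measure P (survive \<gamma> (Suc t))))"
  proof (intro sum.cong refl)
    fix t assume "t \<in> {..<k}"
    then have "inv_likelihood \<nu> m (Suc t) \<omega> = 1" for \<omega> using lt[of "Suc t"] by (intro inv_likelihood_before) auto
    then have "(\<integral>\<^sup>+\<omega>. indicator (survive \<gamma> t - survive \<gamma> (Suc t)) \<omega> * ennreal (inv_likelihood \<nu> m (Suc t) \<omega>) \<partial>P)
       = emeasure P (survive \<gamma> t - survive \<gamma> (Suc t))"
      using sP by (simp del: inv_likelihood.simps)
    also have "\<dots> = ennreal (measure P (survive \<gamma> t) - measure P (survive \<gamma> (Suc t)))"
      unfolding P.emeasure_eq_measure using P.finite_measure_Diff[OF sP sP survive_antimono[of t "Suc t" \<gamma>]] by simp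
    finally show "(\<integral>\<^sup>+\<omega>. indicator (survive \<gamma> t - survive \<gamma> (Suc t)) \<omega> * ennreal (inv_likelihood \<nu> m (Suc t) \<omega>) \<partial>P)
       = ennreal (measure P (survive \<gamma> t) - measure P (survive \<gamma> (Suc t)))" .
  qed
  also have "\<dots> = ennreal (\<Sum>t<k. measure P (survive \<gamma> t) - measure P (survive \<gamma> (Suc t)))"
    by (intro sum_ennreal) (simp add: P.finite_measure_mono[OF survive_antimono sP])
  also have "(\<Sum>t<k. measure P (survive \<gamma> t) - measure P (survive \<gamma> (Suc t))) = 1 - measure P (survive \<gamma> k)"
    using P.prob_space by (subst sum_lessThan_telescope') (simp add: survive_0[OF \<gamma>] P_def)
  also have "(\<Sum>t<k. \<integral>\<^sup>+\<omega>. indicator (survive \<gamma> t) \<omega> * ennreal (inv_likelihood \<nu> m t \<omega>) \<partial>P)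
     = (\<Sum>t<k. ennreal (measure P (survive \<gamma> t)))"
    using sP lt by (intro sum.cong refl) (simp add: inv_likelihood_before P.emeasure_eq_measure)
  also have "\<dots> = ennreal (\<Sum>t<k. measure P (survive \<gamma> t))" by (intro sum_ennreal) simp
  finally have "ennreal (threshold \<gamma> * (1 - measure P (survive \<gamma> k))) \<le> ennreal (real (num_hyp S) * (\<Sum>t<k. measure P (survive \<gamma> t)))"
    using threshold_ge_1[OF \<gamma>] by (simp add: ennreal_mult[symmetric] sum_nonneg ennreal_of_nat_eq_real_of_nat)
  then have "threshold \<gamma> * (1 - measure P (survive \<gamma> k)) \<le> real (num_hyp S) * (\<Sum>t<k. measure P (survive \<gamma> t))"
    by (subst (asm) ennreal_le_iff) (auto intro!: mult_nonneg_nonneg sum_nonneg)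
  then have "real (num_hyp S) * (\<gamma> * (1 - measure P (survive \<gamma> k))) \<le> real (num_hyp S) * (\<Sum>t<k. measure P (survive \<gamma> t))"
    by (simp add: mult.assoc)
  then show ?thesis using num_hyp_ge_1 by (subst (asm) mult_le_cancel_left_pos) auto
qed

lemma measurable_stopping:
  assumes "stopping_time (obs_filtration S) \<tau>"
  shows "\<tau> \<in> obs_measure S \<pi> \<nu> m \<rightarrow>\<^sub>M count_space UNIV"
proof -
  have "\<tau> \<in> obs_seq_space S \<rightarrow>\<^sub>M borel"
    by (rule measurable_stopping_time[OF assms])
       (use obs_filtration_facts(2)[of _ \<infinity> S] obs_filtration_facts(3)[of S] in \<open>auto simp: obs_filtration_facts(1)\<close>)
  then have "\<tau> \<in> obs_seq_space S \<rightarrow>\<^sub>M count_space UNIV"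
    using measurable_cong_sets[OF refl sets_borel_eq_count_space] by auto
  then show ?thesis by (simp add: measurable_cong_sets[OF sets_obs_measure refl])
qed

text \<open>The bound on alarms before time \<open>k\<close>, for \<open>k \<rightarrow> \<infinity>\<close>: either the expected run length is infinite or
  the probability of no alarm before \<open>k\<close> tends to \<open>0\<close>.\<close>

lemma ARL_glr_cusum:
  assumes \<gamma>: "1 \<le> \<gamma>"
  shows "ennreal \<gamma> \<le> ARL S (glr_cusum S \<gamma>) \<pi>"
proof -
  let ?P = "obs_measure S \<pi> \<infinity> 0"
  interpret P: prob_space ?P by (rule prob_space_obs_measure[OF model le0])
  define p where "p t = measure ?P (survive \<gamma> t)" for t
  have p0: "0 \<le> p t" for t by (simp add: p_def)
  have "ARL S (glr_cusum S \<gamma>) \<pi> = (\<Sum>t. emeasure ?P {x \<in> space ?P. enat t < glr_cusum S \<gamma> x})"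
    unfolding ARL_def by (rule nn_integral_enat_function[OF measurable_stopping[OF stopping_time_glr_cusum[OF model]]])
  also have "\<dots> = (\<Sum>t. ennreal (p t))"
    by (simp add: p_def P.emeasure_eq_measure[symmetric] survive_def)
  finally have ARL: "ARL S (glr_cusum S \<gamma>) \<pi> = (\<Sum>t. ennreal (p t))" .
  show ?thesis
  proof (cases "summable p")
    case False
    have "(\<Sum>t. ennreal (p t)) = top"
    proof (rule ccontr)
      assume "(\<Sum>t. ennreal (p t)) \<noteq> top"
      with p0 have "summable p" by (intro summable_suminf_not_top) auto
      with False show False ..
    qed
    then show ?thesis by (simp add: ARL)
  next
    case True
    have "(\<lambda>k. \<gamma> * (1 - p k)) \<longlonglongrightarrow> \<gamma> * (1 - 0)"
      by (intro tendsto_intros summable_LIMSEQ_zero True)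
    moreover have "\<gamma> * (1 - p k) \<le> (\<Sum>t. p t)" for k
    proof -
      have "\<gamma> * (1 - p k) \<le> (\<Sum>t<k. p t)"
        unfolding p_def by (rule early_alarm[OF le0 \<gamma>]) simp
      also have "\<dots> \<le> (\<Sum>t. p t)" by (rule sum_le_suminf[OF True]) (simp_all add: p0)
      finally show ?thesis .
    qed
    ultimately have "\<gamma> * (1 - 0) \<le> (\<Sum>t. p t)" by (intro LIMSEQ_le_const2) auto
    then show ?thesis by (simp add: ARL suminf_ennreal2[OF p0 True] ennreal_leI)
  qed
qed

section \<open>Worst-case delay\<close>

text \<open>The change point is written \<open>k + 1\<close>, so that \<open>k\<close> observations precede it.\<close>

abbreviation delay :: "((nat \<Rightarrow> 'act \<times> 'y) \<Rightarrow> enat) \<Rightarrow> nat \<Rightarrow> (nat \<Rightarrow> 'act \<times> 'y) \<Rightarrow> ennreal" where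
  "delay \<tau> k \<omega> \<equiv> ennreal_of_enat (\<tau> \<omega> + 1 - enat (Suc k))"

lemma sigma_finite_subalg:
  assumes "m \<le> num_hyp S"
  shows "sigma_finite_subalgebra (obs_measure S \<pi> \<nu> m) (obs_filtration S n)"
proof -
  interpret prob_space "obs_measure S \<pi> \<nu> m" by (rule prob_space_obs_measure[OF model assms])
  interpret finite_measure_subalgebra "obs_measure S \<pi> \<nu> m" "obs_filtration S n"
    by unfold_locales (rule obs_filtration_facts(4))
  show ?thesis by (rule sigma_finite_subalgebra_axioms)
qed

text \<open>Instead of conditional expectations, the following bounds on the worst-case delay use integrals
  over events \<open>F\<close> of the past; an essential supremum dominates the mean over each of them.\<close>

lemma WADD_hyp_lower:
  fixes \<pi> :: "'act policy" and k m :: nat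
  assumes m: "m \<le> num_hyp S" and \<tau>: "stopping_time (obs_filtration S) \<tau>"
    and F: "F \<in> sets (obs_filtration S (enat k))"
  defines "P \<equiv> obs_measure S \<pi> (enat (Suc k)) m"
  shows "(\<integral>\<^sup>+\<omega>. indicator F \<omega> * delay \<tau> k \<omega> \<partial>P) \<le> WADD_hyp S m \<tau> \<pi> * emeasure P F"
proof -
  interpret sigma_finite_subalgebra P "obs_filtration S (enat k)"
    unfolding P_def by (rule sigma_finite_subalg[OF m])
  let ?c = "nn_cond_exp P (obs_filtration S (enat k)) (delay \<tau> k)"
  have FP: "F \<in> sets P" using sets_obs_filtration_full[OF F] by (simp add: P_def)
  have meas: "delay \<tau> k \<in> borel_measurable P" unfolding P_def by (rule measurable_delay[OF \<tau>])
  have sup_le: "esssup P ?c \<le> WADD_hyp S m \<tau> \<pi>"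
    unfolding WADD_hyp_def P_def
    using SUP_upper[of "Suc k" "{1..}" "\<lambda>\<nu>. esssup (obs_measure S \<pi> (enat \<nu>) m)
        (nn_cond_exp (obs_measure S \<pi> (enat \<nu>) m) (obs_filtration S (enat (\<nu> - 1)))
           (\<lambda>\<omega>. ennreal_of_enat (\<tau> \<omega> + 1 - enat \<nu>)))"] by simp
  have le: "AE \<omega> in P. ?c \<omega> \<le> WADD_hyp S m \<tau> \<pi>"
    using esssup_AE[of ?c P] by eventually_elim (rule order_trans[OF _ sup_le])
  have "(\<integral>\<^sup>+\<omega>. indicator F \<omega> * delay \<tau> k \<omega> \<partial>P) = (\<integral>\<^sup>+\<omega>. indicator F \<omega> * ?c \<omega> \<partial>P)"
    by (rule nn_cond_exp_intg[symmetric]) (use F meas in auto)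
  also have "\<dots> \<le> (\<integral>\<^sup>+\<omega>. WADD_hyp S m \<tau> \<pi> * indicator F \<omega> \<partial>P)"
    using le by (intro nn_integral_mono_AE) (auto simp: indicator_def)
  also have "\<dots> = WADD_hyp S m \<tau> \<pi> * emeasure P F" using FP by (rule nn_integral_cmult_indicator)
  finally show ?thesis .
qed

text \<open>The event that the conditional expectation exceeds \<open>c\<close> is itself an event of the past, and the
  hypothesis makes it a null set.\<close>

lemma WADD_hyp_upper:
  assumes m: "m \<le> num_hyp S" and \<tau>: "stopping_time (obs_filtration S) \<tau>"
    and le: "\<And>k F. F \<in> sets (obs_filtration S (enat k)) \<Longrightarrow>
       (\<integral>\<^sup>+\<omega>. indicator F \<omega> * delay \<tau> k \<omega> \<partial>obs_measure S \<pi> (enat (Suc k)) m)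
         \<le> ennreal c * emeasure (obs_measure S \<pi> (enat (Suc k)) m) F"
  shows "WADD_hyp S m \<tau> \<pi> \<le> ennreal c"
  unfolding WADD_hyp_def
proof (rule SUP_least)
  fix \<nu> :: nat assume "\<nu> \<in> {1..}"
  then obtain k where \<nu>: "\<nu> = Suc k" by (cases \<nu>) auto
  let ?P = "obs_measure S \<pi> (enat (Suc k)) m" and ?F = "obs_filtration S (enat k)"
  interpret prob_space ?P by (rule prob_space_obs_measure[OF model m])
  interpret sigma_finite_subalgebra ?P ?F by (rule sigma_finite_subalg[OF m])
  let ?c = "nn_cond_exp ?P ?F (delay \<tau> k)"
  have meas: "delay \<tau> k \<in> borel_measurable ?P" by (rule measurable_delay[OF \<tau>])
  define A where "A = {\<omega> \<in> space ?F. ennreal c < ?c \<omega>}"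
  have AF: "A \<in> sets ?F" unfolding A_def by measurable
  have AP [measurable]: "A \<in> sets ?P" using sets_obs_filtration_full[OF AF] by simp
  have cP [measurable]: "?c \<in> borel_measurable ?P" by simp
  have "(\<integral>\<^sup>+\<omega>. indicator A \<omega> * ?c \<omega> \<partial>?P) = (\<integral>\<^sup>+\<omega>. indicator A \<omega> * delay \<tau> k \<omega> \<partial>?P)"
    by (rule nn_cond_exp_intg) (use AF meas in auto)
  also have "\<dots> \<le> ennreal c * emeasure ?P A" by (rule le[OF AF])
  also have "\<dots> = (\<integral>\<^sup>+\<omega>. ennreal c * indicator A \<omega> \<partial>?P)" by (rule nn_integral_cmult_indicator[symmetric, OF AP])
  finally have int_le: "(\<integral>\<^sup>+\<omega>. indicator A \<omega> * ?c \<omega> \<partial>?P) \<le> (\<integral>\<^sup>+\<omega>. ennreal c * indicator A \<omega> \<partial>?P)" .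
  have m1: "(\<lambda>\<omega>. indicator A \<omega> * ?c \<omega>) \<in> borel_measurable ?P"
    and m2: "(\<lambda>\<omega>. ennreal c * indicator A \<omega>) \<in> borel_measurable ?P"
    by measurable
  have fin: "(\<integral>\<^sup>+\<omega>. ennreal c * indicator A \<omega> \<partial>?P) < \<infinity>"
    by (simp add: nn_integral_cmult_indicator[OF AP] ennreal_mult_less_top emeasure_eq_measure)
  have above: "AE \<omega> in ?P. ennreal c * indicator A \<omega> \<le> indicator A \<omega> * ?c \<omega>"
    by (intro AE_I2) (auto simp: A_def indicator_def intro: less_imp_le)
  have "(\<integral>\<^sup>+\<omega>. indicator A \<omega> * ?c \<omega> - ennreal c * indicator A \<omega> \<partial>?P)
     = (\<integral>\<^sup>+\<omega>. indicator A \<omega> * ?c \<omega> \<partial>?P) - (\<integral>\<^sup>+\<omega>. ennreal c * indicator A \<omega> \<partial>?P)"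
    using fin by (intro nn_integral_diff m1 m2 above) simp
  also have "\<dots> = 0"
    using int_le le_less_trans[OF int_le fin] by (simp only: diff_eq_0_iff_ennreal infinity_ennreal_def)
  finally have "AE \<omega> in ?P. indicator A \<omega> * ?c \<omega> - ennreal c * indicator A \<omega> = 0"
    using m1 m2 by (subst (asm) nn_integral_0_iff_AE) auto
  then have "AE \<omega> in ?P. ?c \<omega> \<le> ennreal c"
    using AE_space
  proof eventually_elim
    case (elim \<omega>)
    show ?case
    proof (rule ccontr)
      assume gt: "\<not> ?c \<omega> \<le> ennreal c"
      then have "\<omega> \<in> A" using elim by (simp add: A_def obs_filtration_facts(1))
      then have "?c \<omega> - ennreal c = 0" using elim by simp
      then have "?c \<omega> \<le> ennreal c" by (metis diff_gt_0_iff_gt_ennreal not_le less_irrefl)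
      with gt show False ..
    qed
  qed
  then show "esssup (obs_measure S \<pi> (enat \<nu>) m) (nn_cond_exp (obs_measure S \<pi> (enat \<nu>) m) (obs_filtration S (enat (\<nu> - 1)))
           (\<lambda>\<omega>. ennreal_of_enat (\<tau> \<omega> + 1 - enat \<nu>))) \<le> ennreal c"
    unfolding \<nu> by (intro esssup_I) simp_all
qed

text \<open>The layer-cake formula: the delay exceeds \<open>i\<close> exactly if no alarm has been raised by time \<open>k + i\<close>.\<close>

lemma delay_integral:
  fixes \<pi> :: "'act policy" and k m :: nat
  assumes m: "m \<le> num_hyp S" and F: "F \<in> sets (obs_seq_space S)"
  defines "P \<equiv> obs_measure S \<pi> (enat (Suc k)) m"
  shows "(\<integral>\<^sup>+\<omega>. indicator F \<omega> * delay (glr_cusum S \<gamma>) k \<omega> \<partial>P)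
    = (\<Sum>i. ennreal (measure P (F \<inter> survive \<gamma> (k + i))))"
proof -
  interpret P: prob_space P unfolding P_def by (rule prob_space_obs_measure[OF model m])
  define f where "f \<omega> = (if \<omega> \<in> F then glr_cusum S \<gamma> \<omega> + 1 - enat (Suc k) else 0)" for \<omega>
  have T: "glr_cusum S \<gamma> \<in> P \<rightarrow>\<^sub>M count_space UNIV"
    unfolding P_def by (rule measurable_stopping[OF stopping_time_glr_cusum[OF model]])
  have FP: "F \<in> sets P" using F by (simp add: P_def)
  have f: "f \<in> P \<rightarrow>\<^sub>M count_space UNIV"
    unfolding f_def[abs_def]
    by (intro measurable_If_set) (use FP in \<open>auto intro: measurable_compose[OF T]\<close>)
  have "(\<integral>\<^sup>+\<omega>. indicator F \<omega> * delay (glr_cusum S \<gamma>) k \<omega> \<partial>P) = (\<integral>\<^sup>+\<omega>. ennreal_of_enat (f \<omega>) \<partial>P)"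
    by (intro nn_integral_cong) (auto simp: f_def indicator_def simp del: ennreal_of_enat_plus)
  also have "\<dots> = (\<Sum>i. emeasure P {x \<in> space P. enat i < f x})" by (rule nn_integral_enat_function[OF f])
  also have "(\<lambda>i. {x \<in> space P. enat i < f x}) = (\<lambda>i. F \<inter> survive \<gamma> (k + i))"
  proof (intro ext set_eqI)
    fix i x
    have "enat i < y + 1 - enat (Suc k) \<longleftrightarrow> enat (k + i) < y" for y :: enat
      by (cases y) (auto simp: one_enat_def)
    then show "x \<in> {x \<in> space P. enat i < f x} \<longleftrightarrow> x \<in> F \<inter> survive \<gamma> (k + i)"
      using sets.sets_into_space[OF F] by (auto simp: f_def survive_def P_def zero_enat_def[symmetric])
  qed
  finally show ?thesis by (simp add: P.emeasure_eq_measure)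
qed

section \<open>Wald's identity with a Poisson equation\<close>

text \<open>The sum telescopes up to the first failure of \<open>b\<close>.\<close>

lemma abs_telescope_le:
  fixes x :: "nat \<Rightarrow> real"
  assumes b: "\<And>i. b (Suc i) \<Longrightarrow> b i" and x: "\<And>i. \<bar>x i\<bar> \<le> H" and b0: "\<not> b0 \<Longrightarrow> \<not> b 0"
  shows "\<bar>\<Sum>i<n. of_bool (b i) * (x i - x (Suc i))\<bar> \<le> of_bool b0 * (2 * H)"
proof -
  have dec: "b j" if "b i" "j \<le> i" for i j
    using that(2,1) by (induction rule: dec_induct) (auto intro: b)
  have "b 0 \<Longrightarrow> \<exists>\<sigma>. (\<Sum>i<n. of_bool (b i) * (x i - x (Suc i))) = x 0 - x \<sigma> \<and> (b n \<longrightarrow> \<sigma> = n)"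
  proof (induction n)
    case 0
    then show ?case by auto
  next
    case (Suc n)
    then obtain \<sigma> where \<sigma>: "(\<Sum>i<n. of_bool (b i) * (x i - x (Suc i))) = x 0 - x \<sigma>" "b n \<longrightarrow> \<sigma> = n" by auto
    show ?case
    proof (cases "b n")
      case True
      then show ?thesis using \<sigma> by (intro exI[of _ "Suc n"]) simp
    next
      case False
      then show ?thesis using \<sigma> b[of n] by (intro exI[of _ \<sigma>]) auto
    qed
  qed
  moreover have "\<bar>x 0 - x \<sigma>\<bar> \<le> 2 * H" for \<sigma> using x[of 0] x[of \<sigma>] by linarith
  moreover have "(\<Sum>i<n. of_bool (b i) * (x i - x (Suc i))) = 0" if "\<not> b 0"
    using dec that by (intro sum.neutral) auto
  moreover have "0 \<le> H" using order_trans[OF abs_ge_zero x] .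
  ultimately show ?thesis using b0 by (cases "b 0"; cases b0) auto
qed

text \<open>While no alarm has been raised, the conditional mean of \<open>\<phi>\<close> at the next observation depends only on
  the current action; this is Wald's identity. By hypothesis that mean is at most
  \<open>h w - step T h w + c\<close> in the current window \<open>w\<close>. By the Markov property the first part is the mean
  of \<open>h w - h w'\<close> for the next window \<open>w'\<close>, which telescopes and contributes only a bounded amount. What
  remains is \<open>c\<close> times the expected delay: only the rate \<open>c\<close> matters, not the order in which the
  actions are taken.\<close>

lemma wald_poisson_le:
  fixes \<pi> :: "'act policy" and k m :: nat
  assumes m: "m \<le> num_hyp S" and \<pi>: "open_loop_policy W \<pi>" "W \<ge> 1"
    and F: "F \<in> sets (obs_filtration S (enat k))"
    and \<phi>: "\<phi> \<in> borel_measurable obs_pair_space"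
    and int: "\<And>a. integrable (obs_law S m a) (\<lambda>y. \<phi> (a, y))"
    and h: "\<And>w. \<bar>h w\<bar> \<le> H"
    and drift: "\<And>w. w \<in> B \<Longrightarrow> (\<integral>y. \<phi> (hd w, y) \<partial>obs_law S m (hd w)) \<le> h w - step (snd \<pi>) h w + c"
    and B: "AE p in joint \<pi> (enat (Suc k)) m. observe p \<in> F \<longrightarrow> (\<forall>i. fst p (k + i) \<in> B)"
  defines "P \<equiv> obs_measure S \<pi> (enat (Suc k)) m"
  shows "(\<Sum>i<n. \<integral>\<omega>. indicator (F \<inter> survive \<gamma> (k + i)) \<omega> * \<phi> (\<omega> (Suc (k + i))) \<partial>P)
    \<le> 2 * H * measure P F + c * (\<Sum>i<n. measure P (F \<inter> survive \<gamma> (k + i)))"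
proof -
  let ?J = "joint \<pi> (enat (Suc k)) m"
  interpret J: prob_space ?J by (rule prob_space_joint[OF m])
  define E where "E i = F \<inter> survive \<gamma> (k + i)" for i
  define d where "d a = (\<integral>y. \<phi> (a, y) \<partial>obs_law S m a)" for a
  have EF: "E i \<in> sets (obs_filtration S (enat (k + i)))" for i
  proof -
    have "F \<in> sets (obs_filtration S (enat (k + i)))"
      using subsetD[OF obs_filtration_facts(2) F, of "enat (k + i)"] by simp
    then show ?thesis unfolding E_def using survive_sets by blast
  qed
  have Eseq: "E i \<in> sets (obs_seq_space S)" for i by (rule sets_obs_filtration_full[OF EF])
  have Fseq: "F \<in> sets (obs_seq_space S)" by (rule sets_obs_filtration_full[OF F])
  have H0: "0 \<le> H" using order_trans[OF abs_ge_zero h] by blast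
  have Em: "(\<lambda>p. indicator (E i) (observe p) :: real) \<in> borel_measurable ?J" for i
    by (rule measurable_compose[OF measurable_observe]) (use Eseq in measurable)
  have Fm: "(\<lambda>p. indicator F (observe p) :: real) \<in> borel_measurable ?J"
    by (rule measurable_compose[OF measurable_observe]) (use Fseq in measurable)
  have wm: "(\<lambda>p. f (fst p t)) \<in> borel_measurable ?J" for f :: "'act list \<Rightarrow> real" and t
    unfolding joint_def
    by (rule measurable_compose[OF measurable_fst measurable_compose[OF measurable_window_coordinate]]) simp
  have bint: "integrable ?J (\<lambda>p. indicator (E i) (observe p) * f (fst p t))"
    if f: "\<And>w. \<bar>f w\<bar> \<le> M" for f :: "'act list \<Rightarrow> real" and i t M
  proof (rule J.integrable_const_bound[of _ M])
    have "0 \<le> M" using order_trans[OF abs_ge_zero f] by blast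
    then show "AE p in ?J. norm (indicator (E i) (observe p) * f (fst p t)) \<le> M"
      using f by (auto simp: indicator_def)
    show "(\<lambda>p. indicator (E i) (observe p) * f (fst p t)) \<in> borel_measurable ?J"
      using Em[of i] wm[of f t] by (rule borel_measurable_times)
  qed
  have step_le: "\<bar>step (snd \<pi>) h w\<bar> \<le> H" for w by (rule abs_step_le[OF h])
  have dbound: "\<bar>d a\<bar> \<le> Max (range (\<lambda>a. \<bar>d a\<bar>))" for a by (intro Max_ge) auto
  have int_d: "integrable ?J (\<lambda>p. indicator (E i) (observe p) * d (hd (fst p t)))" for i t
    by (rule bint[of "\<lambda>w. d (hd w)"]) (rule dbound)
  note int_h = bint[of h H, OF h] and int_s = bint[of "step (snd \<pi>) h" H, OF step_le]
  have prob: "(\<integral>p. indicator A (observe p) \<partial>?J) = measure P A" if "A \<in> sets (obs_seq_space S)" for A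
  proof -
    have "(\<integral>\<omega>. (indicator A \<omega> :: real) \<partial>P) = (\<integral>p. indicator A (observe p) \<partial>?J)"
      unfolding P_def obs_measure_eq_distr
      by (rule integral_distr[OF measurable_observe]) (use that in measurable)
    moreover have "A \<inter> space P = A" using sets.sets_into_space[OF that] by (auto simp: P_def)
    ultimately show ?thesis by simp
  qed
  have wald: "(\<integral>\<omega>. indicator (E i) \<omega> * \<phi> (\<omega> (Suc (k + i))) \<partial>P)
      = (\<integral>p. indicator (E i) (observe p) * d (hd (fst p (k + i))) \<partial>?J)" for i
  proof -
    have "(\<integral>\<omega>. indicator (E i) \<omega> * \<phi> (\<omega> (Suc (k + i))) \<partial>P)
        = (\<integral>\<omega>. indicator (E i) \<omega> * d (fst (\<omega> (Suc (k + i)))) \<partial>P)"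
      unfolding P_def d_def
      using integral_next_observation(2)[OF m, of "Suc (k + i)" "E i" \<phi> "enat (Suc k)" \<pi>] EF[of i] \<phi> int by simp
    also have "\<dots> = (\<integral>p. indicator (E i) (observe p) * d (fst (observe p (Suc (k + i)))) \<partial>?J)"
      unfolding P_def obs_measure_eq_distr
    proof (rule integral_distr[OF measurable_observe])
      have "(\<lambda>\<omega>. d (fst (\<omega> (Suc (k + i))))) \<in> borel_measurable (obs_seq_space S)"
        by (rule measurable_compose[OF measurable_observation_full measurable_compose[OF measurable_fst]]) simp_all
      then show "(\<lambda>\<omega>. indicator (E i) \<omega> * d (fst (\<omega> (Suc (k + i))))) \<in> borel_measurable (obs_seq_space S)"
        using Eseq by measurable
    qed
    finally show ?thesis by (simp add: observe_apply)
  qed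
  have "(\<Sum>i<n. \<integral>\<omega>. indicator (E i) \<omega> * \<phi> (\<omega> (Suc (k + i))) \<partial>P)
     \<le> (\<Sum>i<n. \<integral>p. indicator (E i) (observe p) * h (fst p (k + i)) - indicator (E i) (observe p) * step (snd \<pi>) h (fst p (k + i))
            + c * indicator (E i) (observe p) \<partial>?J)"
    unfolding wald
  proof (intro sum_mono integral_mono_AE)
    fix i
    show "integrable ?J (\<lambda>p. indicator (E i) (observe p) * d (hd (fst p (k + i))))" by (rule int_d)
    show "integrable ?J (\<lambda>p. indicator (E i) (observe p) * h (fst p (k + i)) - indicator (E i) (observe p) * step (snd \<pi>) h (fst p (k + i))
            + c * indicator (E i) (observe p))"
      using int_h int_s bint[of "\<lambda>_. 1" 1 i 0] by simp
    show "AE p in ?J. indicator (E i) (observe p) * d (hd (fst p (k + i)))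
       \<le> indicator (E i) (observe p) * h (fst p (k + i)) - indicator (E i) (observe p) * step (snd \<pi>) h (fst p (k + i))
            + c * indicator (E i) (observe p)"
      using B
    proof eventually_elim
      case (elim p)
      then show ?case using drift[of "fst p (k + i)"] by (auto simp: indicator_def E_def d_def)
    qed
  qed
  also have "\<dots> = (\<Sum>i<n. (\<integral>p. indicator (E i) (observe p) * (h (fst p (k + i)) - h (fst p (Suc (k + i)))) \<partial>?J)
      + c * measure P (E i))"
  proof (intro sum.cong refl)
    fix i
    have "(\<integral>p. indicator (E i) (observe p) * step (snd \<pi>) h (fst p (k + i)) \<partial>?J)
        = (\<integral>p. indicator (E i) (observe p) * h (fst p (Suc (k + i))) \<partial>?J)"
      by (rule integral_next_window[symmetric, OF m \<pi> EF h])
    moreover have "integrable ?J (\<lambda>p. indicator (E i) (observe p) :: real)" using bint[of "\<lambda>_. 1" 1 i 0] by simp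
    ultimately show "(\<integral>p. indicator (E i) (observe p) * h (fst p (k + i)) - indicator (E i) (observe p) * step (snd \<pi>) h (fst p (k + i))
            + c * indicator (E i) (observe p) \<partial>?J)
       = (\<integral>p. indicator (E i) (observe p) * (h (fst p (k + i)) - h (fst p (Suc (k + i)))) \<partial>?J) + c * measure P (E i)"
      by (simp add: int_h int_s right_diff_distrib prob[OF Eseq])
  qed
  also have "\<dots> = (\<integral>p. (\<Sum>i<n. indicator (E i) (observe p) * (h (fst p (k + i)) - h (fst p (Suc (k + i))))) \<partial>?J)
      + c * (\<Sum>i<n. measure P (E i))"
  proof -
    have "(\<integral>p. (\<Sum>i<n. indicator (E i) (observe p) * (h (fst p (k + i)) - h (fst p (Suc (k + i))))) \<partial>?J)
       = (\<Sum>i<n. \<integral>p. indicator (E i) (observe p) * (h (fst p (k + i)) - h (fst p (Suc (k + i)))) \<partial>?J)"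
      by (rule Bochner_Integration.integral_sum) (simp add: right_diff_distrib int_h)
    then show ?thesis by (simp add: sum.distrib sum_distrib_left)
  qed
  also have "(\<integral>p. (\<Sum>i<n. indicator (E i) (observe p) * (h (fst p (k + i)) - h (fst p (Suc (k + i))))) \<partial>?J)
     \<le> (\<integral>p. indicator F (observe p) * (2 * H) \<partial>?J)"
  proof (rule integral_mono)
    show "integrable ?J (\<lambda>p. \<Sum>i<n. indicator (E i) (observe p) * (h (fst p (k + i)) - h (fst p (Suc (k + i)))))"
      by (rule Bochner_Integration.integrable_sum) (simp add: right_diff_distrib int_h)
    show "integrable ?J (\<lambda>p. indicator F (observe p) * (2 * H))"
      by (rule J.integrable_const_bound[of _ "2 * H"]) (use Fm H0 in \<open>auto simp: indicator_def\<close>)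
    fix p
    have "(\<Sum>i<n. indicator (E i) (observe p) * (h (fst p (k + i)) - h (fst p (Suc (k + i)))))
        = (\<Sum>i<n. of_bool (observe p \<in> E i) * (h (fst p (k + i)) - h (fst p (k + Suc i))))"
      by (intro sum.cong refl) (simp add: indicator_def)
    also have "\<dots> \<le> of_bool (observe p \<in> F) * (2 * H)"
    proof (rule abs_le_D1, rule abs_telescope_le)
      show "observe p \<in> E i" if "observe p \<in> E (Suc i)" for i
        using that survive_antimono[of "k + i" "k + Suc i" \<gamma>] by (auto simp: E_def)
    qed (use h in \<open>auto simp: E_def\<close>)
    finally show "(\<Sum>i<n. indicator (E i) (observe p) * (h (fst p (k + i)) - h (fst p (Suc (k + i)))))
        \<le> indicator F (observe p) * (2 * H)"
      by (simp add: indicator_def)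
  qed
  also have "(\<integral>p. indicator F (observe p) * (2 * H) \<partial>?J) = 2 * H * measure P F"
    by (simp add: prob[OF Fseq])
  finally show ?thesis unfolding E_def by simp
qed

end

text \<open>The potential of a Poisson inequality matters only on a closed class, so outside of the class
  it may be set to \<open>0\<close> to make it bounded.\<close>

lemma bounded_on_closed:
  fixes h :: "'b \<Rightarrow> real"
  assumes A: "finite A" "\<And>v. v \<in> A \<Longrightarrow> set_pmf (T v) \<subseteq> A"
  shows "\<exists>h' H. (\<forall>v. \<bar>h' v\<bar> \<le> H) \<and> (\<forall>v\<in>A. h' v = h v \<and> step T h' v = step T h v)"
proof (intro exI conjI allI ballI)
  let ?h = "\<lambda>v. if v \<in> A then h v else 0"
  show "\<bar>?h v\<bar> \<le> (\<Sum>v\<in>A. \<bar>h v\<bar>)" for v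
    using member_le_sum[of v A "\<lambda>v. \<bar>h v\<bar>"] A(1) by (auto intro: sum_nonneg)
  show "?h v = h v" if "v \<in> A" for v using that by simp
  show "step T ?h v = step T h v" if "v \<in> A" for v
    unfolding step_def by (intro integral_cong_AE AE_pmfI) (use A(2)[OF that] in auto)
qed

lemma integrable_indicator_prob:
  assumes "prob_space M" "A \<in> sets M"
  shows "integrable M (\<lambda>x. indicator A x :: real)"
proof -
  interpret prob_space M by fact
  show ?thesis using assms(2) by (intro integrable_real_indicator) (simp_all add: less_top[symmetric])
qed

lemma sum_lessThan_add: "(\<Sum>t<k + n. f t) = (\<Sum>t<k. f t) + (\<Sum>i<n. f (k + i))"
  for f :: "nat \<Rightarrow> 'b :: comm_monoid_add"
  by (induction n) (simp_all add: add.assoc)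

lemma real_suminf_ennreal_le:
  assumes "\<And>n. (\<Sum>i<n. f i) \<le> c" "\<And>i. 0 \<le> f i"
  shows "(\<Sum>i. ennreal (f i)) \<le> ennreal c"
  unfolding suminf_eq_SUP using assms by (intro SUP_least) (simp add: sum_ennreal ennreal_leI)

lemma real_sum_le_suminf_ennreal:
  assumes "(\<Sum>i. ennreal (f i)) \<le> ennreal c" "\<And>i. 0 \<le> f i" "0 \<le> c"
  shows "(\<Sum>i<n. f i) \<le> c"
proof -
  have "ennreal (\<Sum>i<n. f i) = (\<Sum>i<n. ennreal (f i))" using assms(2) by (simp add: sum_ennreal)
  also have "\<dots> \<le> (\<Sum>i. ennreal (f i))" unfolding suminf_eq_SUP by (rule SUP_upper) simp
  also have "\<dots> \<le> ennreal c" by (rule assms(1))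
  finally show ?thesis using assms(3) by (simp add: ennreal_le_iff)
qed

context detection_model
begin

lemma AE_joint_windows:
  assumes m: "m \<le> num_hyp S" and "AE w in window_measure \<pi>. Q w"
  shows "AE p in joint \<pi> \<nu> m. Q (fst p)"
proof -
  interpret X: prob_space "signal_seq \<nu> m" by (rule prob_space_signal_seq[OF m])
  have eq: "distr (joint \<pi> \<nu> m) (window_measure \<pi>) fst = window_measure \<pi>"
    unfolding joint_def by (rule X.distr_pair_fst)
  have fst: "fst \<in> joint \<pi> \<nu> m \<rightarrow>\<^sub>M window_measure \<pi>" unfolding joint_def by (rule measurable_fst)
  show ?thesis
    by (rule AE_distrD[OF fst]) (unfold eq, rule assms(2))
qed

lemma AE_windows_stay:
  assumes m: "m \<le> num_hyp S" and cl: "\<And>v. v \<in> B \<Longrightarrow> set_pmf (snd \<pi> v) \<subseteq> B"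
  shows "AE p in joint \<pi> \<nu> m. \<forall>k i. fst p k \<in> B \<longrightarrow> fst p (k + i) \<in> B"
proof (rule AE_joint_windows[OF m])
  show "AE w in window_measure \<pi>. \<forall>k i. w k \<in> B \<longrightarrow> w (k + i) \<in> B"
    using AE_window_transitions[of \<pi>]
  proof eventually_elim
    case (elim w)
    have "w (k + i) \<in> B" if "w k \<in> B" for k i
      using that by (induction i) (use elim cl in auto)
    then show ?case by blast
  qed
qed

lemma regular_llr:
  assumes reg: "regular_obs \<nu> m \<omega>" and t: "1 \<le> t" "\<nu> \<le> enat t"
  shows "llr S m (\<omega> t) = ereal (log_ratio m (\<omega> t))" "0 < ratio 0 m (\<omega> t)"
    "log_ratio m (\<omega> t) = - ln (ratio 0 m (\<omega> t))"
proof -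
  have "0 < obs_pdf S 0 (fst (\<omega> t)) (snd (\<omega> t))" "0 < obs_pdf S m (fst (\<omega> t)) (snd (\<omega> t))"
    using assms unfolding regular_obs_def by auto
  then show "llr S m (\<omega> t) = ereal (log_ratio m (\<omega> t))" "0 < ratio 0 m (\<omega> t)"
    "log_ratio m (\<omega> t) = - ln (ratio 0 m (\<omega> t))"
    by (auto simp: llr_def log_ratio_def ratio_def split_beta' ln_div)
qed

lemma cusum_nonneg: "0 \<le> cusum S m t \<omega>"
  by (cases t) simp_all

section \<open>Upper bound on the delay\<close>

lemma cusum_ge_sum:
  assumes "regular_obs (enat (Suc k)) m \<omega>"
  shows "ereal (\<Sum>i<n. log_ratio m (\<omega> (Suc (k + i)))) \<le> cusum S m (k + n) \<omega>"
proof (induction n)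
  case 0
  show ?case using cusum_nonneg[of m k \<omega>] by (simp add: zero_ereal_def)
next
  case (Suc n)
  have "llr S m (\<omega> (Suc (k + n))) = ereal (log_ratio m (\<omega> (Suc (k + n))))"
    by (rule regular_llr[OF assms]) simp_all
  then have "ereal (\<Sum>i<Suc n. log_ratio m (\<omega> (Suc (k + i))))
      = ereal (\<Sum>i<n. log_ratio m (\<omega> (Suc (k + i)))) + llr S m (\<omega> (Suc (k + n)))" by simp
  also have "\<dots> \<le> cusum S m (k + n) \<omega> + llr S m (\<omega> (Suc (k + n)))" by (rule add_right_mono[OF Suc])
  also have "\<dots> \<le> cusum S m (k + Suc n) \<omega>" by simp
  finally show ?case .
qed

text \<open>Before the alarm the sum of the log-likelihood ratios since the change lies below the CuSum
  statistic and hence below the threshold. Only the last summand is not controlled in this way; the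
  truncation at \<open>K\<close> bounds this overshoot.\<close>

lemma truncated_sum_le:
  assumes reg: "regular_obs (enat (Suc k)) m \<omega>" and m: "m \<in> {1..num_hyp S}"
    and \<gamma>: "1 \<le> \<gamma>" and K: "0 \<le> K"
  shows "(\<Sum>i<n. indicator (survive \<gamma> (k + i)) \<omega> * min (log_ratio m (\<omega> (Suc (k + i)))) K)
    \<le> ln (threshold \<gamma>) + K"
proof (induction n)
  case 0
  show ?case using threshold_ge_1[OF \<gamma>] K by (simp add: ln_ge_zero)
next
  case (Suc n)
  show ?case
  proof (cases "\<omega> \<in> survive \<gamma> (k + n)")
    case True
    have "\<omega> \<in> survive \<gamma> (k + i)" if "i \<le> n" for i
      using True survive_antimono[of "k + i" "k + n" \<gamma>] that by auto
    then have "(\<Sum>i<Suc n. indicator (survive \<gamma> (k + i)) \<omega> * min (log_ratio m (\<omega> (Suc (k + i)))) K)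
       = (\<Sum>i<n. min (log_ratio m (\<omega> (Suc (k + i)))) K) + min (log_ratio m (\<omega> (Suc (k + n)))) K"
      by simp
    also have "\<dots> \<le> (\<Sum>i<n. log_ratio m (\<omega> (Suc (k + i)))) + K"
      by (intro add_mono sum_mono) simp_all
    also have "(\<Sum>i<n. log_ratio m (\<omega> (Suc (k + i)))) \<le> ln (threshold \<gamma>)"
    proof -
      have "ereal (\<Sum>i<n. log_ratio m (\<omega> (Suc (k + i)))) \<le> cusum S m (k + n) \<omega>" by (rule cusum_ge_sum[OF reg])
      also have "\<dots> \<le> ereal (ln (threshold \<gamma>))"
        by (rule cusum_le_threshold) (use True m in \<open>auto simp: survive_def\<close>)
      finally show ?thesis by simp
    qed
    finally show ?thesis by simp
  next
    case False
    then show ?thesis using Suc by simp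
  qed
qed

text \<open>Dominated convergence; finitely many actions share one truncation.\<close>

lemma truncated_kl:
  assumes m: "m \<in> {1..num_hyp S}" and \<delta>: "0 < \<delta>"
  obtains K where "0 \<le> K" "\<And>a. kl m a - \<delta> \<le> (\<integral>y. min (log_ratio m (a, y)) K \<partial>obs_law S m a)"
proof -
  have m': "m \<le> num_hyp S" using m by simp
  have lim: "(\<lambda>n. \<integral>y. min (log_ratio m (a, y)) (real n) \<partial>obs_law S m a) \<longlonglongrightarrow> kl m a" for a
    unfolding kl_def
  proof (rule integral_dominated_convergence[where w = "\<lambda>y. \<bar>log_ratio m (a, y)\<bar>"])
    have meas: "(\<lambda>y. log_ratio m (a, y)) \<in> borel_measurable (obs_law S m a)"
      by (rule measurable_section[OF measurable_log_ratio[OF m']])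
    then show "(\<lambda>y. log_ratio m (a, y)) \<in> borel_measurable (obs_law S m a)"
      "(\<lambda>y. min (log_ratio m (a, y)) (real n)) \<in> borel_measurable (obs_law S m a)" for n
      by measurable
    show "integrable (obs_law S m a) (\<lambda>y. \<bar>log_ratio m (a, y)\<bar>)" using integrable_log_ratio[OF m] by simp
    show "AE y in obs_law S m a. (\<lambda>n. min (log_ratio m (a, y)) (real n)) \<longlonglongrightarrow> log_ratio m (a, y)"
    proof (intro AE_I2 tendsto_eventually)
      fix y
      obtain n0 where "log_ratio m (a, y) \<le> real n0" using real_arch_simple by blast
      then show "\<forall>\<^sub>F n in sequentially. min (log_ratio m (a, y)) (real n) = log_ratio m (a, y)"
        unfolding eventually_sequentially by (intro exI[of _ n0]) auto
    qed
    show "AE y in obs_law S m a. norm (min (log_ratio m (a, y)) (real n)) \<le> \<bar>log_ratio m (a, y)\<bar>" for n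
      by (intro AE_I2) auto
  qed
  have "\<forall>\<^sub>F n in sequentially. \<forall>a\<in>UNIV. kl m a - \<delta> < (\<integral>y. min (log_ratio m (a, y)) (real n) \<partial>obs_law S m a)"
    by (intro eventually_ball_finite ballI order_tendstoD(1)[OF lim]) (use \<delta> in auto)
  then obtain n where "\<forall>a. kl m a - \<delta> < (\<integral>y. min (log_ratio m (a, y)) (real n) \<partial>obs_law S m a)"
    by (auto simp: eventually_sequentially)
  then show thesis by (intro that[of "real n"]) (auto intro: less_imp_le)
qed

text \<open>The truncated log-likelihood ratios collected until the alarm sum up to at most \<open>ln (M \<gamma>) + K\<close>,
  while on average each step of the delay contributes \<open>c - \<delta>\<close>, up to the bounded boundary term of
  the Poisson inequality.\<close>

lemma WADD_hyp_le:
  assumes m: "m \<in> {1..num_hyp S}" and \<pi>: "open_loop_policy W \<pi>" "W \<ge> 1"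
    and A: "finite A" "set_pmf (fst \<pi>) \<subseteq> A" "\<And>v. v \<in> A \<Longrightarrow> set_pmf (snd \<pi> v) \<subseteq> A"
    and h: "\<And>v. v \<in> A \<Longrightarrow> h v - step (snd \<pi>) h v + c \<le> kl m (hd v)"
    and \<delta>: "0 < \<delta>" "\<delta> < c"
  shows "\<exists>C\<ge>0. \<forall>\<gamma>\<ge>1. WADD_hyp S m (glr_cusum S \<gamma>) \<pi> \<le> ennreal ((ln (threshold \<gamma>) + C) / (c - \<delta>))"
proof -
  have m': "m \<le> num_hyp S" using m by simp
  obtain K where K: "0 \<le> K" "\<And>a. kl m a - \<delta> \<le> (\<integral>y. min (log_ratio m (a, y)) K \<partial>obs_law S m a)"
    using truncated_kl[OF m \<delta>(1)] by blast
  have "\<exists>h' H. (\<forall>v. \<bar>h' v\<bar> \<le> H) \<and> (\<forall>v\<in>A. h' v = h v \<and> step (snd \<pi>) h' v = step (snd \<pi>) h v)"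
    by (rule bounded_on_closed[OF A(1)]) (rule A(3))
  then obtain h' H where h': "\<And>v. \<bar>h' v\<bar> \<le> H" "\<And>v. v \<in> A \<Longrightarrow> h' v = h v"
    "\<And>v. v \<in> A \<Longrightarrow> step (snd \<pi>) h' v = step (snd \<pi>) h v"
    by blast
  have H0: "0 \<le> H" using order_trans[OF abs_ge_zero h'(1)] by blast
  (* K bounds the overshoot, 2 * H the boundary term of the Poisson inequality. *)
  define C where "C = K + 2 * H"
  define \<phi> where "\<phi> z = min (log_ratio m z) K" for z
  have \<phi>m: "\<phi> \<in> borel_measurable obs_pair_space"
    unfolding \<phi>_def[abs_def] using measurable_log_ratio[OF m'] by measurable
  have \<phi>i: "integrable (obs_law S m a) (\<lambda>y. \<phi> (a, y))" for a
  proof -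
    interpret prob_space "obs_law S m a" by (rule prob_space_obs_law[OF m'])
    show ?thesis unfolding \<phi>_def using integrable_log_ratio[OF m] by auto
  qed
  have "WADD_hyp S m (glr_cusum S \<gamma>) \<pi> \<le> ennreal ((ln (threshold \<gamma>) + C) / (c - \<delta>))" if \<gamma>: "1 \<le> \<gamma>" for \<gamma>
  proof (rule WADD_hyp_upper[OF m' stopping_time_glr_cusum[OF model]])
    fix k F assume F: "F \<in> sets (obs_filtration S (enat k))"
    let ?P = "obs_measure S \<pi> (enat (Suc k)) m"
    interpret P: prob_space ?P by (rule prob_space_obs_measure[OF model m'])
    have Fs: "F \<in> sets (obs_seq_space S)" by (rule sets_obs_filtration_full[OF F])
    have EF: "F \<inter> survive \<gamma> (k + i) \<in> sets (obs_filtration S (enat (k + i)))" for i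
      using subsetD[OF obs_filtration_facts(2) F, of "enat (k + i)"] survive_sets[of \<gamma> "k + i"] by auto
    have int: "integrable ?P (\<lambda>\<omega>. indicator (F \<inter> survive \<gamma> (k + i)) \<omega> * \<phi> (\<omega> (Suc (k + i))))" for i
      using integral_next_observation(1)[OF m', of "Suc (k + i)" "F \<inter> survive \<gamma> (k + i)" \<phi> "enat (Suc k)" \<pi>] EF[of i] \<phi>m \<phi>i
      by simp
    have AEA: "AE p in joint \<pi> (enat (Suc k)) m. observe p \<in> F \<longrightarrow> (\<forall>i. fst p (k + i) \<in> A)"
    proof -
      have "AE w in window_measure \<pi>. w 0 \<in> A"
        using AE_window_transitions[of \<pi>] by eventually_elim (use A(2) in blast)
      then have start: "AE p in joint \<pi> (enat (Suc k)) m. fst p 0 \<in> A" by (rule AE_joint_windows[OF m'])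
      have stay: "AE p in joint \<pi> (enat (Suc k)) m. \<forall>k i. fst p k \<in> A \<longrightarrow> fst p (k + i) \<in> A"
        by (rule AE_windows_stay[OF m']) (rule A(3))
      show ?thesis
        using start stay
      proof eventually_elim
        case (elim p)
        have "fst p (k + i) \<in> A" for i
          using elim(2)[rule_format, OF elim(1), of "k + i"] by simp
        then show ?case by blast
      qed
    qed
    have up: "(\<Sum>i<n. \<integral>\<omega>. indicator (F \<inter> survive \<gamma> (k + i)) \<omega> * \<phi> (\<omega> (Suc (k + i))) \<partial>?P)
       \<le> (ln (threshold \<gamma>) + K) * measure ?P F" for n
    proof -
      have "(\<Sum>i<n. \<integral>\<omega>. indicator (F \<inter> survive \<gamma> (k + i)) \<omega> * \<phi> (\<omega> (Suc (k + i))) \<partial>?P)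
        = (\<integral>\<omega>. (\<Sum>i<n. indicator (F \<inter> survive \<gamma> (k + i)) \<omega> * \<phi> (\<omega> (Suc (k + i)))) \<partial>?P)"
        by (rule Bochner_Integration.integral_sum[symmetric]) (rule int)
      also have "\<dots> \<le> (\<integral>\<omega>. (ln (threshold \<gamma>) + K) * indicator F \<omega> \<partial>?P)"
      proof (rule integral_mono_AE)
        show "integrable ?P (\<lambda>\<omega>. \<Sum>i<n. indicator (F \<inter> survive \<gamma> (k + i)) \<omega> * \<phi> (\<omega> (Suc (k + i))))"
          by (rule Bochner_Integration.integrable_sum) (rule int)
        show "integrable ?P (\<lambda>\<omega>. (ln (threshold \<gamma>) + K) * indicator F \<omega>)"
          by (rule integrable_mult_right, rule integrable_indicator_prob[OF P.prob_space_axioms]) (simp add: Fs)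
        show "AE \<omega> in ?P. (\<Sum>i<n. indicator (F \<inter> survive \<gamma> (k + i)) \<omega> * \<phi> (\<omega> (Suc (k + i))))
            \<le> (ln (threshold \<gamma>) + K) * indicator F \<omega>"
          using AE_regular_obs[OF m', of "enat (Suc k)" \<pi>]
        proof eventually_elim
          case (elim \<omega>)
          have "(\<Sum>i<n. indicator (F \<inter> survive \<gamma> (k + i)) \<omega> * \<phi> (\<omega> (Suc (k + i))))
             = indicator F \<omega> * (\<Sum>i<n. indicator (survive \<gamma> (k + i)) \<omega> * min (log_ratio m (\<omega> (Suc (k + i)))) K)"
            unfolding sum_distrib_left by (intro sum.cong refl) (simp add: indicator_def \<phi>_def)
          also have "\<dots> \<le> indicator F \<omega> * (ln (threshold \<gamma>) + K)"
            by (intro mult_left_mono truncated_sum_le[OF elim m \<gamma> K(1)]) simp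
          finally show ?case by (simp add: mult.commute)
        qed
      qed
      also have "\<dots> = (ln (threshold \<gamma>) + K) * measure ?P F"
        using sets.sets_into_space[OF Fs] by (simp add: Int_absorb2)
      finally show ?thesis .
    qed
    have "(\<Sum>i<n. measure ?P (F \<inter> survive \<gamma> (k + i))) \<le> (ln (threshold \<gamma>) + C) / (c - \<delta>) * measure ?P F" for n
    proof -
      have "(\<Sum>i<n. \<integral>\<omega>. indicator (F \<inter> survive \<gamma> (k + i)) \<omega> * - \<phi> (\<omega> (Suc (k + i))) \<partial>?P)
        \<le> 2 * H * measure ?P F + - (c - \<delta>) * (\<Sum>i<n. measure ?P (F \<inter> survive \<gamma> (k + i)))"
      proof (rule wald_poisson_le[OF m' \<pi> F, of "\<lambda>z. - \<phi> z" "\<lambda>v. - h' v" H A])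
        show "(\<integral>y. - \<phi> (hd w, y) \<partial>obs_law S m (hd w)) \<le> - h' w - step (snd \<pi>) (\<lambda>v. - h' v) w + - (c - \<delta>)" if "w \<in> A" for w
          using K(2)[of "hd w"] h[OF that] h'(2,3)[OF that] by (simp add: step_uminus \<phi>_def)
        show "integrable (obs_law S m a) (\<lambda>y. - \<phi> (a, y))" for a using \<phi>i by simp
        show "(\<lambda>z. - \<phi> z) \<in> borel_measurable obs_pair_space" using \<phi>m by measurable
      qed (use h'(1) AEA in simp_all)
      then have "(c - \<delta>) * (\<Sum>i<n. measure ?P (F \<inter> survive \<gamma> (k + i)))
         \<le> 2 * H * measure ?P F + (\<Sum>i<n. \<integral>\<omega>. indicator (F \<inter> survive \<gamma> (k + i)) \<omega> * \<phi> (\<omega> (Suc (k + i))) \<partial>?P)"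
        by (simp add: sum_negf algebra_simps)
      also have "\<dots> \<le> 2 * H * measure ?P F + (ln (threshold \<gamma>) + K) * measure ?P F"
        by (intro add_left_mono up)
      also have "\<dots> = (ln (threshold \<gamma>) + C) * measure ?P F" by (simp add: C_def algebra_simps)
      finally show ?thesis using \<delta>(2) by (simp add: field_simps)
    qed
    then have "(\<Sum>i. ennreal (measure ?P (F \<inter> survive \<gamma> (k + i)))) \<le> ennreal ((ln (threshold \<gamma>) + C) / (c - \<delta>) * measure ?P F)"
      by (rule real_suminf_ennreal_le) simp
    also have "\<dots> = ennreal ((ln (threshold \<gamma>) + C) / (c - \<delta>)) * emeasure ?P F"
      using threshold_ge_1[OF \<gamma>] K(1) H0 \<delta>(2)
      by (subst ennreal_mult) (auto simp: P.emeasure_eq_measure C_def ln_ge_zero)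
    finally show "(\<integral>\<^sup>+\<omega>. indicator F \<omega> * delay (glr_cusum S \<gamma>) k \<omega> \<partial>?P)
       \<le> ennreal ((ln (threshold \<gamma>) + C) / (c - \<delta>)) * emeasure ?P F"
      unfolding delay_integral[OF m' Fs] .
  qed
  moreover have "0 \<le> C" using K(1) H0 by (simp add: C_def)
  ultimately show ?thesis by blast
qed

section \<open>Lower bound on the delay\<close>

text \<open>The bound on weighted crossings for alarms after time \<open>k\<close> on an event \<open>F\<close> that is decided only at
  time \<open>k\<close>. Up to then all paths have to be followed, which costs a weight of at most \<open>k\<close>.\<close>

lemma crossing_mass:
  fixes \<pi> :: "'act policy" and k m :: nat
  assumes m: "m \<le> num_hyp S" and F: "F \<in> sets (obs_filtration S (enat k))"
    and J: "finite J" "\<And>j. j \<in> J \<Longrightarrow> j \<le> num_hyp S" and \<gamma>: "1 \<le> \<gamma>"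
  defines "P \<equiv> obs_measure S \<pi> (enat (Suc k)) m"
  assumes cross: "\<And>i. AE \<omega> in P. \<omega> \<in> F \<inter> (survive \<gamma> (k + i) - survive \<gamma> (Suc (k + i))) \<longrightarrow>
        (\<exists>j\<in>J. cusum S j (Suc (k + i)) \<omega> > ereal (ln (threshold \<gamma>)))"
  shows "ennreal (threshold \<gamma>) * (\<Sum>i<n. \<integral>\<^sup>+\<omega>. indicator (F \<inter> (survive \<gamma> (k + i) - survive \<gamma> (Suc (k + i)))) \<omega>
            * ennreal (inv_likelihood (enat (Suc k)) m (Suc (k + i)) \<omega>) \<partial>P)
    \<le> of_nat (card J) * (of_nat k + (\<Sum>i<n. \<integral>\<^sup>+\<omega>. indicator (F \<inter> survive \<gamma> (k + i)) \<omega>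
            * ennreal (inv_likelihood (enat (Suc k)) m (k + i) \<omega>) \<partial>P))"
proof -
  (* Before time k all paths without alarm are followed, from then on only those in F. *)
  define E where "E t = (if t < k then survive \<gamma> t else F \<inter> survive \<gamma> t)" for t
  define X where "X t = (if t < k then {} else F \<inter> (survive \<gamma> t - survive \<gamma> (Suc t)))" for t
  let ?Q = "inv_likelihood (enat (Suc k)) m"
  have Fk: "F \<in> sets (obs_filtration S (enat t))" if "k \<le> t" for t
    using subsetD[OF obs_filtration_facts(2) F, of "enat t"] that by simp
  have Fs: "F \<in> sets (obs_seq_space S)" by (rule sets_obs_filtration_full[OF F])
  have ss: "survive \<gamma> t \<in> sets (obs_seq_space S)" for t by (rule sets_obs_filtration_full[OF survive_sets])
  have main: "ennreal (threshold \<gamma>) * (\<Sum>t<k + n. \<integral>\<^sup>+\<omega>. indicator (X t) \<omega> * ennreal (?Q (Suc t) \<omega>) \<partial>P)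
    \<le> of_nat (card J) * (\<Sum>t<k + n. \<integral>\<^sup>+\<omega>. indicator (E t) \<omega> * ennreal (?Q t \<omega>) \<partial>P)"
    unfolding P_def
  proof (rule false_alarm_bound[OF m J threshold_ge_1[OF \<gamma>]])
    show "E t \<in> sets (obs_filtration S (enat t))" for t
      using survive_sets[of \<gamma> t] Fk[of t] by (auto simp: E_def)
    show "E (Suc t) \<subseteq> E t" for t using survive_antimono[of t "Suc t" \<gamma>] by (auto simp: E_def)
    show "X t \<subseteq> E t - E (Suc t)" for t by (auto simp: E_def X_def)
    show "X t \<in> sets (obs_seq_space S)" for t using Fs ss by (auto simp: X_def)
    show "AE \<omega> in obs_measure S \<pi> (enat (Suc k)) m. \<omega> \<in> X t \<longrightarrow> (\<exists>j\<in>J. cusum S j (Suc t) \<omega> > ereal (ln (threshold \<gamma>)))" for t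
    proof (cases "t < k")
      case False
      then show ?thesis using cross[of "t - k", unfolded P_def] by (simp add: X_def del: cusum.simps)
    qed (simp add: X_def)
  qed
  have "(\<Sum>t<k. \<integral>\<^sup>+\<omega>. indicator (E t) \<omega> * ennreal (?Q t \<omega>) \<partial>P) \<le> (\<Sum>t<k. 1)"
  proof (rule sum_mono)
    fix t
    have "(\<integral>\<^sup>+\<omega>. indicator (E t) \<omega> * ennreal (?Q t \<omega>) \<partial>P) \<le> (\<integral>\<^sup>+\<omega>. ennreal (?Q t \<omega>) \<partial>P)"
      by (intro nn_integral_mono) (simp add: indicator_def)
    also have "\<dots> \<le> 1" unfolding P_def by (rule nn_integral_inv_likelihood_le_1[OF m])
    finally show "(\<integral>\<^sup>+\<omega>. indicator (E t) \<omega> * ennreal (?Q t \<omega>) \<partial>P) \<le> 1" .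
  qed
  then have early: "(\<Sum>t<k. \<integral>\<^sup>+\<omega>. indicator (E t) \<omega> * ennreal (?Q t \<omega>) \<partial>P) \<le> of_nat k" by simp
  have "ennreal (threshold \<gamma>) * (\<Sum>i<n. \<integral>\<^sup>+\<omega>. indicator (X (k + i)) \<omega> * ennreal (?Q (Suc (k + i)) \<omega>) \<partial>P)
     \<le> ennreal (threshold \<gamma>) * (\<Sum>t<k + n. \<integral>\<^sup>+\<omega>. indicator (X t) \<omega> * ennreal (?Q (Suc t) \<omega>) \<partial>P)"
    unfolding sum_lessThan_add by (intro mult_left_mono) simp_all
  also have "\<dots> \<le> of_nat (card J) * (of_nat k + (\<Sum>i<n. \<integral>\<^sup>+\<omega>. indicator (E (k + i)) \<omega> * ennreal (?Q (k + i) \<omega>) \<partial>P))"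
    by (rule order_trans[OF main]) (unfold sum_lessThan_add, intro mult_left_mono add_right_mono early, simp)
  finally show ?thesis by (simp add: E_def X_def del: inv_likelihood.simps)
qed

text \<open>Most of \<open>F\<close> is alarmed between \<open>k\<close> and \<open>k + n\<close>: few alarms occur before time \<open>k\<close>, and by Markov's
  inequality few delays exceed \<open>n\<close>.\<close>

lemma delay_facts:
  fixes \<pi> :: "'act policy" and k m :: nat
  assumes m: "m \<le> num_hyp S" and F: "F \<in> sets (obs_filtration S (enat k))" and \<gamma>: "1 \<le> \<gamma>"
    and V: "WADD_hyp S m (glr_cusum S \<gamma>) \<pi> \<le> ennreal V" "0 \<le> V" and n: "0 < n"
  defines "P \<equiv> obs_measure S \<pi> (enat (Suc k)) m"
  shows "(\<Sum>i<n. measure P (F \<inter> survive \<gamma> (k + i))) \<le> V * measure P F"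
    and "measure P F - real k / \<gamma> - V * measure P F / real n
      \<le> measure P (F \<inter> survive \<gamma> k) - measure P (F \<inter> survive \<gamma> (k + n))"
proof -
  interpret P: prob_space P unfolding P_def by (rule prob_space_obs_measure[OF model m])
  have Fs: "F \<in> sets (obs_seq_space S)" by (rule sets_obs_filtration_full[OF F])
  have FP: "F \<in> sets P" using Fs by (simp add: P_def)
  have sP: "survive \<gamma> t \<in> sets P" for t unfolding P_def by (rule survive_in_obs)
  have "(\<Sum>i. ennreal (measure P (F \<inter> survive \<gamma> (k + i)))) \<le> WADD_hyp S m (glr_cusum S \<gamma>) \<pi> * emeasure P F"
    using WADD_hyp_lower[OF m stopping_time_glr_cusum[OF model, of \<gamma>] F, of \<pi>]
    unfolding P_def delay_integral[OF m Fs] .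
  also have "\<dots> \<le> ennreal V * emeasure P F" by (intro mult_right_mono V) simp
  also have "\<dots> = ennreal (V * measure P F)" using V(2) by (simp add: P.emeasure_eq_measure ennreal_mult)
  finally show N: "(\<Sum>i<n. measure P (F \<inter> survive \<gamma> (k + i))) \<le> V * measure P F" for n
    by (rule real_sum_le_suminf_ennreal) (use V(2) in auto)
  have "real n * measure P (F \<inter> survive \<gamma> (k + n)) = (\<Sum>i<n. measure P (F \<inter> survive \<gamma> (k + n)))" by simp
  also have "\<dots> \<le> (\<Sum>i<n. measure P (F \<inter> survive \<gamma> (k + i)))"
  proof (rule sum_mono)
    fix i assume "i \<in> {..<n}"
    then show "measure P (F \<inter> survive \<gamma> (k + n)) \<le> measure P (F \<inter> survive \<gamma> (k + i))"
      using survive_antimono[of "k + i" "k + n" \<gamma>] FP sP by (intro P.finite_measure_mono) auto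
  qed
  also have "\<dots> \<le> V * measure P F" by (rule N)
  finally have "measure P (F \<inter> survive \<gamma> (k + n)) \<le> V * measure P F / real n" using n by (simp add: field_simps)
  moreover have "measure P F - real k / \<gamma> \<le> measure P (F \<inter> survive \<gamma> k)"
  proof -
    have "\<gamma> * (1 - measure P (survive \<gamma> k)) \<le> (\<Sum>t<k. measure P (survive \<gamma> t))"
      unfolding P_def by (rule early_alarm[OF m \<gamma>]) simp
    also have "\<dots> \<le> (\<Sum>t<k. 1)" by (intro sum_mono) simp
    finally have "1 - measure P (survive \<gamma> k) \<le> real k / \<gamma>" using \<gamma> by (simp add: field_simps)
    moreover have "measure P F - measure P (F \<inter> survive \<gamma> k) = measure P (F - survive \<gamma> k)"
      using P.finite_measure_Diff'[OF FP sP] by simp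
    moreover have "measure P (F - survive \<gamma> k) \<le> measure P (space P - survive \<gamma> k)"
      using sets.sets_into_space[OF FP] FP sP by (intro P.finite_measure_mono) auto
    moreover have "measure P (space P - survive \<gamma> k) = 1 - measure P (survive \<gamma> k)" by (rule P.prob_compl[OF sP])
    ultimately show ?thesis by linarith
  qed
  ultimately show "measure P F - real k / \<gamma> - V * measure P F / real n
      \<le> measure P (F \<inter> survive \<gamma> k) - measure P (F \<inter> survive \<gamma> (k + n))" by linarith
qed

lemma ln_inv_likelihood:
  assumes "regular_obs (enat (Suc k)) m \<omega>"
  shows "0 < inv_likelihood (enat (Suc k)) m (k + n) \<omega> \<and>
    (\<Sum>i<n. log_ratio m (\<omega> (Suc (k + i)))) = - ln (inv_likelihood (enat (Suc k)) m (k + n) \<omega>)"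
proof (induction n)
  case 0
  have "inv_likelihood (enat (Suc k)) m k \<omega> = 1" by (rule inv_likelihood_before) simp
  then show ?case by simp
next
  case (Suc n)
  have r: "0 < ratio 0 m (\<omega> (Suc (k + n)))" "log_ratio m (\<omega> (Suc (k + n))) = - ln (ratio 0 m (\<omega> (Suc (k + n))))"
    by (rule regular_llr[OF assms]; simp)+
  then show ?case using Suc by (simp add: ln_mult)
qed

text \<open>If \<open>q\<close> denotes the inverse likelihood, the accumulated log-likelihood ratio is \<open>- ln q\<close>. At the
  alarm it is bounded from below by the tangent inequality \<open>- ln q \<ge> L - e\<^sup>L q\<close>, and on paths that have
  not been stopped after \<open>n\<close> steps by \<open>- ln q \<ge> - q\<close>. Both bounds are affine in \<open>q\<close>, so that after
  integration they need only the mean of \<open>q\<close>; no concentration of the log-likelihood ratio is used.\<close>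

lemma path_lower:
  fixes L :: real
  assumes reg: "regular_obs (enat (Suc k)) m \<omega>"
    and dec: "\<And>i. E (Suc i) \<subseteq> E i"
  shows "(\<Sum>i<n. indicator (E i - E (Suc i)) \<omega> * (L - exp L * inv_likelihood (enat (Suc k)) m (Suc (k + i)) \<omega>))
      - indicator (E n) \<omega> * inv_likelihood (enat (Suc k)) m (k + n) \<omega>
    \<le> (\<Sum>i<n. indicator (E i) \<omega> * log_ratio m (\<omega> (Suc (k + i))))"
proof -
  let ?Q = "\<lambda>t. inv_likelihood (enat (Suc k)) m t \<omega>"
  note lnQ = ln_inv_likelihood[OF reg]
  have decE: "\<omega> \<in> E i" if "\<omega> \<in> E j" "i \<le> j" for i j
    using that(2,1) by (induction rule: dec_induct) (use dec in auto)
  have full: "(\<Sum>i<n. indicator (E i) \<omega> * log_ratio m (\<omega> (Suc (k + i)))) = - ln (?Q (k + n))"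
    if "\<omega> \<in> E j" "n \<le> Suc j" for n j
  proof -
    have "(\<Sum>i<n. indicator (E i) \<omega> * log_ratio m (\<omega> (Suc (k + i)))) = (\<Sum>i<n. log_ratio m (\<omega> (Suc (k + i))))"
      using decE[OF that(1)] that(2) by (intro sum.cong refl) auto
    then show ?thesis using lnQ by simp
  qed
  have none: "(\<Sum>i<n. indicator (E i - E (Suc i)) \<omega> * f i) = 0" if "\<omega> \<in> E j" "n \<le> j" for n j and f :: "nat \<Rightarrow> real"
    using decE[OF that(1)] that(2) by (intro sum.neutral) auto
  show ?thesis
  proof (induction n)
    case 0
    have "?Q k = 1" by (rule inv_likelihood_before) simp
    then show ?case by simp
  next
    case (Suc n)
    consider "\<omega> \<in> E (Suc n)" | "\<omega> \<in> E n - E (Suc n)" | "\<omega> \<notin> E n" by blast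
    then show ?case
    proof cases
      case 1
      have "- ?Q (k + Suc n) \<le> - ln (?Q (k + Suc n))"
        using lnQ[of "Suc n"] ln_le_minus_one[of "?Q (k + Suc n)"] by linarith
      then show ?thesis using full[OF 1, of "Suc n"] none[OF 1 order_refl] 1 by (simp only: indicator_simps)
    next
      case 2
      let ?q = "?Q (Suc (k + n))"
      have q: "0 < ?q" using lnQ[of "Suc n"] by (simp only: add_Suc_right)
      have "ln (exp L * ?q) \<le> exp L * ?q - 1" using q by (intro ln_le_minus_one) simp
      then have "L - exp L * ?q \<le> - ln ?q" using q by (simp add: ln_mult del: inv_likelihood.simps)
      moreover have "(\<Sum>i<Suc n. indicator (E i) \<omega> * log_ratio m (\<omega> (Suc (k + i)))) = - ln ?q"
        using full[of n "Suc n"] 2 by (simp only: add_Suc_right) auto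
      moreover have "(\<Sum>i<n. indicator (E i - E (Suc i)) \<omega> * (L - exp L * ?Q (Suc (k + i)))) = 0"
        using 2 by (intro none[of n]) auto
      ultimately show ?thesis using 2 by (simp del: inv_likelihood.simps)
    next
      case 3
      then have "\<omega> \<notin> E (Suc n)" using dec[of n] by auto
      then show ?thesis using 3 Suc by (simp del: inv_likelihood.simps)
    qed
  qed
qed

text \<open>An alarm after the change requires about \<open>L = ln (\<gamma> / (k + n))\<close> of accumulated information:
  alarms with less would be false alarms under the inverse likelihood weight, whose total weight is
  at most \<open>e\<^bsup>-L\<^esup>\<close>. On the closed class \<open>B\<close> information about \<open>m\<close> arrives at rate at most \<open>c\<close>, so a
  delay of mean at most \<open>V\<close> on \<open>F\<close> yields no more than \<open>c V\<close>, up to the bounded boundary term.\<close>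

lemma WADD_hyp_ge:
  fixes \<pi> :: "'act policy" and k m :: nat
  assumes m: "m \<in> {1..num_hyp S}" and \<pi>: "open_loop_policy W \<pi>" "W \<ge> 1"
    and F: "F \<in> sets (obs_filtration S (enat k))"
    and h: "\<And>w. \<bar>h w\<bar> \<le> H"
    and drift: "\<And>w. w \<in> B \<Longrightarrow> kl m (hd w) \<le> h w - step (snd \<pi>) h w + c" and c: "0 \<le> c"
    and B: "AE p in joint \<pi> (enat (Suc k)) m. observe p \<in> F \<longrightarrow> (\<forall>i. fst p (k + i) \<in> B)"
    and \<gamma>: "1 \<le> \<gamma>"
    and V: "WADD_hyp S m (glr_cusum S \<gamma>) \<pi> \<le> ennreal V" "0 \<le> V"
    and n: "0 < n" "real (k + n) \<le> \<gamma>"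
  defines "p \<equiv> measure (obs_measure S \<pi> (enat (Suc k)) m) F"
  shows "ln (\<gamma> / real (k + n)) * (p - real k / \<gamma> - V * p / real n) \<le> 2 + 2 * H * p + c * (V * p)"
proof -
  have m': "m \<le> num_hyp S" using m by simp
  define P where "P = obs_measure S \<pi> (enat (Suc k)) m"
  interpret P: prob_space P unfolding P_def by (rule prob_space_obs_measure[OF model m'])
  define E where "E i = F \<inter> survive \<gamma> (k + i)" for i
  define Q where "Q = inv_likelihood (enat (Suc k)) m"
  define L where "L = ln (\<gamma> / real (k + n))"
  have L0: "0 \<le> L" unfolding L_def using n by (intro ln_ge_zero) (simp add: field_simps)
  have eL: "exp L = \<gamma> / real (k + n)" unfolding L_def using n \<gamma> by (subst exp_ln) auto
  have Fs: "F \<in> sets (obs_seq_space S)" by (rule sets_obs_filtration_full[OF F])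
  have EF: "E i \<in> sets (obs_filtration S (enat (k + i)))" for i
    using subsetD[OF obs_filtration_facts(2) F, of "enat (k + i)"] survive_sets[of \<gamma> "k + i"] by (auto simp: E_def)
  have EP [measurable]: "E i \<in> sets P" for i using sets_obs_filtration_full[OF EF] by (simp add: P_def)
  have dec: "E (Suc i) \<subseteq> E i" for i using survive_antimono[of "k + i" "k + Suc i" \<gamma>] by (auto simp: E_def)
  have Qm [measurable]: "Q t \<in> borel_measurable P" for t
    unfolding P_def Q_def by (rule measurable_obs_measure[OF measurable_inv_likelihood[OF m']])
  have Q0: "0 \<le> Q t \<omega>" for t \<omega> unfolding Q_def by (rule inv_likelihood_nonneg[OF m'])
  have Q1: "(\<integral>\<^sup>+\<omega>. ennreal (Q t \<omega>) \<partial>P) \<le> 1" for t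
    unfolding P_def Q_def by (rule nn_integral_inv_likelihood_le_1[OF m'])
  have iQ: "integrable P (\<lambda>\<omega>. indicator A \<omega> * Q t \<omega>)" if [measurable]: "A \<in> sets P" for A t
  proof -
    have "integrable P (Q t)"
      using Q1[of t] Q0 by (intro integrableI_nonneg) (auto intro: le_less_trans)
    then show ?thesis using integrable_mult_indicator[OF that, of "Q t"] by simp
  qed
  have IQ1: "(\<integral>\<^sup>+\<omega>. indicator A \<omega> * ennreal (Q t \<omega>) \<partial>P) \<le> 1" for A t
    by (rule order_trans[OF _ Q1[of t]], intro nn_integral_mono) (simp add: indicator_def)
  have nnQ: "(\<integral>\<^sup>+\<omega>. indicator A \<omega> * ennreal (Q t \<omega>) \<partial>P) = ennreal (\<integral>\<omega>. indicator A \<omega> * Q t \<omega> \<partial>P)"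
    if A: "A \<in> sets P" for A t
  proof -
    have "(\<integral>\<^sup>+\<omega>. indicator A \<omega> * ennreal (Q t \<omega>) \<partial>P) = (\<integral>\<^sup>+\<omega>. ennreal (indicator A \<omega> * Q t \<omega>) \<partial>P)"
      by (intro nn_integral_cong) (simp add: indicator_def)
    also have "\<dots> = ennreal (\<integral>\<omega>. indicator A \<omega> * Q t \<omega> \<partial>P)"
      by (rule nn_integral_eq_integral[OF iQ[OF A]]) (simp add: Q0)
    finally show ?thesis .
  qed
  have DP: "E i - E (Suc i) \<in> sets P" for i by measurable
  have Deq: "E i - E (Suc i) = F \<inter> (survive \<gamma> (k + i) - survive \<gamma> (Suc (k + i)))" for i by (auto simp: E_def)

  have mass: "ennreal (threshold \<gamma>) * (\<Sum>i<n. \<integral>\<^sup>+\<omega>. indicator (E i - E (Suc i)) \<omega> * ennreal (Q (Suc (k + i)) \<omega>) \<partial>P)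
     \<le> of_nat (card {1..num_hyp S}) * (of_nat k + (\<Sum>i<n. \<integral>\<^sup>+\<omega>. indicator (E i) \<omega> * ennreal (Q (k + i) \<omega>) \<partial>P))"
    unfolding Deq unfolding E_def Q_def P_def
  proof (rule crossing_mass[OF m' F _ _ \<gamma>])
    show "AE \<omega> in obs_measure S \<pi> (enat (Suc k)) m.
        \<omega> \<in> F \<inter> (survive \<gamma> (k + i) - survive \<gamma> (Suc (k + i))) \<longrightarrow>
        (\<exists>j\<in>{1..num_hyp S}. cusum S j (Suc (k + i)) \<omega> > ereal (ln (threshold \<gamma>)))" for i
      by (intro AE_I2 impI crossing_at) blast
  qed auto
  have "ennreal (threshold \<gamma>) * (\<Sum>i<n. ennreal (\<integral>\<omega>. indicator (E i - E (Suc i)) \<omega> * Q (Suc (k + i)) \<omega> \<partial>P))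
     \<le> of_nat (num_hyp S) * (of_nat k + (\<Sum>i<n. \<integral>\<^sup>+\<omega>. indicator (E i) \<omega> * ennreal (Q (k + i) \<omega>) \<partial>P))"
    using mass unfolding nnQ[OF DP] card_atLeastAtMost diff_Suc_1 .
  also have "\<dots> \<le> of_nat (num_hyp S) * (of_nat k + (\<Sum>i<n. 1))"
    by (intro mult_left_mono add_left_mono sum_mono IQ1) simp
  also have "\<dots> = ennreal (real (num_hyp S) * real (k + n))"
    by (simp add: ennreal_mult ennreal_of_nat_eq_real_of_nat flip: ennreal_plus)
  also have "(\<Sum>i<n. ennreal (\<integral>\<omega>. indicator (E i - E (Suc i)) \<omega> * Q (Suc (k + i)) \<omega> \<partial>P))
     = ennreal (\<Sum>i<n. \<integral>\<omega>. indicator (E i - E (Suc i)) \<omega> * Q (Suc (k + i)) \<omega> \<partial>P)"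
    by (intro sum_ennreal integral_nonneg_AE AE_I2 mult_nonneg_nonneg Q0) simp
  finally have "threshold \<gamma> * (\<Sum>i<n. \<integral>\<omega>. indicator (E i - E (Suc i)) \<omega> * Q (Suc (k + i)) \<omega> \<partial>P) \<le> real (num_hyp S) * real (k + n)"
    using threshold_ge_1[OF \<gamma>]
    by (simp only: ennreal_mult'[symmetric] order_trans[OF zero_le_one] ennreal_le_iff mult_nonneg_nonneg of_nat_0_le_iff)
  then have "real (num_hyp S) * (\<gamma> * (\<Sum>i<n. \<integral>\<omega>. indicator (E i - E (Suc i)) \<omega> * Q (Suc (k + i)) \<omega> \<partial>P)) \<le> real (num_hyp S) * real (k + n)"
    by (simp only: mult.assoc)
  then have q: "exp L * (\<Sum>i<n. \<integral>\<omega>. indicator (E i - E (Suc i)) \<omega> * Q (Suc (k + i)) \<omega> \<partial>P) \<le> 1"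
    unfolding eL using num_hyp_ge_1 n by (subst (asm) mult_le_cancel_left_pos) (auto simp: field_simps)

  have r: "(\<integral>\<omega>. indicator (E n) \<omega> * Q (k + n) \<omega> \<partial>P) \<le> 1"
    using IQ1[of "E n" "k + n"] unfolding nnQ[OF EP] by simp

  have int: "integrable P (\<lambda>\<omega>. indicator (E i) \<omega> * log_ratio m (\<omega> (Suc (k + i))))" for i
    using integral_next_observation(1)[OF m', of "Suc (k + i)" "E i" "log_ratio m" "enat (Suc k)" \<pi>]
      EF[of i] measurable_log_ratio[OF m'] integrable_log_ratio[OF m] by (simp add: P_def)
  have iD: "integrable P (\<lambda>\<omega>. indicator (E i - E (Suc i)) \<omega> * (L - exp L * Q (Suc (k + i)) \<omega>))" for i
  proof -
    have "integrable P (\<lambda>\<omega>. L * indicator (E i - E (Suc i)) \<omega> - exp L * (indicator (E i - E (Suc i)) \<omega> * Q (Suc (k + i)) \<omega>))"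
      by (intro Bochner_Integration.integrable_diff)
         (rule integrable_mult_right, rule integrable_indicator_prob[OF P.prob_space_axioms DP],
          rule integrable_mult_right, rule iQ[OF DP])
    then show ?thesis by (simp add: algebra_simps)
  qed
  have ID: "(\<integral>\<omega>. indicator (E i - E (Suc i)) \<omega> * (L - exp L * Q (Suc (k + i)) \<omega>) \<partial>P)
     = L * (measure P (E i) - measure P (E (Suc i))) - exp L * (\<integral>\<omega>. indicator (E i - E (Suc i)) \<omega> * Q (Suc (k + i)) \<omega> \<partial>P)" for i
  proof -
    have "(\<integral>\<omega>. indicator (E i - E (Suc i)) \<omega> * (L - exp L * Q (Suc (k + i)) \<omega>) \<partial>P)
       = (\<integral>\<omega>. L * indicator (E i - E (Suc i)) \<omega> - exp L * (indicator (E i - E (Suc i)) \<omega> * Q (Suc (k + i)) \<omega>) \<partial>P)"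
      by (intro Bochner_Integration.integral_cong refl) (simp add: algebra_simps)
    also have "\<dots> = (\<integral>\<omega>. L * indicator (E i - E (Suc i)) \<omega> \<partial>P) - (\<integral>\<omega>. exp L * (indicator (E i - E (Suc i)) \<omega> * Q (Suc (k + i)) \<omega>) \<partial>P)"
      by (rule Bochner_Integration.integral_diff)
         (rule integrable_mult_right, rule integrable_indicator_prob[OF P.prob_space_axioms DP],
          rule integrable_mult_right, rule iQ[OF DP])
    also have "(\<integral>\<omega>. L * indicator (E i - E (Suc i)) \<omega> \<partial>P) = L * measure P (E i - E (Suc i))"
      using DP[of i] sets.sets_into_space[OF DP[of i]] by (simp add: Int_absorb2)
    also have "measure P (E i - E (Suc i)) = measure P (E i) - measure P (E (Suc i))"
      by (rule P.finite_measure_Diff[OF EP EP dec])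
    finally show ?thesis by simp
  qed
  have "L * (p - real k / \<gamma> - V * p / real n) \<le> L * (measure P (E 0) - measure P (E n))"
    using delay_facts(2)[OF m' F \<gamma> V n(1)] L0 unfolding p_def P_def E_def by (intro mult_left_mono) auto
  also have "\<dots> = (\<Sum>i<n. L * (measure P (E i) - measure P (E (Suc i))))"
    by (simp only: sum_distrib_left[symmetric] sum_lessThan_telescope'[of "\<lambda>i. measure P (E i)"])
  also have "\<dots> = (\<Sum>i<n. \<integral>\<omega>. indicator (E i - E (Suc i)) \<omega> * (L - exp L * Q (Suc (k + i)) \<omega>) \<partial>P)
     + exp L * (\<Sum>i<n. \<integral>\<omega>. indicator (E i - E (Suc i)) \<omega> * Q (Suc (k + i)) \<omega> \<partial>P)"
    unfolding ID by (simp add: sum_subtractf sum_distrib_left)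
  also have "(\<Sum>i<n. \<integral>\<omega>. indicator (E i - E (Suc i)) \<omega> * (L - exp L * Q (Suc (k + i)) \<omega>) \<partial>P)
     \<le> (\<Sum>i<n. \<integral>\<omega>. indicator (E i) \<omega> * log_ratio m (\<omega> (Suc (k + i))) \<partial>P) + (\<integral>\<omega>. indicator (E n) \<omega> * Q (k + n) \<omega> \<partial>P)"
  proof -
    have "(\<Sum>i<n. \<integral>\<omega>. indicator (E i - E (Suc i)) \<omega> * (L - exp L * Q (Suc (k + i)) \<omega>) \<partial>P)
       = (\<integral>\<omega>. (\<Sum>i<n. indicator (E i - E (Suc i)) \<omega> * (L - exp L * Q (Suc (k + i)) \<omega>)) \<partial>P)"
      by (rule Bochner_Integration.integral_sum[symmetric]) (rule iD)
    also have "\<dots> \<le> (\<integral>\<omega>. (\<Sum>i<n. indicator (E i) \<omega> * log_ratio m (\<omega> (Suc (k + i)))) + indicator (E n) \<omega> * Q (k + n) \<omega> \<partial>P)"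
    proof (rule integral_mono_AE)
      show "integrable P (\<lambda>\<omega>. \<Sum>i<n. indicator (E i - E (Suc i)) \<omega> * (L - exp L * Q (Suc (k + i)) \<omega>))"
        by (rule Bochner_Integration.integrable_sum) (rule iD)
      show "integrable P (\<lambda>\<omega>. (\<Sum>i<n. indicator (E i) \<omega> * log_ratio m (\<omega> (Suc (k + i)))) + indicator (E n) \<omega> * Q (k + n) \<omega>)"
        by (intro Bochner_Integration.integrable_add Bochner_Integration.integrable_sum int iQ EP)
      show "AE \<omega> in P. (\<Sum>i<n. indicator (E i - E (Suc i)) \<omega> * (L - exp L * Q (Suc (k + i)) \<omega>))
         \<le> (\<Sum>i<n. indicator (E i) \<omega> * log_ratio m (\<omega> (Suc (k + i)))) + indicator (E n) \<omega> * Q (k + n) \<omega>"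
        using AE_regular_obs[OF m', of "enat (Suc k)" \<pi>] unfolding P_def[symmetric]
      proof eventually_elim
        case (elim \<omega>)
        from path_lower[where n = n and L = L and E = E, OF elim dec] show ?case unfolding Q_def by linarith
      qed
    qed
    also have "\<dots> = (\<integral>\<omega>. (\<Sum>i<n. indicator (E i) \<omega> * log_ratio m (\<omega> (Suc (k + i)))) \<partial>P) + (\<integral>\<omega>. indicator (E n) \<omega> * Q (k + n) \<omega> \<partial>P)"
      by (intro Bochner_Integration.integral_add Bochner_Integration.integrable_sum int iQ EP)
    also have "(\<integral>\<omega>. (\<Sum>i<n. indicator (E i) \<omega> * log_ratio m (\<omega> (Suc (k + i)))) \<partial>P)
       = (\<Sum>i<n. \<integral>\<omega>. indicator (E i) \<omega> * log_ratio m (\<omega> (Suc (k + i))) \<partial>P)"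
      by (rule Bochner_Integration.integral_sum) (rule int)
    finally show ?thesis by simp
  qed
  also have "(\<Sum>i<n. \<integral>\<omega>. indicator (E i) \<omega> * log_ratio m (\<omega> (Suc (k + i))) \<partial>P)
      \<le> 2 * H * p + c * (\<Sum>i<n. measure P (E i))"
    unfolding E_def P_def p_def
    by (rule wald_poisson_le[OF m' \<pi> F measurable_log_ratio[OF m'] integrable_log_ratio[OF m] h _ B])
       (use drift in \<open>auto simp: kl_def\<close>)
  also have "(\<Sum>i<n. measure P (E i)) \<le> V * p"
    using delay_facts(1)[OF m' F \<gamma> V n(1)] unfolding E_def P_def p_def .
  finally show ?thesis using q r c by (simp add: L_def mult_left_mono)
qed

section \<open>A closed class on which a hypothesis is indistinguishable\<close>

text \<open>On \<open>F\<close> the statistic of \<open>m\<close> does not move after the change and the inverse likelihood stays \<open>1\<close>.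
  Only the other \<open>M - 1\<close> statistics can raise an alarm, and they do so as rarely as false alarms.\<close>

lemma WADD_hyp_degenerate:
  fixes \<pi> :: "'act policy" and k m :: nat
  assumes m: "m \<in> {1..num_hyp S}"
    and F: "F \<in> sets (obs_filtration S (enat k))"
    and zero: "\<And>w. w \<in> B \<Longrightarrow> kl m (hd w) = 0"
    and B: "AE p in joint \<pi> (enat (Suc k)) m. observe p \<in> F \<longrightarrow> (\<forall>i. fst p (k + i) \<in> B)"
    and \<gamma>: "1 \<le> \<gamma>"
    and V: "WADD_hyp S m (glr_cusum S \<gamma>) \<pi> \<le> ennreal V" "0 \<le> V"
    and n: "0 < n"
  defines "p \<equiv> measure (obs_measure S \<pi> (enat (Suc k)) m) F"
  shows "threshold \<gamma> * (p - real k / \<gamma> - V * p / real n) \<le> (real (num_hyp S) - 1) * (real k + V * p)"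
proof -
  have m': "m \<le> num_hyp S" using m by simp
  define P where "P = obs_measure S \<pi> (enat (Suc k)) m"
  interpret P: prob_space P unfolding P_def by (rule prob_space_obs_measure[OF model m'])
  define E where "E i = F \<inter> survive \<gamma> (k + i)" for i
  have Fs: "F \<in> sets (obs_seq_space S)" by (rule sets_obs_filtration_full[OF F])
  have EP: "E i \<in> sets P" for i
    using Fs sets_obs_filtration_full[OF survive_sets[of \<gamma> "k + i"]] by (simp add: P_def E_def)
  have dec: "E (Suc i) \<subseteq> E i" for i using survive_antimono[of "k + i" "k + Suc i" \<gamma>] by (auto simp: E_def)
  have DP: "E i - E (Suc i) \<in> sets P" for i using EP by blast
  have Deq: "E i - E (Suc i) = F \<inter> (survive \<gamma> (k + i) - survive \<gamma> (Suc (k + i)))" for i by (auto simp: E_def)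

  have zero_i: "AE \<omega> in P. \<omega> \<in> F \<longrightarrow> log_ratio m (\<omega> (Suc (k + i))) = 0" for i
  proof -
    let ?t = "Suc (k + i)"
    let ?\<phi> = "\<lambda>z. indicator {z. log_ratio m z \<noteq> 0} z :: ennreal"
    have \<phi>: "?\<phi> \<in> borel_measurable obs_pair_space"
      using measurable_log_ratio[OF m'] by measurable
    have act: "AE \<omega> in P. \<omega> \<in> F \<longrightarrow> fst (\<omega> ?t) \<in> hd ` B"
    proof -
      have meas: "{\<omega> \<in> space (obs_seq_space S). \<omega> \<in> F \<longrightarrow> fst (\<omega> ?t) \<in> hd ` B} \<in> sets (obs_seq_space S)"
      proof -
        have "(\<lambda>\<omega>. fst (\<omega> ?t)) \<in> obs_seq_space S \<rightarrow>\<^sub>M count_space UNIV"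
          by (rule measurable_compose[OF measurable_observation_full measurable_fst]) simp
        from measurable_sets[OF this, of "hd ` B"]
        have "(\<lambda>\<omega>. fst (\<omega> ?t)) -` (hd ` B) \<inter> space (obs_seq_space S) \<in> sets (obs_seq_space S)" by simp
        then have "(space (obs_seq_space S) - F) \<union> ((\<lambda>\<omega>. fst (\<omega> ?t)) -` (hd ` B) \<inter> space (obs_seq_space S)) \<in> sets (obs_seq_space S)"
          using Fs by (intro sets.Un sets.Diff sets.top)
        moreover have "(space (obs_seq_space S) - F) \<union> ((\<lambda>\<omega>. fst (\<omega> ?t)) -` (hd ` B) \<inter> space (obs_seq_space S))
            = {\<omega> \<in> space (obs_seq_space S). \<omega> \<in> F \<longrightarrow> fst (\<omega> ?t) \<in> hd ` B}" by auto
        ultimately show ?thesis by (simp only:)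
      qed
      have "AE p in joint \<pi> (enat (Suc k)) m. observe p \<in> F \<longrightarrow> fst (observe p ?t) \<in> hd ` B"
        using B by eventually_elim (simp add: observe_apply)
      then show ?thesis
        unfolding P_def obs_measure_eq_distr by (subst AE_distr_iff[OF measurable_observe meas])
    qed
    have "(\<integral>\<^sup>+\<omega>. indicator F \<omega> * ?\<phi> (\<omega> ?t) \<partial>P)
       = (\<integral>\<^sup>+\<omega>. indicator F \<omega> * (\<integral>\<^sup>+y. ?\<phi> (fst (\<omega> ?t), y) \<partial>obs_law S m (fst (\<omega> ?t))) \<partial>P)"
    proof -
      have "F \<in> sets (obs_filtration S (enat (k + i)))"
        using subsetD[OF obs_filtration_facts(2) F, of "enat (k + i)"] by simp
      then show ?thesis
        using nn_integral_next_observation[OF m', where t = ?t and g = "indicator F" and \<phi> = ?\<phi> and \<nu> = "enat (Suc k)" and \<pi> = \<pi>] \<phi>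
        by (simp add: P_def)
    qed
    also have "\<dots> = (\<integral>\<^sup>+\<omega>. 0 \<partial>P)"
    proof (rule nn_integral_cong_AE)
      show "AE \<omega> in P. indicator F \<omega> * (\<integral>\<^sup>+y. ?\<phi> (fst (\<omega> ?t), y) \<partial>obs_law S m (fst (\<omega> ?t))) = 0"
        using act
      proof eventually_elim
        case (elim \<omega>)
        show ?case
        proof (cases "\<omega> \<in> F")
          case True
          then have "kl m (fst (\<omega> ?t)) = 0" using elim zero by auto
          from kl_facts(2)[OF m this]
          have "AE y in obs_law S m (fst (\<omega> ?t)). ?\<phi> (fst (\<omega> ?t), y) = 0" by eventually_elim simp
          then have "(\<integral>\<^sup>+y. ?\<phi> (fst (\<omega> ?t), y) \<partial>obs_law S m (fst (\<omega> ?t))) = (\<integral>\<^sup>+y. 0 \<partial>obs_law S m (fst (\<omega> ?t)))"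
            by (rule nn_integral_cong_AE)
          then show ?thesis by simp
        qed simp
      qed
    qed
    finally have int0: "(\<integral>\<^sup>+\<omega>. indicator F \<omega> * ?\<phi> (\<omega> ?t) \<partial>P) = 0" by simp
    have "(\<lambda>\<omega>. ?\<phi> (\<omega> ?t)) \<in> borel_measurable P"
      unfolding P_def measurable_cong_sets[OF sets_obs_measure refl]
      by (rule measurable_compose[OF measurable_observation_full \<phi>]) simp
    then have "(\<lambda>\<omega>. indicator F \<omega> * ?\<phi> (\<omega> ?t)) \<in> borel_measurable P"
      using Fs by (intro borel_measurable_times_ennreal borel_measurable_indicator) (simp_all add: P_def)
    from nn_integral_0_iff_AE[OF this] int0 have "AE \<omega> in P. indicator F \<omega> * ?\<phi> (\<omega> ?t) = 0" by simp
    then show ?thesis by eventually_elim (auto simp: indicator_def split: if_splits)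
  qed
  have "AE \<omega> in P. \<forall>i. \<omega> \<in> F \<longrightarrow> log_ratio m (\<omega> (Suc (k + i))) = 0"
    unfolding AE_all_countable using zero_i by blast
  then have zero_all: "AE \<omega> in P. \<omega> \<in> F \<longrightarrow> (\<forall>i. log_ratio m (\<omega> (Suc (k + i))) = 0)"
    by eventually_elim blast

  define J where "J = {1..num_hyp S} - {m}"
  have J: "finite J" "\<And>j. j \<in> J \<Longrightarrow> j \<le> num_hyp S" by (auto simp: J_def)
  have cardJ: "card J = num_hyp S - 1" using m by (simp add: J_def)
  have reg: "AE \<omega> in P. regular_obs (enat (Suc k)) m \<omega>" unfolding P_def by (rule AE_regular_obs[OF m'])
  have cross: "AE \<omega> in P. \<omega> \<in> F \<inter> (survive \<gamma> (k + i) - survive \<gamma> (Suc (k + i))) \<longrightarrow>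
        (\<exists>j\<in>J. cusum S j (Suc (k + i)) \<omega> > ereal (ln (threshold \<gamma>)))" for i
    using zero_all reg
  proof eventually_elim
    case (elim \<omega>)
    show ?case
    proof
      assume \<omega>: "\<omega> \<in> F \<inter> (survive \<gamma> (k + i) - survive \<gamma> (Suc (k + i)))"
      then obtain j where j: "j \<in> {1..num_hyp S}" "cusum S j (Suc (k + i)) \<omega> > ereal (ln (threshold \<gamma>))"
        using crossing_at[of \<omega> \<gamma> "k + i"] by blast
      have "llr S m (\<omega> (Suc (k + i))) = 0"
        using regular_llr(1)[OF elim(2), of "Suc (k + i)"] elim(1) \<omega> by (simp add: zero_ereal_def)
      then have "cusum S m (Suc (k + i)) \<omega> = cusum S m (k + i) \<omega>"
        using cusum_nonneg[of m "k + i" \<omega>] by (simp add: max_absorb2)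
      also have "\<dots> \<le> ereal (ln (threshold \<gamma>))"
        by (rule cusum_le_threshold) (use \<omega> m in \<open>auto simp: survive_def\<close>)
      finally have "j \<noteq> m" using j(2) by (auto simp del: cusum.simps)
      then show "\<exists>j\<in>J. cusum S j (Suc (k + i)) \<omega> > ereal (ln (threshold \<gamma>))"
        using j by (intro bexI[of _ j]) (auto simp: J_def simp del: cusum.simps)
    qed
  qed
  let ?Q = "inv_likelihood (enat (Suc k)) m"
  have Q1: "AE \<omega> in P. \<omega> \<in> F \<longrightarrow> (\<forall>i. ?Q (k + i) \<omega> = 1)"
    using zero_all reg
  proof eventually_elim
    case (elim \<omega>)
    have "?Q (k + i) \<omega> = 1" if "\<omega> \<in> F" for i
      using ln_inv_likelihood[OF elim(2), of i] elim(1) that by auto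
    then show ?case by blast
  qed
  have drop: "(\<integral>\<^sup>+\<omega>. indicator A \<omega> * ennreal (?Q (k + i) \<omega>) \<partial>P) = ennreal (measure P A)"
    if A: "A \<in> sets P" "A \<subseteq> F" for A i
  proof -
    have "(\<integral>\<^sup>+\<omega>. indicator A \<omega> * ennreal (?Q (k + i) \<omega>) \<partial>P) = (\<integral>\<^sup>+\<omega>. indicator A \<omega> \<partial>P)"
    proof (rule nn_integral_cong_AE)
      show "AE \<omega> in P. indicator A \<omega> * ennreal (?Q (k + i) \<omega>) = indicator A \<omega>"
        using Q1 by eventually_elim (use A(2) in \<open>auto simp: indicator_def\<close>)
    qed
    then show ?thesis using A(1) by (simp add: P.emeasure_eq_measure)
  qed
  have "ennreal (threshold \<gamma>) * (\<Sum>i<n. ennreal (measure P (E i - E (Suc i))))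
     \<le> of_nat (card J) * (of_nat k + (\<Sum>i<n. ennreal (measure P (E i))))"
  proof -
    have "ennreal (threshold \<gamma>) * (\<Sum>i<n. \<integral>\<^sup>+\<omega>. indicator (E i - E (Suc i)) \<omega> * ennreal (?Q (Suc (k + i)) \<omega>) \<partial>P)
      \<le> of_nat (card J) * (of_nat k + (\<Sum>i<n. \<integral>\<^sup>+\<omega>. indicator (E i) \<omega> * ennreal (?Q (k + i) \<omega>) \<partial>P))"
      unfolding Deq unfolding E_def P_def
      by (rule crossing_mass[OF m' F J(1) _ \<gamma>]) (erule J(2), rule cross[unfolded P_def])
    moreover have "(\<integral>\<^sup>+\<omega>. indicator (E i - E (Suc i)) \<omega> * ennreal (?Q (Suc (k + i)) \<omega>) \<partial>P) = ennreal (measure P (E i - E (Suc i)))" for i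
      using drop[OF DP, of i "Suc i"] by (simp add: E_def Diff_subset subset_iff del: inv_likelihood.simps)
    moreover have "(\<integral>\<^sup>+\<omega>. indicator (E i) \<omega> * ennreal (?Q (k + i) \<omega>) \<partial>P) = ennreal (measure P (E i))" for i
      using drop[OF EP, of i i] by (simp add: E_def)
    ultimately show ?thesis by (simp only:)
  qed
  also have "(\<Sum>i<n. ennreal (measure P (E i - E (Suc i)))) = ennreal (\<Sum>i<n. measure P (E i - E (Suc i)))"
    by (intro sum_ennreal) simp
  also have "(\<Sum>i<n. measure P (E i - E (Suc i))) = measure P (E 0) - measure P (E n)"
    by (simp only: P.finite_measure_Diff[OF EP EP dec] sum_lessThan_telescope'[of "\<lambda>i. measure P (E i)"])
  also have "of_nat (card J) * (of_nat k + (\<Sum>i<n. ennreal (measure P (E i))))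
     = ennreal (real (card J) * (real k + (\<Sum>i<n. measure P (E i))))"
    by (simp add: sum_ennreal ennreal_mult sum_nonneg ennreal_of_nat_eq_real_of_nat flip: ennreal_plus)
  finally have "ennreal (threshold \<gamma> * (measure P (E 0) - measure P (E n)))
      \<le> ennreal (real (card J) * (real k + (\<Sum>i<n. measure P (E i))))"
    using threshold_ge_1[OF \<gamma>] by (simp add: ennreal_mult')
  then have "threshold \<gamma> * (measure P (E 0) - measure P (E n)) \<le> real (card J) * (real k + (\<Sum>i<n. measure P (E i)))"
    by (subst (asm) ennreal_le_iff) (auto intro!: mult_nonneg_nonneg add_nonneg_nonneg sum_nonneg)
  also have "\<dots> \<le> real (card J) * (real k + V * p)"
    using delay_facts(1)[OF m' F \<gamma> V n] unfolding E_def P_def p_def by (intro mult_left_mono add_left_mono) auto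
  also have "real (card J) = real (num_hyp S) - 1" using num_hyp_ge_1 by (simp add: cardJ of_nat_diff)
  finally have up: "threshold \<gamma> * (measure P (E 0) - measure P (E n)) \<le> (real (num_hyp S) - 1) * (real k + V * p)" .
  have "threshold \<gamma> * (p - real k / \<gamma> - V * p / real n) \<le> threshold \<gamma> * (measure P (E 0) - measure P (E n))"
    using delay_facts(2)[OF m' F \<gamma> V n] threshold_ge_1[OF \<gamma>] unfolding p_def P_def E_def by (intro mult_left_mono) auto
  then show ?thesis using up by linarith
qed

text \<open>Window \<open>k\<^sub>0\<close> consists of the actions at the times \<open>k\<^sub>0 + 1, \<dots>, k\<^sub>0 + W\<close>, so it is known to the
  observer at time \<open>k\<^sub>0 + W\<close>.\<close>

lemma window_event:
  fixes \<pi> :: "'act policy" and k\<^sub>0 :: nat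
  assumes m: "m \<le> num_hyp S" and \<pi>: "open_loop_policy W \<pi>" "W \<ge> 1" and len: "length u = W"
  defines "F \<equiv> {\<omega> \<in> space (obs_seq_space S). \<forall>j\<in>{..<W}. fst (\<omega> (Suc (k\<^sub>0 + j))) = u ! j}"
  shows "F \<in> sets (obs_filtration S (enat (k\<^sub>0 + W)))"
    and "AE p in joint \<pi> \<nu> m. observe p \<in> F \<longleftrightarrow> fst p k\<^sub>0 = u"
    and "measure (obs_measure S \<pi> \<nu> m) F = pmf (chain_law (snd \<pi>) (fst \<pi>) k\<^sub>0) u"
proof -
  have "{\<omega> \<in> space (obs_filtration S (enat (k\<^sub>0 + W))). \<forall>j\<in>{..<W}. fst (\<omega> (Suc (k\<^sub>0 + j))) = u ! j}
      \<in> sets (obs_filtration S (enat (k\<^sub>0 + W)))"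
  proof (rule sets.sets_Collect_finite_All)
    fix j assume j: "j \<in> {..<W}"
    have "(\<lambda>\<omega>. fst (\<omega> (Suc (k\<^sub>0 + j)))) \<in> obs_filtration S (enat (k\<^sub>0 + W)) \<rightarrow>\<^sub>M count_space UNIV"
      by (rule measurable_compose[OF measurable_observation measurable_fst]) (use j in auto)
    from measurable_sets[OF this, of "{u ! j}"]
    show "{\<omega> \<in> space (obs_filtration S (enat (k\<^sub>0 + W))). fst (\<omega> (Suc (k\<^sub>0 + j))) = u ! j}
      \<in> sets (obs_filtration S (enat (k\<^sub>0 + W)))"
      by (simp add: vimage_def Int_def conj_commute)
  qed simp
  then show Fm: "F \<in> sets (obs_filtration S (enat (k\<^sub>0 + W)))"
    by (simp add: F_def obs_filtration_facts(1))
  interpret finite_chain "{w. length w = W}" "snd \<pi>" by (rule window_chain[OF \<pi>])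
  have consistent: "AE w in window_measure \<pi>. (\<forall>j<W. hd (w (k\<^sub>0 + j)) = u ! j) \<longleftrightarrow> w k\<^sub>0 = u"
    using AE_window_transitions[of \<pi>]
  proof eventually_elim
    case (elim w)
    have len_w: "length (w k) = W" for k
    proof (induction k)
      case 0
      then show ?case using elim window_chain(2)[OF \<pi>] by auto
    next
      case (Suc k)
      then have "set_pmf (snd \<pi> (w k)) \<subseteq> {w. length w = W}" by (intro closed_states) simp
      then show ?case using elim by blast
    qed
    have shift: "w (Suc k) ! i = w k ! Suc i" if "Suc i < W" for k i
    proof -
      have "\<forall>w'\<in>set_pmf (snd \<pi> (w k)). \<exists>a. w' = tl (w k) @ [a]"
        using \<pi>(1) len_w[of k] unfolding open_loop_policy_def by simp
      moreover have "w (Suc k) \<in> set_pmf (snd \<pi> (w k))" using elim by blast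
      ultimately obtain a where "w (Suc k) = tl (w k) @ [a]" by metis
      moreover have "i < length (tl (w k))" using that len_w[of k] by simp
      ultimately show ?thesis by (simp add: nth_append nth_tl)
    qed
    have "w (k\<^sub>0 + j) ! i = w k\<^sub>0 ! (i + j)" if "i + j < W" for i j
      using that by (induction j arbitrary: i) (auto simp: shift)
    from this[of 0] have hd: "hd (w (k\<^sub>0 + j)) = w k\<^sub>0 ! j" if "j < W" for j
      using that len_w[of "k\<^sub>0 + j"] by (subst hd_conv_nth) auto
    show ?case
      using hd len len_w[of k\<^sub>0] by (auto intro: nth_equalityI)
  qed
  show AE: "AE p in joint \<pi> \<nu> m. observe p \<in> F \<longleftrightarrow> fst p k\<^sub>0 = u"
    using AE_joint_windows[OF m consistent, of \<nu>] AE_space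
  proof eventually_elim
    case (elim p)
    have "observe p \<in> space (obs_seq_space S)" by (rule measurable_space[OF measurable_observe elim(2)])
    then have "observe p \<in> F \<longleftrightarrow> (\<forall>j<W. hd (fst p (k\<^sub>0 + j)) = u ! j)"
      by (auto simp: F_def observe_apply)
    then show ?case using elim(1) by simp
  qed
  interpret P: prob_space "obs_measure S \<pi> \<nu> m" by (rule prob_space_obs_measure[OF model m])
  interpret X: prob_space "signal_seq \<nu> m" by (rule prob_space_signal_seq[OF m])
  have Fs: "F \<in> sets (obs_seq_space S)" by (rule sets_obs_filtration_full[OF Fm])
  have fst: "fst \<in> joint \<pi> \<nu> m \<rightarrow>\<^sub>M window_measure \<pi>" unfolding joint_def by (rule measurable_fst)
  have coord: "(\<lambda>w. indicator {u} (w k\<^sub>0) :: real) \<in> borel_measurable (window_measure \<pi>)"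
    by (rule measurable_compose[OF measurable_window_coordinate]) simp
  have "measure (obs_measure S \<pi> \<nu> m) F = (\<integral>\<omega>. (indicator F \<omega> :: real) \<partial>obs_measure S \<pi> \<nu> m)"
    using sets.sets_into_space[OF Fs] by (simp add: Int_absorb2)
  also have "\<dots> = (\<integral>p. indicator F (observe p) \<partial>joint \<pi> \<nu> m)"
    unfolding obs_measure_eq_distr by (rule integral_distr[OF measurable_observe]) (use Fs in measurable)
  also have "\<dots> = (\<integral>p. indicator {u} (fst p k\<^sub>0) \<partial>joint \<pi> \<nu> m)"
  proof (rule integral_cong_AE)
    show "(\<lambda>p. indicator F (observe p) :: real) \<in> borel_measurable (joint \<pi> \<nu> m)"
      by (rule measurable_compose[OF measurable_observe]) (use Fs in measurable)
    show "(\<lambda>p. indicator {u} (fst p k\<^sub>0) :: real) \<in> borel_measurable (joint \<pi> \<nu> m)"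
      by (rule measurable_compose[OF fst coord])
    show "AE p in joint \<pi> \<nu> m. indicator F (observe p) = (indicator {u} (fst p k\<^sub>0) :: real)"
      using AE by eventually_elim (simp add: indicator_def)
  qed
  also have "\<dots> = (\<integral>w. indicator {u} (w k\<^sub>0) \<partial>distr (joint \<pi> \<nu> m) (window_measure \<pi>) fst)"
    by (rule integral_distr[symmetric, OF fst coord])
  also have "distr (joint \<pi> \<nu> m) (window_measure \<pi>) fst = window_measure \<pi>"
    unfolding joint_def by (rule X.distr_pair_fst)
  also have "(\<integral>w. (indicator {u} (w k\<^sub>0) :: real) \<partial>window_measure \<pi>) = measure_pmf.expectation (chain_law (snd \<pi>) (fst \<pi>) k\<^sub>0) (indicator {u})"
    by (rule integral_window_coordinate)
  also have "\<dots> = pmf (chain_law (snd \<pi>) (fst \<pi>) k\<^sub>0) u" by (simp add: pmf.rep_eq)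
  finally show "measure (obs_measure S \<pi> \<nu> m) F = pmf (chain_law (snd \<pi>) (fst \<pi>) k\<^sub>0) u" .
qed

section \<open>Switching cost\<close>

text \<open>The cost of a switch has the same mean as its conditional mean given the current window.\<close>

lemma AOSC_eq_time_average:
  assumes \<pi>: "open_loop_policy W \<pi>" "W \<ge> 1"
  shows "AOSC S C \<pi> = limsup (\<lambda>n. ereal (time_average (snd \<pi>) (fst \<pi>) (switching_cost C (snd \<pi>)) n))"
proof -
  let ?J = "joint \<pi> \<infinity> 0"
  interpret V: prob_space "window_measure \<pi>" by (rule prob_space_window_measure)
  interpret X: prob_space "signal_seq \<infinity> 0" by (rule prob_space_signal_seq[OF le0])
  have fst: "fst \<in> ?J \<rightarrow>\<^sub>M window_measure \<pi>" unfolding joint_def by (rule measurable_fst)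
  have coord: "(\<lambda>w. f (w k)) \<in> borel_measurable (window_measure \<pi>)" for f :: "'act list \<Rightarrow> real" and k
    by (rule measurable_compose[OF measurable_window_coordinate]) simp
  have pairm: "(\<lambda>w. C $ hd (w k) $ hd (w l)) \<in> borel_measurable (window_measure \<pi>)" for k l
  proof -
    have "C $ hd (w k) $ hd (w l) = (\<Sum>a\<in>UNIV. of_bool (hd (w k) = a) * C $ a $ hd (w l))" for w :: "nat \<Rightarrow> 'act list"
      by (simp add: of_bool_def if_distrib[of "\<lambda>x. x * _"] cong: if_cong)
    then show ?thesis
      using coord[of "\<lambda>v. of_bool (hd v = _)" k] coord[of "\<lambda>v. C $ _ $ hd v" l]
      by (simp only:) (intro borel_measurable_sum borel_measurable_times coord[of "\<lambda>v. of_bool (hd v = _)"] coord[of "\<lambda>v. C $ _ $ hd v"])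
  qed
  define K where "K = (\<Sum>a\<in>UNIV. \<Sum>b\<in>UNIV. \<bar>C $ a $ b\<bar>)"
  have K: "\<bar>C $ a $ b\<bar> \<le> K" for a b
  proof -
    have "\<bar>C $ a $ b\<bar> \<le> (\<Sum>b\<in>UNIV. \<bar>C $ a $ b\<bar>)" by (rule member_le_sum) auto
    also have "\<dots> \<le> K" unfolding K_def by (rule member_le_sum) (auto intro: sum_nonneg)
    finally show ?thesis .
  qed
  have int: "integrable (window_measure \<pi>) (\<lambda>w. C $ hd (w k) $ hd (w l))" for k l
    by (rule V.integrable_const_bound[of _ K]) (use K pairm in auto)
  have int1: "integrable (window_measure \<pi>) (\<lambda>w. of_bool (hd (w k) = a) * f (w l))"
    if f: "\<And>v. \<bar>f v\<bar> \<le> K" for a k l and f :: "'act list \<Rightarrow> real"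
  proof (rule V.integrable_const_bound[of _ K])
    have "0 \<le> K" using order_trans[OF abs_ge_zero f] by blast
    then show "AE w in window_measure \<pi>. norm (of_bool (hd (w k) = a) * f (w l)) \<le> K" using f by auto
    show "(\<lambda>w. of_bool (hd (w k) = a) * f (w l)) \<in> borel_measurable (window_measure \<pi>)"
      using coord[of "\<lambda>v. of_bool (hd v = a)" k] coord[of f l] by (rule borel_measurable_times)
  qed
  have stepK: "\<bar>step (snd \<pi>) (\<lambda>v. C $ a $ hd v) w\<bar> \<le> K" for a w by (rule abs_step_le[OF K])
  have expand: "f (hd (w k)) = (\<Sum>a\<in>UNIV. of_bool (hd (w k) = a) * f a)" for f :: "'act \<Rightarrow> real" and w :: "nat \<Rightarrow> 'act list" and k
    by (simp add: of_bool_def if_distrib[of "\<lambda>x. x * _"] cong: if_cong)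
  have one: "(\<integral>w. C $ hd (w k) $ hd (w (Suc k)) \<partial>window_measure \<pi>)
      = measure_pmf.expectation (chain_law (snd \<pi>) (fst \<pi>) k) (switching_cost C (snd \<pi>))" for k
  proof -
    have "(\<integral>w. C $ hd (w k) $ hd (w (Suc k)) \<partial>window_measure \<pi>)
       = (\<integral>w. (\<Sum>a\<in>UNIV. of_bool (hd (w k) = a) * C $ a $ hd (w (Suc k))) \<partial>window_measure \<pi>)"
      by (intro Bochner_Integration.integral_cong refl expand)
    also have "\<dots> = (\<Sum>a\<in>UNIV. \<integral>w. of_bool (hd (w k) = a) * C $ a $ hd (w (Suc k)) \<partial>window_measure \<pi>)"
      by (rule Bochner_Integration.integral_sum) (rule int1, rule K)
    also have "\<dots> = (\<Sum>a\<in>UNIV. \<integral>w. of_bool (hd (w k) = a) * step (snd \<pi>) (\<lambda>v. C $ a $ hd v) (w k) \<partial>window_measure \<pi>)"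
    proof (intro sum.cong refl)
      fix a
      show "(\<integral>w. of_bool (hd (w k) = a) * C $ a $ hd (w (Suc k)) \<partial>window_measure \<pi>)
          = (\<integral>w. of_bool (hd (w k) = a) * step (snd \<pi>) (\<lambda>v. C $ a $ hd v) (w k) \<partial>window_measure \<pi>)"
        using window_markov[OF \<pi>, of "\<lambda>l. of_bool (hd (last l) = a)" k "\<lambda>v. C $ a $ hd v"] by simp
    qed
    also have "\<dots> = (\<integral>w. (\<Sum>a\<in>UNIV. of_bool (hd (w k) = a) * step (snd \<pi>) (\<lambda>v. C $ a $ hd v) (w k)) \<partial>window_measure \<pi>)"
      by (rule Bochner_Integration.integral_sum[symmetric]) (rule int1, rule stepK)
    also have "\<dots> = (\<integral>w. switching_cost C (snd \<pi>) (w k) \<partial>window_measure \<pi>)"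
      unfolding switching_cost_def
      by (intro Bochner_Integration.integral_cong refl expand[symmetric])
    finally show ?thesis by (simp add: integral_window_coordinate)
  qed
  have "(\<integral>\<omega>. (\<Sum>t=2..n + 1. C $ fst (\<omega> (t - 1)) $ fst (\<omega> t)) \<partial>no_change_measure S \<pi>)
     = (\<Sum>k<n. measure_pmf.expectation (chain_law (snd \<pi>) (fst \<pi>) k) (switching_cost C (snd \<pi>)))" for n
  proof -
    have om: "(\<lambda>\<omega>. C $ fst (\<omega> (t - 1)) $ fst (\<omega> t)) \<in> borel_measurable (obs_seq_space S)" if "2 \<le> t" for t
    proof -
      have m1: "(\<lambda>\<omega>. f (fst (\<omega> s))) \<in> borel_measurable (obs_seq_space S)" if "1 \<le> s" for f :: "'act \<Rightarrow> real" and s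
        by (rule measurable_compose[OF measurable_observation_full[OF that] measurable_compose[OF measurable_fst]]) simp
      have "C $ fst (\<omega> (t - 1)) $ fst (\<omega> t) = (\<Sum>a\<in>UNIV. of_bool (fst (\<omega> (t - 1)) = a) * C $ a $ fst (\<omega> t))" for \<omega> :: "nat \<Rightarrow> 'act \<times> 'y"
        by (simp add: of_bool_def if_distrib[of "\<lambda>x. x * _"] cong: if_cong)
      then show ?thesis
        using that by (simp only:) (intro borel_measurable_sum borel_measurable_times m1[of _ "\<lambda>b. of_bool (b = _)"] m1[of _ "\<lambda>b. C $ _ $ b"], simp_all)
    qed
    have "(\<integral>\<omega>. (\<Sum>t=2..n + 1. C $ fst (\<omega> (t - 1)) $ fst (\<omega> t)) \<partial>no_change_measure S \<pi>)
       = (\<integral>p. (\<Sum>t=2..n + 1. C $ fst (observe p (t - 1)) $ fst (observe p t)) \<partial>?J)"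
      unfolding obs_measure_eq_distr
      by (rule integral_distr[OF measurable_observe]) (intro borel_measurable_sum om, simp)
    also have "\<dots> = (\<integral>p. (\<Sum>k<n. C $ hd (fst p k) $ hd (fst p (Suc k))) \<partial>?J)"
    proof (intro Bochner_Integration.integral_cong refl)
      fix p
      show "(\<Sum>t=2..n + 1. C $ fst (observe p (t - 1)) $ fst (observe p t)) = (\<Sum>k<n. C $ hd (fst p k) $ hd (fst p (Suc k)))"
        by (rule sum.reindex_bij_witness[of _ "\<lambda>k. k + 2" "\<lambda>t. t - 2"])
           (auto simp: observe_apply numeral_2_eq_2 Suc_diff_Suc)
    qed
    also have "\<dots> = (\<integral>w. (\<Sum>k<n. C $ hd (w k) $ hd (w (Suc k))) \<partial>distr ?J (window_measure \<pi>) fst)"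
      by (rule integral_distr[symmetric, OF fst]) (intro borel_measurable_sum pairm)
    also have "distr ?J (window_measure \<pi>) fst = window_measure \<pi>" unfolding joint_def by (rule X.distr_pair_fst)
    also have "(\<integral>w. (\<Sum>k<n. C $ hd (w k) $ hd (w (Suc k))) \<partial>window_measure \<pi>)
      = (\<Sum>k<n. \<integral>w. C $ hd (w k) $ hd (w (Suc k)) \<partial>window_measure \<pi>)"
      by (rule Bochner_Integration.integral_sum) (rule int)
    finally show ?thesis by (simp add: one)
  qed
  then show ?thesis unfolding AOSC_def time_average_def by (simp add: mult.commute divide_inverse)
qed

end

section \<open>Asymptotics of the worst-case delay\<close>

text \<open>A quotient with an argument \<open>0\<close> or \<open>\<infinity>\<close> is itself \<open>0\<close> or \<open>\<infinity>\<close>.\<close>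

lemma ennreal_ratio_real:
  fixes x y :: ennreal and r :: real
  assumes "x / y < ennreal r" "ennreal (1 / 2) < x / y"
  obtains a b where "x = ennreal a" "y = ennreal b" "0 < a" "0 < b" "a / b < r"
proof -
  have y: "y \<noteq> top"
  proof
    assume "y = top"
    then have "x / y = 0" by (simp add: divide_ennreal_def)
    then show False using assms(2) by (simp only: not_less_zero)
  qed
  have x0: "x \<noteq> 0" using assms(2) by auto
  have y0: "y \<noteq> 0"
  proof
    assume "y = 0"
    then have "x / y = top" using x0 by (simp add: divide_ennreal_def ennreal_mult_top)
    then show False using assms(1) by simp
  qed
  have x: "x \<noteq> top"
  proof
    assume "x = top"
    then have "x / y = top" using y y0 by (simp add: divide_ennreal_def ennreal_top_mult)
    then show False using assms(1) by simp
  qed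
  obtain a where a: "x = ennreal a" "0 \<le> a" using x by (cases x) auto
  obtain b where b: "y = ennreal b" "0 \<le> b" using y by (cases y) auto
  have "0 < a" using a x0 by (cases "a = 0") auto
  moreover have "0 < b" using b y0 by (cases "b = 0") auto
  moreover from this have "a / b < r"
    using assms(1) a by (simp add: b divide_ennreal ennreal_less_iff)
  ultimately show thesis using that a(1) b(1) by blast
qed

context detection_model
begin

lemma WADD_hyp_le_WADD: "m \<in> {1..num_hyp S} \<Longrightarrow> WADD_hyp S m \<tau> \<pi> \<le> WADD S \<tau> \<pi>"
  unfolding WADD_def by (intro Max_ge) auto

lemma WADD_le_iff: "WADD S \<tau> \<pi> \<le> c \<longleftrightarrow> (\<forall>m\<in>{1..num_hyp S}. WADD_hyp S m \<tau> \<pi> \<le> c)"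
  unfolding WADD_def using num_hyp_ge_1 by (subst Max_le_iff) auto

lemma WADD_glr_le:
  assumes \<pi>: "open_loop_policy W \<pi>" "W \<ge> 1"
    and A: "finite A" "set_pmf (fst \<pi>) \<subseteq> A" "\<And>v. v \<in> A \<Longrightarrow> set_pmf (snd \<pi> v) \<subseteq> A"
    and h: "\<And>m \<epsilon>. m \<in> {1..num_hyp S} \<Longrightarrow> \<epsilon> > 0 \<Longrightarrow>
       \<exists>h. \<forall>v\<in>A. h v - step (snd \<pi>) h v + I - \<epsilon> \<le> kl m (hd v)"
    and \<delta>: "0 < \<delta>" "\<delta> < I"
  shows "\<exists>C. \<forall>\<gamma>\<ge>1. WADD S (glr_cusum S \<gamma>) \<pi> \<le> ennreal ((ln (threshold \<gamma>) + C) / (I - \<delta>))"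
proof -
  have "\<forall>m\<in>{1..num_hyp S}. \<exists>C\<ge>0. \<forall>\<gamma>\<ge>1. WADD_hyp S m (glr_cusum S \<gamma>) \<pi> \<le> ennreal ((ln (threshold \<gamma>) + C) / (I - \<delta>))"
  proof
    fix m assume m: "m \<in> {1..num_hyp S}"
    obtain h' where h': "\<forall>v\<in>A. h' v - step (snd \<pi>) h' v + I - \<delta> / 2 \<le> kl m (hd v)"
      using h[OF m, of "\<delta> / 2"] \<delta>(1) by auto
    have "\<exists>C\<ge>0. \<forall>\<gamma>\<ge>1. WADD_hyp S m (glr_cusum S \<gamma>) \<pi> \<le> ennreal ((ln (threshold \<gamma>) + C) / ((I - \<delta> / 2) - \<delta> / 2))"
      by (rule WADD_hyp_le[OF m \<pi> A(1,2), of h' "I - \<delta> / 2" "\<delta> / 2"]) (use A(3) h' \<delta> in \<open>auto simp: algebra_simps\<close>)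
    then show "\<exists>C\<ge>0. \<forall>\<gamma>\<ge>1. WADD_hyp S m (glr_cusum S \<gamma>) \<pi> \<le> ennreal ((ln (threshold \<gamma>) + C) / (I - \<delta>))" by simp
  qed
  then obtain C where C: "\<And>m. m \<in> {1..num_hyp S} \<Longrightarrow> 0 \<le> C m"
    "\<And>m \<gamma>. m \<in> {1..num_hyp S} \<Longrightarrow> 1 \<le> \<gamma> \<Longrightarrow>
       WADD_hyp S m (glr_cusum S \<gamma>) \<pi> \<le> ennreal ((ln (threshold \<gamma>) + C m) / (I - \<delta>))"
    by metis
  have "WADD S (glr_cusum S \<gamma>) \<pi> \<le> ennreal ((ln (threshold \<gamma>) + (\<Sum>m=1..num_hyp S. C m)) / (I - \<delta>))"
    if \<gamma>: "1 \<le> \<gamma>" for \<gamma>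
    unfolding WADD_le_iff
  proof
    fix m assume m: "m \<in> {1..num_hyp S}"
    have "C m \<le> (\<Sum>m=1..num_hyp S. C m)" using m C(1) by (intro member_le_sum) auto
    then have "(ln (threshold \<gamma>) + C m) / (I - \<delta>) \<le> (ln (threshold \<gamma>) + (\<Sum>m=1..num_hyp S. C m)) / (I - \<delta>)"
      using \<delta> by (intro divide_right_mono) auto
    then show "WADD_hyp S m (glr_cusum S \<gamma>) \<pi> \<le> ennreal ((ln (threshold \<gamma>) + (\<Sum>m=1..num_hyp S. C m)) / (I - \<delta>))"
      using C(2)[OF m \<gamma>] by (intro order_trans[OF C(2)[OF m \<gamma>]] ennreal_leI)
  qed
  then show ?thesis by blast
qed

text \<open>The event that some window of \<open>B\<close> has been observed, with the change point placed right after it.\<close>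

lemma reach_closed_class:
  fixes \<pi> :: "'act policy"
  assumes m: "m \<le> num_hyp S" and \<pi>: "open_loop_policy W \<pi>" "W \<ge> 1"
    and B: "B \<noteq> {}" "B \<subseteq> (\<Union>k. set_pmf (chain_law (snd \<pi>) (fst \<pi>) k))"
      "\<And>w. w \<in> B \<Longrightarrow> length w = W" "\<And>w. w \<in> B \<Longrightarrow> set_pmf (snd \<pi> w) \<subseteq> B"
  obtains k F where "F \<in> sets (obs_filtration S (enat k))"
    "0 < measure (obs_measure S \<pi> (enat (Suc k)) m) F"
    "AE p in joint \<pi> (enat (Suc k)) m. observe p \<in> F \<longrightarrow> (\<forall>i. fst p (k + i) \<in> B)"
proof -
  obtain u k\<^sub>0 where u: "u \<in> B" "u \<in> set_pmf (chain_law (snd \<pi>) (fst \<pi>) k\<^sub>0)" using B(1,2) by blast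
  define k where "k = k\<^sub>0 + W"
  define F where "F = {\<omega> \<in> space (obs_seq_space S). \<forall>j\<in>{..<W}. fst (\<omega> (Suc (k\<^sub>0 + j))) = u ! j}"
  note ev = window_event[OF m \<pi> B(3)[OF u(1)], where k\<^sub>0 = k\<^sub>0, folded F_def]
  have stay: "AE p in joint \<pi> (enat (Suc k)) m. \<forall>k i. fst p k \<in> B \<longrightarrow> fst p (k + i) \<in> B"
    by (rule AE_windows_stay[OF m]) (rule B(4))
  show thesis
  proof (rule that[of F k])
    show "F \<in> sets (obs_filtration S (enat k))" using ev(1) by (simp add: k_def)
    show "0 < measure (obs_measure S \<pi> (enat (Suc k)) m) F" using ev(3) u(2) by (simp add: pmf_positive)
    show "AE p in joint \<pi> (enat (Suc k)) m. observe p \<in> F \<longrightarrow> (\<forall>i. fst p (k + i) \<in> B)"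
      using stay ev(2)[of "enat (Suc k)"]
    proof eventually_elim
      case (elim p)
      have "fst p (k + i) \<in> B" if "observe p \<in> F" for i
        using elim(1)[rule_format, of k\<^sub>0 "W + i"] elim(2) that u(1) by (simp add: k_def add.assoc)
      then show ?case by blast
    qed
  qed
qed

text \<open>If the worst-case delay were at most \<open>\<beta> ln \<gamma>\<close>, then a horizon of \<open>n = (ln \<gamma>)\<^sup>2\<close> steps would be long
  compared with the delay but negligible compared with \<open>\<gamma>\<close>. The required information
  \<open>ln (\<gamma> / (k + n))\<close> is then asymptotic to \<open>ln \<gamma>\<close>, but only \<open>\<beta> (I + \<epsilon>) ln \<gamma>\<close> could have arrived.\<close>

lemma WADD_hyp_eventually_gt:
  fixes \<pi> :: "'act policy"
  assumes m: "m \<in> {1..num_hyp S}" and \<pi>: "open_loop_policy W \<pi>" "W \<ge> 1"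
    and B: "B \<noteq> {}" "B \<subseteq> (\<Union>k. set_pmf (chain_law (snd \<pi>) (fst \<pi>) k))"
      "\<And>w. w \<in> B \<Longrightarrow> length w = W" "\<And>w. w \<in> B \<Longrightarrow> set_pmf (snd \<pi> w) \<subseteq> B" "finite B"
    and h: "\<And>\<epsilon>. \<epsilon> > 0 \<Longrightarrow> \<exists>h. \<forall>w\<in>B. kl m (hd w) \<le> h w - step (snd \<pi>) h w + I + \<epsilon>"
    and I: "0 \<le> I" and \<beta>: "0 < \<beta>" "\<beta> * I < 1"
  shows "\<forall>\<^sub>F \<gamma> in at_top. ennreal (\<beta> * ln \<gamma>) < WADD_hyp S m (glr_cusum S \<gamma>) \<pi>"
proof -
  have m': "m \<le> num_hyp S" using m by simp
  obtain k F where F: "F \<in> sets (obs_filtration S (enat k))"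
    and ppos: "0 < measure (obs_measure S \<pi> (enat (Suc k)) m) F"
    and BF: "AE p in joint \<pi> (enat (Suc k)) m. observe p \<in> F \<longrightarrow> (\<forall>i. fst p (k + i) \<in> B)"
    using reach_closed_class[OF m' \<pi> B(1-4)] by blast
  define p where "p = measure (obs_measure S \<pi> (enat (Suc k)) m) F"
  have p: "0 < p" using ppos by (simp add: p_def)
  (* This choice puts beta * (I + epsilon) halfway between beta * I and 1. *)
  define \<epsilon> where "\<epsilon> = (1 - \<beta> * I) / (2 * \<beta>)"
  have \<epsilon>: "0 < \<epsilon>" using \<beta> by (simp add: \<epsilon>_def)
  have slope: "\<beta> * (I + \<epsilon>) < 1" using \<beta> by (simp add: \<epsilon>_def field_simps)
  obtain h0 where h0: "\<forall>w\<in>B. kl m (hd w) \<le> h0 w - step (snd \<pi>) h0 w + I + \<epsilon>" using h[OF \<epsilon>] by blast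
  have "\<exists>h' H. (\<forall>v. \<bar>h' v\<bar> \<le> H) \<and> (\<forall>v\<in>B. h' v = h0 v \<and> step (snd \<pi>) h' v = step (snd \<pi>) h0 v)"
    by (rule bounded_on_closed[OF B(5)]) (rule B(4))
  then obtain h' H where h': "\<And>v. \<bar>h' v\<bar> \<le> H" "\<And>v. v \<in> B \<Longrightarrow> h' v = h0 v"
    "\<And>v. v \<in> B \<Longrightarrow> step (snd \<pi>) h' v = step (snd \<pi>) h0 v"
    by blast
  define a where "a \<gamma> = ln (\<gamma> / (real k + 1 + (ln \<gamma>)\<^sup>2))" for \<gamma> :: real
  define b where "b \<gamma> = p - real k / \<gamma> - \<beta> * p / ln \<gamma>" for \<gamma> :: real
  have "((\<lambda>\<gamma>. ln (\<gamma> / (K + (ln \<gamma>)\<^sup>2)) / ln \<gamma>) \<longlongrightarrow> 1) at_top" if "K > 0" for K :: real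
    using that by real_asymp
  from this[of "real k + 1"] have a1: "((\<lambda>\<gamma>. a \<gamma> / ln \<gamma>) \<longlongrightarrow> 1) at_top" by (simp add: a_def)
  have c0: "((\<lambda>\<gamma>. c / \<gamma>) \<longlongrightarrow> 0) at_top" and l0: "((\<lambda>\<gamma>. c / ln \<gamma>) \<longlongrightarrow> 0) at_top" for c :: real
    by real_asymp+
  have b1: "(b \<longlongrightarrow> p - 0 - 0) at_top"
    unfolding b_def[abs_def] by (intro tendsto_intros c0 l0)
  have "((\<lambda>\<gamma>. a \<gamma> / ln \<gamma> * b \<gamma> - (2 + 2 * H * p) / ln \<gamma>) \<longlongrightarrow> 1 * (p - 0 - 0) - 0) at_top"
    by (intro tendsto_intros a1 b1 l0)
  moreover have "\<beta> * (I + \<epsilon>) * p < 1 * (p - 0 - 0) - 0" using slope p by simp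
  ultimately have ev1: "\<forall>\<^sub>F \<gamma> in at_top. \<beta> * (I + \<epsilon>) * p < a \<gamma> / ln \<gamma> * b \<gamma> - (2 + 2 * H * p) / ln \<gamma>"
    by (rule order_tendstoD(1))
  have ev2: "\<forall>\<^sub>F \<gamma> in at_top. 0 < b \<gamma>" using order_tendstoD(1)[OF b1, of 0] p by simp
  have "\<forall>\<^sub>F \<gamma> in at_top. K + (ln \<gamma>)\<^sup>2 \<le> \<gamma>" for K :: real by real_asymp
  then have ev3: "\<forall>\<^sub>F \<gamma> in at_top. real k + 1 + (ln \<gamma>)\<^sup>2 \<le> \<gamma>" by blast
  have ev4: "\<forall>\<^sub>F \<gamma> in at_top. (1::real) \<le> ln \<gamma>" by real_asymp
  show ?thesis
    using ev1 ev2 ev3 ev4 eventually_ge_at_top[of 1]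
  proof eventually_elim
    case (elim \<gamma>)
    show ?case
    proof (rule ccontr)
      assume "\<not> ?thesis"
      then have V: "WADD_hyp S m (glr_cusum S \<gamma>) \<pi> \<le> ennreal (\<beta> * ln \<gamma>)" by (simp add: not_less)
      define n where "n = nat \<lceil>(ln \<gamma>)\<^sup>2\<rceil>"
      have sq: "1 \<le> (ln \<gamma>)\<^sup>2" using elim(4) by (simp add: one_le_power)
      have n1: "(ln \<gamma>)\<^sup>2 \<le> real n" and n2: "real n \<le> (ln \<gamma>)\<^sup>2 + 1" unfolding n_def using sq by linarith+
      have n0: "0 < n" using n1 sq by (cases n) auto
      have V0: "0 \<le> \<beta> * ln \<gamma>" using \<beta>(1) elim(4) by simp
      have nk: "real (k + n) \<le> \<gamma>" using n2 elim(3) by simp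
      have main: "ln (\<gamma> / real (k + n)) * (p - real k / \<gamma> - (\<beta> * ln \<gamma>) * p / real n)
          \<le> 2 + 2 * H * p + (I + \<epsilon>) * ((\<beta> * ln \<gamma>) * p)"
        unfolding p_def
      proof (rule WADD_hyp_ge[OF m \<pi> F h'(1) _ _ BF elim(5) V V0 n0 nk])
        show "kl m (hd w) \<le> h' w - step (snd \<pi>) h' w + (I + \<epsilon>)" if "w \<in> B" for w
          using h0 h'(2,3)[OF that] that by auto
        show "0 \<le> I + \<epsilon>" using I \<epsilon> by simp
      qed
      have "a \<gamma> \<le> ln (\<gamma> / real (k + n))"
        unfolding a_def using n0 n2 elim(5) sq by (intro ln_mono divide_left_mono) auto
      moreover have "0 \<le> a \<gamma>"
        unfolding a_def using elim(3) sq by (intro ln_ge_zero) (simp add: field_simps)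
      moreover have "b \<gamma> \<le> p - real k / \<gamma> - (\<beta> * ln \<gamma>) * p / real n"
      proof -
        have "(\<beta> * ln \<gamma>) * p / real n \<le> (\<beta> * ln \<gamma>) * p / (ln \<gamma>)\<^sup>2"
          using n1 sq p n0 \<beta>(1) elim(4) by (intro divide_left_mono mult_pos_pos mult_nonneg_nonneg) auto
        also have "\<dots> = \<beta> * p / ln \<gamma>" using elim(4) by (simp add: power2_eq_square)
        finally show ?thesis by (simp add: b_def)
      qed
      ultimately have "a \<gamma> * b \<gamma> \<le> ln (\<gamma> / real (k + n)) * (p - real k / \<gamma> - (\<beta> * ln \<gamma>) * p / real n)"
        using elim(2) by (intro mult_mono) auto
      then have "a \<gamma> * b \<gamma> - (2 + 2 * H * p) \<le> (I + \<epsilon>) * ((\<beta> * ln \<gamma>) * p)" using main by linarith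
      moreover have "(\<beta> * (I + \<epsilon>) * p) * ln \<gamma> < (a \<gamma> / ln \<gamma> * b \<gamma> - (2 + 2 * H * p) / ln \<gamma>) * ln \<gamma>"
        using elim(1,4) by (intro mult_strict_right_mono) auto
      moreover have "(a \<gamma> / ln \<gamma> * b \<gamma> - (2 + 2 * H * p) / ln \<gamma>) * ln \<gamma> = a \<gamma> * b \<gamma> - (2 + 2 * H * p)"
        using elim(4) by (simp add: left_diff_distrib)
      ultimately show False by (simp add: mult_ac)
    qed
  qed
qed

text \<open>The bound for a finite horizon \<open>n\<close>, for \<open>n \<rightarrow> \<infinity>\<close>. The delay is asymptotically at least
  \<open>\<gamma> M / (M - 1)\<close>, since \<open>M - 1\<close> statistics are left to reach a threshold made for \<open>M\<close>.\<close>

lemma WADD_hyp_degenerate_eventually_gt: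
  fixes \<pi> :: "'act policy"
  assumes m: "m \<in> {1..num_hyp S}" and \<pi>: "open_loop_policy W \<pi>" "W \<ge> 1"
    and B: "B \<noteq> {}" "B \<subseteq> (\<Union>k. set_pmf (chain_law (snd \<pi>) (fst \<pi>) k))"
      "\<And>w. w \<in> B \<Longrightarrow> length w = W" "\<And>w. w \<in> B \<Longrightarrow> set_pmf (snd \<pi> w) \<subseteq> B"
    and zero: "\<And>w. w \<in> B \<Longrightarrow> kl m (hd w) = 0"
    and r: "0 \<le> r" "r * (real (num_hyp S) - 1) < real (num_hyp S)"
  shows "\<forall>\<^sub>F \<gamma> in at_top. ennreal (r * \<gamma>) < WADD_hyp S m (glr_cusum S \<gamma>) \<pi>"
proof -
  have m': "m \<le> num_hyp S" using m by simp
  obtain k F where F: "F \<in> sets (obs_filtration S (enat k))"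
    and ppos: "0 < measure (obs_measure S \<pi> (enat (Suc k)) m) F"
    and BF: "AE p in joint \<pi> (enat (Suc k)) m. observe p \<in> F \<longrightarrow> (\<forall>i. fst p (k + i) \<in> B)"
    using reach_closed_class[OF m' \<pi> B] by blast
  define p where "p = measure (obs_measure S \<pi> (enat (Suc k)) m) F"
  have p: "0 < p" using ppos by (simp add: p_def)
  let ?M = "real (num_hyp S)"
  define d where "d = ?M - r * (?M - 1)"
  have d: "0 < d" using r by (simp add: d_def)
  show ?thesis
    using eventually_ge_at_top[of 1] eventually_gt_at_top[of "(2 * ?M * real k) / (p * d)"]
  proof eventually_elim
    case (elim \<gamma>)
    show ?case
    proof (rule ccontr)
      assume "\<not> ?thesis"
      then have V: "WADD_hyp S m (glr_cusum S \<gamma>) \<pi> \<le> ennreal (r * \<gamma>)" by (simp add: not_less)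
      have V0: "0 \<le> r * \<gamma>" using r(1) elim(1) by simp
      have le: "threshold \<gamma> * (p - real k / \<gamma> - (r * \<gamma>) * p / real n) \<le> (?M - 1) * (real k + (r * \<gamma>) * p)"
        if "0 < n" for n
        unfolding p_def by (rule WADD_hyp_degenerate[OF m F zero BF elim(1) V V0 that])
      have "(\<lambda>n. threshold \<gamma> * (p - real k / \<gamma> - (r * \<gamma>) * p / real n)) \<longlonglongrightarrow> threshold \<gamma> * (p - real k / \<gamma> - 0)"
        by (intro tendsto_intros lim_const_over_n)
      then have "threshold \<gamma> * (p - real k / \<gamma> - 0) \<le> (?M - 1) * (real k + (r * \<gamma>) * p)"
        by (rule LIMSEQ_le_const2) (intro exI[of _ 1] allI impI le, simp)
      then have "?M * \<gamma> * p - ?M * real k \<le> (?M - 1) * real k + (?M - 1) * r * \<gamma> * p"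
        using elim(1) by (simp add: algebra_simps)
      then have "\<gamma> * (p * d) \<le> 2 * ?M * real k - real k" by (simp add: d_def algebra_simps)
      then have "\<gamma> * (p * d) \<le> 2 * ?M * real k" by simp
      then have "\<gamma> \<le> (2 * ?M * real k) / (p * d)" using p d by (simp add: pos_le_divide_eq)
      then show False using elim(2) by simp
    qed
  qed
qed

text \<open>Stopping at the constant time \<open>\<lceil>\<gamma>\<rceil>\<close> is feasible and is never late by more than that.\<close>

lemma optimal_WADD_le_constant:
  assumes \<pi>: "open_loop_policy W \<pi>" and cost: "AOSC S C \<pi> \<le> ereal \<alpha>" and \<gamma>: "0 \<le> \<gamma>"
  shows "optimal_WADD S C \<alpha> W \<gamma> \<le> ennreal (\<gamma> + 1)"
proof -
  define T where "T = nat \<lceil>\<gamma>\<rceil>"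
  have T: "\<gamma> \<le> real T" "real T \<le> \<gamma> + 1" unfolding T_def using \<gamma> by linarith+
  let ?\<tau> = "\<lambda>_ :: nat \<Rightarrow> 'act \<times> 'y. enat T"
  have st: "stopping_time (obs_filtration S) ?\<tau>" by (rule stopping_time_const)
  have "ARL S ?\<tau> \<pi> = ennreal (real T)"
    unfolding ARL_def using prob_space.emeasure_space_1[OF prob_space_obs_measure[OF model le0, of \<pi> \<infinity>]]
    by (simp add: ennreal_of_nat_eq_real_of_nat)
  then have feas: "feasible S C \<alpha> W \<gamma> ?\<tau> \<pi>"
    unfolding feasible_def using st \<pi> cost T(1) by (simp add: ennreal_leI)
  have "WADD S ?\<tau> \<pi> \<le> ennreal (real T)"
    unfolding WADD_le_iff
  proof
    fix m assume "m \<in> {1..num_hyp S}"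
    then have m: "m \<le> num_hyp S" by simp
    show "WADD_hyp S m ?\<tau> \<pi> \<le> ennreal (real T)"
    proof (rule WADD_hyp_upper[OF m st])
      fix k F assume F: "F \<in> sets (obs_filtration S (enat k))"
      let ?P = "obs_measure S \<pi> (enat (Suc k)) m"
      have FP: "F \<in> sets ?P" using sets_obs_filtration_full[OF F] by simp
      have "enat T + 1 - enat (Suc k) \<le> enat T" by (simp add: one_enat_def)
      then have "ennreal_of_enat (enat T + 1 - enat (Suc k)) \<le> ennreal (real T)"
        by (metis ennreal_of_enat_enat ennreal_of_enat_le_iff ennreal_of_nat_eq_real_of_nat)
      then have "(\<integral>\<^sup>+\<omega>. indicator F \<omega> * ennreal_of_enat (enat T + 1 - enat (Suc k)) \<partial>?P) \<le> (\<integral>\<^sup>+\<omega>. ennreal (real T) * indicator F \<omega> \<partial>?P)"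
        by (intro nn_integral_mono) (auto simp: indicator_def)
      also have "\<dots> = ennreal (real T) * emeasure ?P F" by (rule nn_integral_cmult_indicator[OF FP])
      finally show "(\<integral>\<^sup>+\<omega>. indicator F \<omega> * delay ?\<tau> k \<omega> \<partial>?P) \<le> ennreal (real T) * emeasure ?P F" .
    qed
  qed
  also have "\<dots> \<le> ennreal (\<gamma> + 1)" using T(2) by (rule ennreal_leI)
  finally show ?thesis
    unfolding optimal_WADD_def using feas by (blast intro: order_trans[OF Inf_lower])
qed

text \<open>A policy of window size one competes in the problem for window size \<open>W\<close> after being lifted.\<close>

lemma optimal_WADD_le_order_one:
  assumes \<pi>: "open_loop_policy 1 \<pi>" and W: "W \<ge> 1"
    and cost: "AOSC S C \<pi> \<le> ereal \<alpha>" and \<gamma>: "1 \<le> \<gamma>"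
  shows "optimal_WADD S C \<alpha> W \<gamma> \<le> WADD S (glr_cusum S \<gamma>) \<pi>"
proof -
  have obs: "obs_measure S (lift_policy W \<pi>) \<nu> m = obs_measure S \<pi> \<nu> m" if "m \<le> num_hyp S" for \<nu> m
    by (rule obs_measure_lift_policy[OF model that \<pi> W])
  have "feasible S C \<alpha> W \<gamma> (glr_cusum S \<gamma>) (lift_policy W \<pi>)"
    unfolding feasible_def
  proof (intro conjI)
    show "stopping_time (obs_filtration S) (glr_cusum S \<gamma>)" by (rule stopping_time_glr_cusum[OF model])
    show "open_loop_policy W (lift_policy W \<pi>)" by (rule open_loop_lift_policy[OF W])
    show "ennreal \<gamma> \<le> ARL S (glr_cusum S \<gamma>) (lift_policy W \<pi>)" by (rule ARL_glr_cusum[OF \<gamma>])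
    show "AOSC S C (lift_policy W \<pi>) \<le> ereal \<alpha>" using cost unfolding AOSC_def obs[OF le0] .
  qed
  then have "optimal_WADD S C \<alpha> W \<gamma> \<le> WADD S (glr_cusum S \<gamma>) (lift_policy W \<pi>)"
    unfolding optimal_WADD_def by (blast intro: Inf_lower)
  also have "\<dots> = WADD S (glr_cusum S \<gamma>) \<pi>"
  proof -
    have "WADD_hyp S m (glr_cusum S \<gamma>) (lift_policy W \<pi>) = WADD_hyp S m (glr_cusum S \<gamma>) \<pi>" if "m \<in> {1..num_hyp S}" for m
      unfolding WADD_hyp_def using that by (simp add: obs)
    then have "(\<lambda>m. WADD_hyp S m (glr_cusum S \<gamma>) (lift_policy W \<pi>)) ` {1..num_hyp S}
        = (\<lambda>m. WADD_hyp S m (glr_cusum S \<gamma>) \<pi>) ` {1..num_hyp S}" by (rule image_cong[OF refl])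
    then show ?thesis unfolding WADD_def by (simp only:)
  qed
  finally show ?thesis .
qed

end

theorem proposition5:
  fixes S :: "('n::finite, 'act::finite, 'y) signal_model"
    and C :: "real ^ 'act ^ 'act" and \<alpha> :: real
    and W :: nat and \<pi> :: "'act policy"
  assumes model: "signal_model S"
    and KL: "finite_KL S"
    and W: "W \<ge> 1"
    and \<pi>: "open_loop_policy W \<pi>"
    and opt: "asymp_optimal S C \<alpha> W (glr_cusum S) (\<lambda>\<gamma>. \<pi>)"
  shows "\<exists>\<pi>\<^sub>1. open_loop_policy 1 \<pi>\<^sub>1 \<and> AOSC S C \<pi>\<^sub>1 = AOSC S C \<pi> \<and>
           asymp_eq (\<lambda>\<gamma>. WADD S (glr_cusum S \<gamma>) \<pi>\<^sub>1) (\<lambda>\<gamma>. WADD S (glr_cusum S \<gamma>) \<pi>)"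
proof -
  interpret detection_model S by unfold_locales (rule model, rule KL)
  let ?Ms = "{1..num_hyp S}"
  have Ms: "finite ?Ms" "?Ms \<noteq> {}" using num_hyp_ge_1 by auto
  obtain \<pi>\<^sub>1 A I m B where
    \<pi>1: "open_loop_policy 1 \<pi>\<^sub>1"
    and cost: "limsup (\<lambda>n. ereal (time_average (snd \<pi>\<^sub>1) (fst \<pi>\<^sub>1) (switching_cost C (snd \<pi>\<^sub>1)) n))
       = limsup (\<lambda>n. ereal (time_average (snd \<pi>) (fst \<pi>) (switching_cost C (snd \<pi>)) n))"
    and I0: "0 \<le> I"
    and A: "set_pmf (fst \<pi>\<^sub>1) \<subseteq> A" "finite A" "\<And>v. v \<in> A \<Longrightarrow> set_pmf (snd \<pi>\<^sub>1 v) \<subseteq> A"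
    and lower: "\<And>m \<epsilon>. m \<in> ?Ms \<Longrightarrow> \<epsilon> > 0 \<Longrightarrow>
       \<exists>h. \<forall>v\<in>A. h v - step (snd \<pi>\<^sub>1) h v + I - \<epsilon> \<le> kl m (hd v)"
    and m: "m \<in> ?Ms" and B: "B \<noteq> {}" "finite B" "B \<subseteq> (\<Union>k. set_pmf (chain_law (snd \<pi>) (fst \<pi>) k))"
    "\<And>w. w \<in> B \<Longrightarrow> length w = W" "\<And>w. w \<in> B \<Longrightarrow> set_pmf (snd \<pi> w) \<subseteq> B"
    and upper: "\<And>\<epsilon>. \<epsilon> > 0 \<Longrightarrow> \<exists>h. \<forall>w\<in>B. kl m (hd w) \<le> h w - step (snd \<pi>) h w + I + \<epsilon>"
    and degenerate: "\<And>w. I = 0 \<Longrightarrow> w \<in> B \<Longrightarrow> kl m (hd w) = 0"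
    by (rule order_one_policy[OF \<pi> W Ms, of kl C]) (use kl_facts(1) in blast)+
  have AOSC: "AOSC S C \<pi>\<^sub>1 = AOSC S C \<pi>"
    using cost AOSC_eq_time_average[OF \<pi> W] AOSC_eq_time_average[OF \<pi>1] by simp
  have feas: "AOSC S C \<pi> \<le> ereal \<alpha>" using opt unfolding asymp_optimal_def feasible_def by auto
  define V where "V \<gamma> = WADD S (glr_cusum S \<gamma>) \<pi>" for \<gamma>
  define V\<^sub>1 where "V\<^sub>1 \<gamma> = WADD S (glr_cusum S \<gamma>) \<pi>\<^sub>1" for \<gamma>
  define Opt where "Opt = optimal_WADD S C \<alpha> W"
  have lim: "((\<lambda>\<gamma>. V \<gamma> / Opt \<gamma>) \<longlongrightarrow> 1) at_top"
    using opt unfolding asymp_optimal_def asymp_eq_def V_def Opt_def by simp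
  have ratio_lt: "\<forall>\<^sub>F \<gamma> in at_top. V \<gamma> / Opt \<gamma> < ennreal (1 + \<eta>)" if "0 < \<eta>" for \<eta>
    by (rule order_tendstoD(2)[OF lim]) (use that in \<open>simp add: ennreal_less_iff flip: ennreal_1\<close>)
  have ratio_gt: "\<forall>\<^sub>F \<gamma> in at_top. ennreal (1 / 2) < V \<gamma> / Opt \<gamma>"
    by (rule order_tendstoD(1)[OF lim], subst ennreal_1[symmetric], subst ennreal_less_iff) simp_all
  have V_ge: "WADD_hyp S m (glr_cusum S \<gamma>) \<pi> \<le> V \<gamma>" for \<gamma>
    unfolding V_def by (rule WADD_hyp_le_WADD[OF m])
  (* If the rate were 0, the delay of the GLR procedure would exceed r gamma for every
     r < M / (M - 1), while a constant stopping time achieves gamma + 1. *)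
  have Ipos: "0 < I"
  proof (rule ccontr)
    assume "\<not> 0 < I"
    then have Iz: "I = 0" using I0 by simp
    let ?M = "real (num_hyp S)"
    have M: "1 \<le> ?M" using num_hyp_ge_1 by simp
    (* Any constant strictly between 1 and M / (M - 1) would do. *)
    define r where "r = 1 + 1 / (2 * ?M)"
    have "r * (?M - 1) < ?M" using M by (simp add: r_def field_simps)
    moreover have "0 \<le> r" using M by (simp add: r_def)
    ultimately have "\<forall>\<^sub>F \<gamma> in at_top. ennreal (r * \<gamma>) < WADD_hyp S m (glr_cusum S \<gamma>) \<pi>"
      using WADD_hyp_degenerate_eventually_gt[OF m \<pi> W B(1,3) _ _ degenerate[OF Iz]] B(4,5) by blast
    moreover have "\<forall>\<^sub>F \<gamma> in at_top. V \<gamma> / Opt \<gamma> < ennreal (1 + 1 / (4 * ?M))" using M by (intro ratio_lt) simp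
    ultimately have "eventually (\<lambda>\<gamma> :: real. False) at_top"
      using ratio_gt eventually_ge_at_top[of "8 * ?M"]
    proof eventually_elim
      case (elim \<gamma>)
      have \<gamma>: "0 \<le> \<gamma>" using elim(4) M by linarith
      obtain a b where ab: "V \<gamma> = ennreal a" "Opt \<gamma> = ennreal b" "0 < a" "0 < b" "a / b < 1 + 1 / (4 * ?M)"
        by (rule ennreal_ratio_real[OF elim(2,3)])
      have "ennreal b \<le> ennreal (\<gamma> + 1)"
        using optimal_WADD_le_constant[OF \<pi> feas \<gamma>] ab(2) unfolding Opt_def by (simp only:)
      then have "b \<le> \<gamma> + 1" using \<gamma> by (simp add: ennreal_le_iff del: ennreal_plus)
      moreover have "r * \<gamma> < a"
        using less_le_trans[OF elim(1) V_ge] ab(1,3) \<gamma> \<open>0 \<le> r\<close> by (simp add: ennreal_less_iff)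
      moreover define x where "x = 1 / (4 * ?M)"
      moreover have "a < (1 + x) * b" using ab(4,5) by (simp add: pos_divide_less_eq x_def)
      moreover have "(1 + x) * b \<le> (1 + x) * (\<gamma> + 1)"
        using calculation(1) M by (intro mult_left_mono) (auto simp: x_def)
      ultimately have "r * \<gamma> < (1 + x) * (\<gamma> + 1)" by linarith
      moreover have "r = 1 + 2 * x" by (simp add: r_def x_def)
      ultimately have "x * \<gamma> < 1 + x" by (simp add: algebra_simps)
      then have "\<gamma> < 4 * ?M + 1" using M by (simp add: x_def field_simps)
      then show False using elim(4) M by linarith
    qed
    then show False by simp
  qed
  (* V is at least (1 - s) / I times ln gamma, and V1 at most ln gamma / ((1 - s) I) plus a constant;
     s is chosen such that the quotient of the two bounds has a limit below 1 + eta. The lower bound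
     on V1 / V comes from the optimality of the given policy. *)
  have close: "\<forall>\<^sub>F \<gamma> in at_top. \<exists>v v\<^sub>1. V \<gamma> = ennreal v \<and> V\<^sub>1 \<gamma> = ennreal v\<^sub>1 \<and> 0 < v \<and> 0 \<le> v\<^sub>1 \<and> \<bar>v\<^sub>1 / v - 1\<bar> < \<eta>"
    if \<eta>: "0 < \<eta>" for \<eta>
  proof -
    define s where "s = \<eta> / (4 * (1 + \<eta>))"
    have s: "0 < s" "s < 1" using \<eta> by (simp_all add: s_def field_simps)
    have "1 < (1 + \<eta>) * (1 - 2 * s)" using \<eta> by (auto simp: s_def field_simps intro!: add_pos_pos)
    also have "\<dots> \<le> (1 + \<eta>) * ((1 - s) * (1 - s))" using \<eta> by (intro mult_left_mono) (auto simp: algebra_simps)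
    finally have s2: "1 < (1 + \<eta>) * ((1 - s) * (1 - s))" .
    define \<beta> where "\<beta> = (1 - s) / I"
    have \<beta>: "0 < \<beta>" "\<beta> * I < 1" using s Ipos by (simp_all add: \<beta>_def)
    have \<delta>: "0 < s * I" "s * I < I" using s Ipos by simp_all
    obtain K where K: "\<And>\<gamma>. 1 \<le> \<gamma> \<Longrightarrow> V\<^sub>1 \<gamma> \<le> ennreal ((ln (threshold \<gamma>) + K) / (I - s * I))"
      using WADD_glr_le[OF \<pi>1 order_refl A(2,1) _ lower \<delta>] A(3) unfolding V\<^sub>1_def by blast
    define g where "g \<gamma> = (ln (real (num_hyp S)) + ln \<gamma> + K) / (I - s * I)" for \<gamma>
    have K': "V\<^sub>1 \<gamma> \<le> ennreal (g \<gamma>)" if "1 \<le> \<gamma>" for \<gamma>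
      using K[OF that] that num_hyp_ge_1 by (simp add: g_def ln_mult)
    have "((\<lambda>\<gamma>::real. (c + ln \<gamma>) / ln \<gamma>) \<longlongrightarrow> 1) at_top" for c by real_asymp
    from tendsto_divide[OF this[of "ln (real (num_hyp S)) + K"] tendsto_const[of "(I - s * I) * \<beta>"]]
    have "((\<lambda>\<gamma>. g \<gamma> / (\<beta> * ln \<gamma>)) \<longlongrightarrow> 1 / ((I - s * I) * \<beta>)) at_top"
      using \<beta> \<delta> s(2) by (simp add: g_def field_simps)
    moreover have "1 / ((I - s * I) * \<beta>) < 1 + \<eta>"
    proof -
      have "(I - s * I) * \<beta> = (1 - s) * (1 - s)" using Ipos by (simp add: \<beta>_def field_simps)
      then show ?thesis using s2 s by (simp add: pos_divide_less_eq)
    qed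
    ultimately have ev1: "\<forall>\<^sub>F \<gamma> in at_top. g \<gamma> / (\<beta> * ln \<gamma>) < 1 + \<eta>" by (rule order_tendstoD(2))
    have ev2: "\<forall>\<^sub>F \<gamma> in at_top. ennreal (\<beta> * ln \<gamma>) < WADD_hyp S m (glr_cusum S \<gamma>) \<pi>"
      by (rule WADD_hyp_eventually_gt[OF m \<pi> W B(1,3) _ _ B(2) upper I0 \<beta>]) (use B(4,5) in auto)
    show ?thesis
      using ev1 ev2 ratio_lt[OF \<eta>] ratio_gt eventually_gt_at_top[of 1]
    proof eventually_elim
      case (elim \<gamma>)
      obtain v b where vb: "V \<gamma> = ennreal v" "Opt \<gamma> = ennreal b" "0 < v" "0 < b" "v / b < 1 + \<eta>"
        by (rule ennreal_ratio_real[OF elim(3,4)])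
      have "V\<^sub>1 \<gamma> < top" by (rule le_less_trans[OF K']) (use elim(5) in auto)
      then obtain v1 where v1: "V\<^sub>1 \<gamma> = ennreal v1" "0 \<le> v1" by (cases "V\<^sub>1 \<gamma>") auto
      have "Opt \<gamma> \<le> V\<^sub>1 \<gamma>"
        unfolding Opt_def V\<^sub>1_def
        by (rule optimal_WADD_le_order_one[OF \<pi>1 W]) (use AOSC feas elim(5) in auto)
      then have "b \<le> v1" using v1 vb(2) by (simp add: ennreal_le_iff)
      then have "b / v \<le> v1 / v" using vb(3) by (intro divide_right_mono) auto
      moreover have "1 / (1 + \<eta>) < b / v" using vb \<eta> by (simp add: field_simps)
      moreover have "1 - \<eta> < 1 / (1 + \<eta>)" using \<eta> by (simp add: field_simps)
      ultimately have lo: "1 - \<eta> < v1 / v" by linarith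
      have lnpos: "0 < \<beta> * ln \<gamma>" using \<beta>(1) elim(5) by simp
      have "\<beta> * ln \<gamma> < v" using less_le_trans[OF elim(2) V_ge] vb(1,3) lnpos by (simp add: ennreal_less_iff)
      moreover have "v1 \<le> g \<gamma>"
      proof -
        have "0 < b" "b \<le> v1" by fact+
        then have "0 < v1" by simp
        then show ?thesis using K'[of \<gamma>] elim(5) v1 by (simp add: ennreal_le_iff2)
      qed
      ultimately have "v1 / v \<le> g \<gamma> / (\<beta> * ln \<gamma>)" using v1(2) lnpos by (intro frac_le) auto
      then have "v1 / v < 1 + \<eta>" using elim(1) by linarith
      then have "\<bar>v1 / v - 1\<bar> < \<eta>" using lo by (simp add: abs_less_iff)
      then show ?case using vb v1 by blast
    qed
  qed
  have "((\<lambda>\<gamma>. enn2real (V\<^sub>1 \<gamma>) / enn2real (V \<gamma>)) \<longlongrightarrow> 1) at_top"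
  proof (rule tendstoI)
    fix \<eta> :: real assume "0 < \<eta>"
    from close[OF this] show "\<forall>\<^sub>F \<gamma> in at_top. dist (enn2real (V\<^sub>1 \<gamma>) / enn2real (V \<gamma>)) 1 < \<eta>"
      by eventually_elim (auto simp: dist_real_def)
  qed
  then have "((\<lambda>\<gamma>. ennreal (enn2real (V\<^sub>1 \<gamma>) / enn2real (V \<gamma>))) \<longlongrightarrow> ennreal 1) at_top"
    by (rule tendsto_ennrealI)
  moreover have "\<forall>\<^sub>F \<gamma> in at_top. ennreal (enn2real (V\<^sub>1 \<gamma>) / enn2real (V \<gamma>)) = V\<^sub>1 \<gamma> / V \<gamma>"
    using close[of 1] by (rule eventually_mono) (auto simp: divide_ennreal)
  ultimately have "((\<lambda>\<gamma>. V\<^sub>1 \<gamma> / V \<gamma>) \<longlongrightarrow> ennreal 1) at_top" by (rule Lim_transform_eventually)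
  then have "asymp_eq V\<^sub>1 V" unfolding asymp_eq_def by simp
  then show ?thesis using \<pi>1 AOSC unfolding V_def[abs_def] V\<^sub>1_def[abs_def] by blast
qed

end
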